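(* Let $\Omega\subset\mathbb R^2$ be an open, bounded, simply connected set with Lipschitz boundary. Let $(\alpha_j)_j\subset(0,1)$, $(\rho_j)_j\subset(0,1)$ and $(N_j)_j\subset\mathbb N$ be sequences such that, as $j\to\infty$: $\alpha_j\to0$, $\rho_j\to 0$, $N_j\to\infty$, $\alpha_j\log\rho_j\to 0$, $N_j\rho_j^2\to 0$, and $N_j\alpha_j\to\infty$. Let $\mathcal F^{\rm super}_{\alpha_j}$, $\mathcal F^{\rm super}$ be the functionals defined in the context. Consider the convergence $$\text{(a)}\quad \frac1{N_j}\mathcal I^{\alpha_j}_{\rho_j}\beta_j^{\rm sym}\rightharpoonup\beta\ \text{ weakly in }L^2(\Omega;\mathbb R^{2\times2}_{\rm sym})\text{ as }j\to\infty.$$ (i) (Compactness) Let $(\mu_j,\beta_j)_j\subset\mathcal M(\mathbb R^2;\mathbb R^2)\times L^1_{\rm loc}(\mathbb R^2;\mathbb R^{2\times2})$ satisfy $\sup_{j}\mathcal F^{\rm super}_{\alpha_j}(\mu_j,\beta_j)<\infty$. Then there exist a (not relabeled) subsequence and $\beta\in L^2(\Omega;\mathbb R^{2\times2}_{\rm sym})$ such that (a) holds. (ii) ($\Gamma$-liminf inequality) Let $(\mu_j,\beta_j)_j\subset\mathcal M(\mathbb R^2;\mathbb R^2)\times L^1_{\rm loc}(\mathbb R^2;\mathbb R^{2\times2})$ and $\beta\in L^2(\Omega;\mathbb R^{2\times2}_{\rm sym})$ satisfy (a). Then $$\liminf_{j\to\infty}\mathcal F^{\rm super}_{\alpha_j}(\mu_j,\beta_j)\ge\mathcal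 F^{\rm super}(\beta).$$ (iii) ($\Gamma$-limsup inequality) For all $\beta\in L^2(\Omega;\mathbb R^{2\times2}_{\rm sym})$ there is a sequence $(\mu_j,\beta_j)_j\subset\mathcal M(\mathbb R^2;\mathbb R^2)\times L^1_{\rm loc}(\mathbb R^2;\mathbb R^{2\times2})$ with $\mu_j\in\mathcal X_{\alpha_j}$ and $\beta_j\in\mathcal A_{\alpha_j}(\mu_j)$ for all $j$, satisfying (a) and $$\limsup_{j\to\infty}\mathcal F^{\rm super}_{\alpha_j}(\mu_j,\beta_j)\le\mathcal F^{\rm super}(\beta).$$
   Context: Notation. $\mathcal M(\mathbb R^2;\mathbb R^2)$ is the space of (finite) $\mathbb R^2$-valued Radon measures on $\mathbb R^2$. $B_r(x)$ is the open ball, $B_r=B_r(0)$; for $E\subseteq\mathbb R^2$, $E_\rho:=\{x\in\mathbb R^2:\operatorname{dist}(x,E)<\rho\}$. $F^{\rm sym}=\frac12(F+F^T)$. Functions defined on a subset of $\mathbb R^2$ are extended by $0$ to $\mathbb R^2$ when needed; conversely functions on $\mathbb R^2$ are restricted to subsets when needed. For $\beta\in L^1_{\rm loc}$ with values in $\mathbb R^{2\times2}$, $\operatorname{Curl}\beta:=(\partial_1\beta_{12}-\partial_2\beta_{11},\ \partial_1\beta_{22}-\partial_2\beta_{21})$ in the sense of distributions. Riesz potential with finite horizon. Fix $\overline w\in C^\infty([0,\infty))$ with $\operatorname{supp}\overline w\subset[0,1)$, $0\le\overline w\le1$, $\overline w=1$ on $[0,\frac12]$, $\overline w$ nonincreasing.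 For $\rho>0$ set $\overline w_\rho(t)=\overline w(t/\rho)$. For $\alpha\in(0,1)$ let $\gamma_\alpha=\frac{\pi2^\alpha\Gamma(\alpha/2)}{\Gamma((2-\alpha)/2)}$ ($\Gamma$ the Gamma function) and $$Q^{1-\alpha}_\rho(x)=\frac{2-\alpha}{\gamma_\alpha}\int_{|x|}^\infty\frac{\overline w_\rho(r)}{r^{3-\alpha}}\,dr,\quad x\in\mathbb R^2\setminus\{0\},$$ which belongs to $L^1(\mathbb R^2)$ and is supported in $B_\rho$. For $f\in L^1_{\rm loc}(\mathbb R^2)$ set $\mathcal I^\alpha_\rho f=Q^{1-\alpha}_\rho*f$ (componentwise for matrix-valued $f$). For $x\in\Omega$, $\mathcal I^\alpha_\rho\beta(x)$ depends only on $\beta|_{\Omega_\rho}$. Elasticity tensor. $\mathbb C:\mathbb R^{2\times2}\to\mathbb R^{2\times2}$ is linear with: (C1) $\mathbb CF=\mathbb CF^{\rm sym}\in\mathbb R^{2\times2}_{\rm sym}$; (C2) $\mathbb CF_1:F_2=F_1:\mathbb CF_2$; (C3) there are $0<\nu_1\le\nu_2$ with $\nu_1|F^{\rm sym}|^2\le\mathbb CF:F\le\nu_2|F^{\rm sym}|^2$ for all $F$. Admissible classes. Fix linearly independent $b_1,b_2\in\mathbb S^1$ (unit vectors in $\mathbb R^2$) and let $\mathbb S=\operatorname{span}_{\mathbb Z}\{b_1,b_2\}$. Define $$\mathcal X_{\alpha_j}=\Big\{\sum_{i=1}^M\xi_i\delta_{x_i}\in\mathcal M(\mathbb R^2;\mathbb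 R^2): M\in\mathbb N,\ \xi_i\in\mathbb S\setminus\{0\},\ B_{\rho_j}(x_i)\subset\Omega,\ |x_i-x_k|\ge2\rho_j\text{ for }i\ne k\Big\},$$ and for $\mu\in\mathcal X_{\alpha_j}$, $\mathcal A_{\alpha_j}(\mu)=\{\beta\in L^1(\Omega_{\rho_j};\mathbb R^{2\times2}):\operatorname{Curl}\beta=\mu\text{ in }\mathcal D'(\Omega_{\rho_j};\mathbb R^2)\}$. Energies. $\mathcal E_{\alpha_j}(\mu,\beta)=\frac12\int_\Omega\mathbb C\,\mathcal I^{\alpha_j}_{\rho_j}\beta:\mathcal I^{\alpha_j}_{\rho_j}\beta\,dx$. On $\mathcal M(\mathbb R^2;\mathbb R^2)\times L^1_{\rm loc}(\mathbb R^2;\mathbb R^{2\times2})$, $\mathcal F^{\rm super}_{\alpha_j}(\mu,\beta)=\frac{1}{N_j^2}\mathcal E_{\alpha_j}(\mu,\beta)$ if $\mu\in\mathcal X_{\alpha_j}$ and $\beta\in\mathcal A_{\alpha_j}(\mu)$, and $\mathcal F^{\rm super}_{\alpha_j}(\mu,\beta)=\infty$ otherwise. Limit functional. $\mathcal F^{\rm super}(\beta)=\frac12\int_\Omega\mathbb C\beta:\beta\,dx$ for $\beta\in L^2(\Omega;\mathbb R^{2\times2}_{\rm sym})$. *)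

theory Defs
  imports "HOL-Analysis.Analysis"
begin

type_synonym R2 = "real^2"
type_synonym M22 = "real^2^2"

text \<open>Matrices are indexed by rows first: \<open>F $ i $ j\<close> is $F_{ij}$. The inner product and norm of
  \<^typ>\<open>real^2^2\<close> are the Frobenius ones, so \<open>F \<bullet> G\<close> is $F : G$.\<close>

definition sym_part :: "M22 \<Rightarrow> M22" where
  "sym_part F = (1/2) *\<^sub>R (F + transpose F)"

text \<open>The guard is needed because \<^term>\<open>infdist x {} = 0\<close>.\<close>

definition enlarge :: "R2 set \<Rightarrow> real \<Rightarrow> R2 set" where
  "enlarge E \<rho> = {x. E \<noteq> {} \<and> infdist x E < \<rho>}"

text \<open>Near each boundary point, in a suitable orthonormal frame \<open>(e, n)\<close>, the set is the part of
  a ball lying strictly on one side of a Lipschitz graph.\<close>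

definition lipschitz_boundary :: "R2 set \<Rightarrow> bool" where
  "lipschitz_boundary \<Omega> \<longleftrightarrow>
     (\<forall>p\<in>frontier \<Omega>. \<exists>r>0. \<exists>e n. \<exists>g :: real \<Rightarrow> real. \<exists>L.
        norm e = 1 \<and> norm n = 1 \<and> e \<bullet> n = 0 \<and> L-lipschitz_on UNIV g \<and>
        \<Omega> \<inter> ball p r = {x \<in> ball p r. g ((x - p) \<bullet> e) < (x - p) \<bullet> n})"


section \<open>Functions\<close>

text \<open>Elements of Lebesgue spaces are given by representatives defined on the whole plane; every
  notion below depends only on the values almost everywhere on the set in question.\<close>

definition L1_loc :: "(R2 \<Rightarrow> M22) set" where
  "L1_loc = {f. \<forall>K. compact K \<longrightarrow> f absolutely_integrable_on K}"

definition L2_sym :: "R2 set \<Rightarrow> (R2 \<Rightarrow> M22) set" where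
  "L2_sym \<Omega> = {f. set_borel_measurable lebesgue \<Omega> f \<and>
                  set_integrable lebesgue \<Omega> (\<lambda>x. (norm (f x))\<^sup>2) \<and>
                  (AE x in lebesgue. x \<in> \<Omega> \<longrightarrow> transpose (f x) = f x)}"

definition weakly_L2_sym :: "R2 set \<Rightarrow> (nat \<Rightarrow> R2 \<Rightarrow> M22) \<Rightarrow> (R2 \<Rightarrow> M22) \<Rightarrow> bool" where
  "weakly_L2_sym \<Omega> f g \<longleftrightarrow>
     (\<forall>j. f j \<in> L2_sym \<Omega>) \<and> g \<in> L2_sym \<Omega> \<and>
     (\<forall>h\<in>L2_sym \<Omega>. (\<lambda>j. LINT x:\<Omega>|lebesgue. f j x \<bullet> h x)
                       \<longlonglongrightarrow> (LINT x:\<Omega>|lebesgue. g x \<bullet> h x))"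

definition partial_at :: "2 \<Rightarrow> (R2 \<Rightarrow> real) \<Rightarrow> R2 \<Rightarrow> real" where
  "partial_at i \<phi> x = frechet_derivative \<phi> (at x) (axis i 1)"

text \<open>A function is smooth iff all its iterated partial derivatives, including itself, are
  differentiable everywhere.\<close>

definition smooth_fun :: "(R2 \<Rightarrow> real) \<Rightarrow> bool" where
  "smooth_fun \<phi> \<longleftrightarrow> (\<forall>is. foldr partial_at is \<phi> differentiable_on UNIV)"

definition test_functions :: "R2 set \<Rightarrow> (R2 \<Rightarrow> real) set" where
  "test_functions U = {\<phi>. smooth_fun \<phi> \<and> compact (closure {x. \<phi> x \<noteq> 0}) \<and>
                          closure {x. \<phi> x \<noteq> 0} \<subseteq> U}"


section \<open>Vector-valued measures\<close>

text \<open>Finite vector-valued Radon measures on the plane are the countably additive set functions on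
  the Borel sets; finiteness of the total variation and regularity are then automatic. They are
  made unique as functions by the value 0 on sets that are not Borel.\<close>

definition vector_measures :: "(R2 set \<Rightarrow> R2) set" where
  "vector_measures = {\<mu>. (\<forall>A. A \<notin> sets borel \<longrightarrow> \<mu> A = 0) \<and>
     (\<forall>A :: nat \<Rightarrow> R2 set. range A \<subseteq> sets borel \<and> disjoint_family A \<longrightarrow>
        (\<lambda>n. \<mu> (A n)) sums \<mu> (\<Union>n. A n))}"

definition dirac :: "R2 \<Rightarrow> R2 \<Rightarrow> R2 set \<Rightarrow> R2" where
  "dirac \<xi> x A = (if A \<in> sets borel then indicator A x *\<^sub>R \<xi> else 0)"

text \<open>Jordan decomposition: the positive part $\nu^+(A) = \sup_{B \subseteq A} \nu(B)$ (where
  \<^const>\<open>ennreal\<close> cuts off negative values, harmlessly since $\nu(\emptyset) = 0$), and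
  $\int \phi\,d\nu = \int \phi\,d\nu^+ - \int \phi\,d(-\nu)^+$.\<close>

definition positive_part :: "(R2 set \<Rightarrow> real) \<Rightarrow> R2 measure" where
  "positive_part \<nu> = measure_of UNIV (sets borel)
     (\<lambda>A. SUP B\<in>{B \<in> sets borel. B \<subseteq> A}. ennreal (\<nu> B))"

definition signed_integral :: "(R2 set \<Rightarrow> real) \<Rightarrow> (R2 \<Rightarrow> real) \<Rightarrow> real" where
  "signed_integral \<nu> \<phi> =
     integral\<^sup>L (positive_part \<nu>) \<phi> - integral\<^sup>L (positive_part (\<lambda>A. - \<nu> A)) \<phi>"

definition measure_distr :: "(R2 set \<Rightarrow> R2) \<Rightarrow> (R2 \<Rightarrow> real) \<Rightarrow> R2" where
  "measure_distr \<mu> \<phi> = (\<chi> i. signed_integral (\<lambda>A. \<mu> A $ i) \<phi>)"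

definition curl_distr :: "R2 set \<Rightarrow> (R2 \<Rightarrow> M22) \<Rightarrow> (R2 \<Rightarrow> real) \<Rightarrow> R2" where
  "curl_distr U \<beta> \<phi> = (\<chi> i. - (LINT x:U|lebesgue.
      \<beta> x $ i $ 2 * partial_at 1 \<phi> x - \<beta> x $ i $ 1 * partial_at 2 \<phi> x))"


section \<open>Riesz potential with finite horizon\<close>

text \<open>Only the values of \<open>w\<close> on $[0,\infty)$ matter; derivatives at 0 are one-sided.\<close>

definition horizon_profile :: "(real \<Rightarrow> real) \<Rightarrow> bool" where
  "horizon_profile w \<longleftrightarrow>
     (\<forall>k. ((\<lambda>f t. vector_derivative f (at t within {0..})) ^^ k) w differentiable_on {0..}) \<and>
     closure {t \<in> {0..}. w t \<noteq> 0} \<subseteq> {0..<1} \<and>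
     (\<forall>t\<ge>0. 0 \<le> w t \<and> w t \<le> 1) \<and>
     (\<forall>t\<in>{0..1/2}. w t = 1) \<and>
     antimono_on {0..} w"

definition gamma_const :: "real \<Rightarrow> real" where
  "gamma_const \<alpha> = pi * 2 powr \<alpha> * Gamma (\<alpha> / 2) / Gamma ((2 - \<alpha>) / 2)"

definition riesz_kernel :: "(real \<Rightarrow> real) \<Rightarrow> real \<Rightarrow> real \<Rightarrow> R2 \<Rightarrow> real" where
  "riesz_kernel w \<alpha> \<rho> x =
     (2 - \<alpha>) / gamma_const \<alpha> * (LINT r:{norm x..}|lebesgue. w (r / \<rho>) / r powr (3 - \<alpha>))"

definition riesz_potential ::
  "(real \<Rightarrow> real) \<Rightarrow> real \<Rightarrow> real \<Rightarrow> (R2 \<Rightarrow> M22) \<Rightarrow> R2 \<Rightarrow> M22" where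
  "riesz_potential w \<alpha> \<rho> f x = (LINT y|lebesgue. riesz_kernel w \<alpha> \<rho> (x - y) *\<^sub>R f y)"


section \<open>Energies\<close>

definition elasticity_tensor :: "(M22 \<Rightarrow> M22) \<Rightarrow> bool" where
  "elasticity_tensor C \<longleftrightarrow> linear C \<and>
     (\<forall>F. C F = C (sym_part F) \<and> transpose (C F) = C F) \<and>
     (\<forall>F G. C F \<bullet> G = F \<bullet> C G) \<and>
     (\<exists>\<nu>1 \<nu>2. 0 < \<nu>1 \<and> \<nu>1 \<le> \<nu>2 \<and>
        (\<forall>F. \<nu>1 * (norm (sym_part F))\<^sup>2 \<le> C F \<bullet> F \<and> C F \<bullet> F \<le> \<nu>2 * (norm (sym_part F))\<^sup>2))"

definition int_span :: "R2 \<Rightarrow> R2 \<Rightarrow> R2 set" where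
  "int_span b1 b2 = {of_int k *\<^sub>R b1 + of_int l *\<^sub>R b2 | k l :: int. True}"

text \<open>The number \<open>M\<close> of dislocations may be 0, so that the zero measure is admissible.\<close>

definition admissible_measures :: "R2 set \<Rightarrow> R2 \<Rightarrow> R2 \<Rightarrow> real \<Rightarrow> (R2 set \<Rightarrow> R2) set" where
  "admissible_measures \<Omega> b1 b2 \<rho> = {\<mu> \<in> vector_measures. \<exists>(M::nat) \<xi> x.
     \<mu> = (\<lambda>A. \<Sum>i<M. dirac (\<xi> i) (x i) A) \<and>
     (\<forall>i<M. \<xi> i \<in> int_span b1 b2 - {0} \<and> ball (x i) \<rho> \<subseteq> \<Omega>) \<and>
     (\<forall>i<M. \<forall>k<M. i \<noteq> k \<longrightarrow> norm (x i - x k) \<ge> 2 * \<rho>)}"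

definition admissible_strains :: "R2 set \<Rightarrow> real \<Rightarrow> (R2 set \<Rightarrow> R2) \<Rightarrow> (R2 \<Rightarrow> M22) set" where
  "admissible_strains \<Omega> \<rho> \<mu> = {\<beta>. \<beta> absolutely_integrable_on enlarge \<Omega> \<rho> \<and>
     (\<forall>\<phi>\<in>test_functions (enlarge \<Omega> \<rho>).
        curl_distr (enlarge \<Omega> \<rho>) \<beta> \<phi> = measure_distr \<mu> \<phi>)}"

text \<open>The integrand is nonnegative for an elasticity tensor, so the energies take values in
  \<^typ>\<open>ennreal\<close>.\<close>

definition elastic_energy :: "(M22 \<Rightarrow> M22) \<Rightarrow> R2 set \<Rightarrow> (R2 \<Rightarrow> M22) \<Rightarrow> ennreal" where
  "elastic_energy C \<Omega> \<beta> = ennreal (1/2) * (\<integral>\<^sup>+x\<in>\<Omega>. ennreal (C (\<beta> x) \<bullet> \<beta> x) \<partial>lebesgue)"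

definition F_super_approx :: "(M22 \<Rightarrow> M22) \<Rightarrow> (real \<Rightarrow> real) \<Rightarrow> R2 set \<Rightarrow> R2 \<Rightarrow> R2 \<Rightarrow>
    real \<Rightarrow> real \<Rightarrow> nat \<Rightarrow> (R2 set \<Rightarrow> R2) \<Rightarrow> (R2 \<Rightarrow> M22) \<Rightarrow> ennreal" where
  "F_super_approx C w \<Omega> b1 b2 \<alpha> \<rho> N \<mu> \<beta> =
     (if \<mu> \<in> admissible_measures \<Omega> b1 b2 \<rho> \<and> \<beta> \<in> admissible_strains \<Omega> \<rho> \<mu>
      then ennreal (1 / (real N)\<^sup>2) * elastic_energy C \<Omega> (riesz_potential w \<alpha> \<rho> \<beta>)
      else \<infinity>)"

definition F_super :: "(M22 \<Rightarrow> M22) \<Rightarrow> R2 set \<Rightarrow> (R2 \<Rightarrow> M22) \<Rightarrow> ennreal" where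
  "F_super C \<Omega> \<beta> = elastic_energy C \<Omega> \<beta>"

definition rescaled_strain :: "(real \<Rightarrow> real) \<Rightarrow> real \<Rightarrow> real \<Rightarrow> nat \<Rightarrow> (R2 \<Rightarrow> M22) \<Rightarrow> R2 \<Rightarrow> M22" where
  "rescaled_strain w \<alpha> \<rho> N \<beta> =
     (\<lambda>x. (1 / real N) *\<^sub>R riesz_potential w \<alpha> \<rho> (\<lambda>y. sym_part (\<beta> y)) x)"

end

theory Submission
  imports Defs "HOL-Library.Diagonal_Subsequence"
begin

text \<open>Up to null sets \<^term>\<open>rescaled_strain\<close> is the symmetric part of the rescaled potential, so
  a finite energy is a quadratic form of it. Hence (i) is weak compactness of bounded sets in $L^2$
  and (ii) is convexity of that form.

  For (iii) it is enough to approximate \<^term>\<open>\<beta>\<close> strongly, and for this one may take for \<^term>\<open>\<beta>\<close> the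
  product of a rank-one matrix with a Lipschitz function \<^term>\<open>g\<close> of compact support; rotating, the curl
  becomes a divergence. On a square lattice of width $s = N^{-1/2}$, carry through each cell in
  a fixed coordinate direction the constant flux $\lfloor N s g\rfloor$. Neighbouring cells differ
  by integers bounded by the Lipschitz constant plus 1; this excess is fanned out between the common
  edge and the centre of the cell, so that the divergence is a sum of integer multiples of Dirac masses
  at the centres. The bulk is $N g + o(N)$ uniformly, while each fan is at most $1/|x|$ and its
  potential at most a multiple of $|x|^{\alpha-1}$, so that the $N$ fans contribute
  $O(N/\alpha) = o(N^2)$ to the squared norm.\<close>

text \<open>The width with N s^2 = 1 is a balance: there are of order 1/s^2 = N cells, and N s g
  changes by at most L N s^2 = L between neighbouring centres, so that both the number of the fans
  and their strengths are controlled. The factor 1/\<alpha> in their energy is the integral of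
  |x|^(2\<alpha>-2) over a disc. The other hypotheses make the construction legitimate: N \<rho>^2
  -> 0 makes \<rho> small against s, so that the centres are far enough apart, and \<alpha> log
  \<rho> -> 0 sends the mass of the kernel to 1, so that the potential acts on the bulk as an
  approximate identity. Compact support of g inside the domain leaves room for the balls around the
  centres. Two obstacles shape the details. A potential is a Bochner integral with default value 0
  where it diverges, so that it commutes with the symmetric part only almost everywhere. And the
  pairs in (iii) are required for every j, while the approximation succeeds only for large j; hence
  each j takes an almost optimal admissible pair, the zero pair being always available.\<close>

section \<open>Weak compactness in $L^2$\<close>

definition L2 :: "'a measure \<Rightarrow> ('a \<Rightarrow> 'b::euclidean_space) set" where
  "L2 M = {f \<in> borel_measurable M. integrable M (\<lambda>x. (norm (f x))\<^sup>2)}"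

definition ip :: "'a measure \<Rightarrow> ('a \<Rightarrow> 'b::euclidean_space) \<Rightarrow> ('a \<Rightarrow> 'b) \<Rightarrow> real" where
  "ip M f g = (\<integral>x. f x \<bullet> g x \<partial>M)"

lemma L2_measurable [measurable_dest]: "f \<in> L2 M \<Longrightarrow> f \<in> borel_measurable M"
  by (simp add: L2_def)

lemma L2_integrable_inner:
  assumes "f \<in> L2 M" "g \<in> L2 M" shows "integrable M (\<lambda>x. f x \<bullet> g x)"
proof (rule Bochner_Integration.integrable_bound)
  show "integrable M (\<lambda>x. (norm (f x))\<^sup>2 + (norm (g x))\<^sup>2)"
    using assms by (simp add: L2_def)
  show "(\<lambda>x. f x \<bullet> g x) \<in> borel_measurable M"
    using assms[THEN L2_measurable] by measurable
  show "AE x in M. norm (f x \<bullet> g x) \<le> norm ((norm (f x))\<^sup>2 + (norm (g x))\<^sup>2)"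
  proof (rule AE_I2)
    fix x
    have "norm (f x \<bullet> g x) \<le> norm (f x) * norm (g x)"
      by (simp add: Cauchy_Schwarz_ineq2)
    also have "\<dots> \<le> (norm (f x))\<^sup>2 + (norm (g x))\<^sup>2"
      using sum_squares_bound[of "norm (f x)" "norm (g x)"]
        mult_nonneg_nonneg[OF norm_ge_zero[of "f x"] norm_ge_zero[of "g x"]] by linarith
    finally show "norm (f x \<bullet> g x) \<le> norm ((norm (f x))\<^sup>2 + (norm (g x))\<^sup>2)" by simp
  qed
qed

lemma L2_integrable_sq: "f \<in> L2 M \<Longrightarrow> integrable M (\<lambda>x. (norm (f x))\<^sup>2)"
  by (simp add: L2_def)

lemma L2I_bound:
  assumes "f \<in> borel_measurable M" "integrable M h" "\<And>x. x \<in> space M \<Longrightarrow> (norm (f x))\<^sup>2 \<le> h x"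
  shows "f \<in> L2 M"
  unfolding L2_def
proof (intro CollectI conjI)
  show "integrable M (\<lambda>x. (norm (f x))\<^sup>2)"
  proof (rule Bochner_Integration.integrable_bound[OF assms(2)])
    show "(\<lambda>x. (norm (f x))\<^sup>2) \<in> borel_measurable M" using assms(1) by measurable
    show "AE x in M. norm ((norm (f x))\<^sup>2) \<le> norm (h x)"
      by (rule AE_I2) (use assms(3) in fastforce)
  qed
qed (use assms in auto)

lemma norm_add_sq_le: "(norm (a + b :: 'a::real_normed_vector))\<^sup>2 \<le> 2 * (norm a)\<^sup>2 + 2 * (norm b)\<^sup>2"
proof -
  have "(norm (a + b))\<^sup>2 \<le> (norm a + norm b)\<^sup>2"
    by (simp add: norm_triangle_ineq power_mono)
  also have "\<dots> \<le> 2 * (norm a)\<^sup>2 + 2 * (norm b)\<^sup>2"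
    using sum_squares_bound[of "norm a" "norm b"] by (simp add: power2_sum)
  finally show ?thesis .
qed

lemma L2_add: assumes "f \<in> L2 M" "g \<in> L2 M" shows "(\<lambda>x. f x + g x) \<in> L2 M"
proof (rule L2I_bound)
  show "integrable M (\<lambda>x. 2 * (norm (f x))\<^sup>2 + 2 * (norm (g x))\<^sup>2)"
    using assms by (simp add: L2_def)
qed (use assms norm_add_sq_le in \<open>auto simp: L2_def\<close>)

lemma L2_scale: assumes "f \<in> L2 M" shows "(\<lambda>x. c *\<^sub>R f x) \<in> L2 M"
  using assms by (auto simp: L2_def power_mult_distrib)

lemma L2_diff: assumes "f \<in> L2 M" "g \<in> L2 M" shows "(\<lambda>x. f x - g x) \<in> L2 M"
  using L2_add[OF assms(1) L2_scale[OF assms(2), of "-1"]] by simp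

lemma L2_zero: "(\<lambda>x. 0) \<in> L2 M" by (simp add: L2_def)

lemma L2_const: "finite_measure M \<Longrightarrow> (\<lambda>x. c) \<in> L2 M"
  by (simp add: L2_def finite_measure.integrable_const)

lemma L2_bounded_linear:
  assumes "f \<in> L2 M" "bounded_linear T" shows "(\<lambda>x. T (f x)) \<in> L2 M"
proof -
  obtain K where K: "\<And>x. norm (T x) \<le> norm x * K" "K > 0"
    using bounded_linear.pos_bounded[OF assms(2)] by blast
  show ?thesis
  proof (rule L2I_bound)
    show "integrable M (\<lambda>x. K\<^sup>2 * (norm (f x))\<^sup>2)" using assms by (simp add: L2_def)
    have "T \<in> borel_measurable borel"
      using assms(2) borel_measurable_continuous_onI linear_continuous_on by blast
    then show "(\<lambda>x. T (f x)) \<in> borel_measurable M" using L2_measurable[OF assms(1)] by measurable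
    show "(norm (T (f x)))\<^sup>2 \<le> K\<^sup>2 * (norm (f x))\<^sup>2" for x
      using power_mono[OF K(1) norm_ge_zero, of "f x" 2] by (simp add: power_mult_distrib mult.commute)
  qed
qed

lemma ip_sym: "ip M f g = ip M g f" by (simp add: ip_def inner_commute)

lemma ip_add: "\<lbrakk>f \<in> L2 M; g \<in> L2 M; h \<in> L2 M\<rbrakk> \<Longrightarrow> ip M (\<lambda>x. f x + g x) h = ip M f h + ip M g h"
  by (simp add: ip_def inner_add_left L2_integrable_inner)

lemma ip_diff: "\<lbrakk>f \<in> L2 M; g \<in> L2 M; h \<in> L2 M\<rbrakk> \<Longrightarrow> ip M (\<lambda>x. f x - g x) h = ip M f h - ip M g h"
  by (simp add: ip_def inner_diff_left L2_integrable_inner)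

lemma ip_scale: "ip M (\<lambda>x. c *\<^sub>R f x) h = c * ip M f h"
  by (simp add: ip_def)

lemma ip_self: "ip M f f = (\<integral>x. (norm (f x))\<^sup>2 \<partial>M)"
  by (simp add: ip_def power2_norm_eq_inner)

lemma ip_nonneg: "0 \<le> ip M f f" by (simp add: ip_self)

lemma ip_add_self:
  assumes "f \<in> L2 M" "g \<in> L2 M"
  shows "ip M (\<lambda>x. f x + t *\<^sub>R g x) (\<lambda>x. f x + t *\<^sub>R g x) = ip M f f + 2 * t * ip M f g + t\<^sup>2 * ip M g g"
proof -
  note L = assms L2_scale[OF assms(2), of t]
  note L' = L2_add[OF L(1,3)]
  show ?thesis
    by (simp add: ip_add[OF L(1,3) L'] ip_scale ip_sym[of M _ "\<lambda>x. f x + t *\<^sub>R g x"]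
         ip_add[OF L(1,3) L(1)] ip_add[OF L(1,3) L(2)] ip_sym[of M g f] power2_eq_square algebra_simps)
qed

lemma ip_diff_self:
  assumes "f \<in> L2 M" "g \<in> L2 M"
  shows "ip M (\<lambda>x. f x - g x) (\<lambda>x. f x - g x) = ip M f f - 2 * ip M f g + ip M g g"
  using ip_add_self[OF assms, of "-1"] by simp

text \<open>The discriminant inequality, with the degenerate case c = 0 included. It serves
  Cauchy-Schwarz and, with \<open>a = 0\<close>, the vanishing of a first variation in
  \<open>L2_riesz\<close>.\<close>

lemma quadratic_nonneg_imp:
  fixes a b c :: real
  assumes "\<And>t. 0 \<le> a + 2 * t * b + t\<^sup>2 * c" "0 \<le> c"
  shows "b\<^sup>2 \<le> a * c"
proof (cases "c = 0")
  case True
  have "b = 0"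
  proof (rule ccontr)
    assume "b \<noteq> 0"
    \<comment> \<open>For c = 0 the expression is affine in t, and this t gives it the value
      -1.\<close>
    then show False using assms(1)[of "-(a+1)/(2*b)"] True by (simp add: field_simps)
  qed
  then show ?thesis using True by simp
next
  case False
  then have c: "c > 0" using assms by simp
  have "0 \<le> a + 2 * (-b/c) * b + (-b/c)\<^sup>2 * c" by (rule assms)
  also have "\<dots> = a - b\<^sup>2 / c" using c by (simp add: field_simps power2_eq_square)
  finally show ?thesis using c by (simp add: field_simps)
qed

lemma ip_Cauchy_Schwarz_sq:
  assumes "f \<in> L2 M" "g \<in> L2 M" shows "(ip M f g)\<^sup>2 \<le> ip M f f * ip M g g"
proof (rule quadratic_nonneg_imp)
  show "0 \<le> ip M f f + 2 * t * ip M f g + t\<^sup>2 * ip M g g" for t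
    using ip_add_self[OF assms, of t] ip_nonneg[of M "\<lambda>x. f x + t *\<^sub>R g x"] by simp
qed (rule ip_nonneg)

lemma ip_Cauchy_Schwarz:
  assumes "f \<in> L2 M" "g \<in> L2 M" shows "\<bar>ip M f g\<bar> \<le> sqrt (ip M f f) * sqrt (ip M g g)"
  using real_sqrt_le_mono[OF ip_Cauchy_Schwarz_sq[OF assms]] by (simp add: real_sqrt_mult)

text \<open>Fatou's lemma turns an almost everywhere convergent subsequence into an $L^2$ limit.\<close>

lemma L2_complete:
  assumes "finite_measure M" and f: "\<And>n. f n \<in> L2 M"
    and C: "\<And>e. e > 0 \<Longrightarrow> \<exists>N. \<forall>i\<ge>N. \<forall>j\<ge>N. ip M (\<lambda>x. f i x - f j x) (\<lambda>x. f i x - f j x) < e"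
  obtains g where "g \<in> L2 M" "(\<lambda>n. ip M (\<lambda>x. f n x - g x) (\<lambda>x. f n x - g x)) \<longlonglongrightarrow> 0"
proof -
  interpret finite_measure M by fact
  \<comment> \<open>On a finite measure space Cauchy-Schwarz against the constant 1 bounds the L1
    norm by the L2 norm; the subsequence that is Cauchy almost everywhere is extracted in
    L1.\<close>
  have L1: "integrable M h" "(\<integral>x. norm (h x) \<partial>M) \<le> sqrt (ip M h h) * sqrt (measure M (space M))"
    if h: "h \<in> L2 M" for h :: "'a \<Rightarrow> 'b"
  proof -
    have a: "(\<lambda>x. norm (h x)) \<in> L2 M" using h L2_measurable[OF h] by (simp add: L2_def)
    have b: "(\<lambda>x. 1::real) \<in> L2 M" by (rule L2_const) fact
    show "integrable M h"
      using L2_integrable_inner[OF a b] L2_measurable[OF h]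
      by (intro integrable_norm_cancel[of M h]) auto
    show "(\<integral>x. norm (h x) \<partial>M) \<le> sqrt (ip M h h) * sqrt (measure M (space M))"
      using ip_Cauchy_Schwarz[OF a b] by (simp add: ip_def power2_norm_eq_inner[symmetric] power2_eq_square)
  qed
  define D where "D i j = ip M (\<lambda>x. f i x - f j x) (\<lambda>x. f i x - f j x)" for i j
  obtain r where r: "strict_mono r" "AE x in M. Cauchy (\<lambda>i. f (r i) x)"
  proof (rule cauchy_L1_AE_cauchy_subseq[of M f])
    show "integrable M (f n)" for n using L1 f by blast
    fix e :: real assume e: "e > 0"
    define m where "m = measure M (space M) + 1"
    have m: "m > 0" by (simp add: m_def add_nonneg_pos)
    obtain N where N: "\<And>i j. i \<ge> N \<Longrightarrow> j \<ge> N \<Longrightarrow> D i j < e\<^sup>2 / m"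
      using C[of "e\<^sup>2 / m"] e m unfolding D_def by auto
    have "(\<integral>x. norm (f i x - f j x) \<partial>M) < e" if "i \<ge> N" "j \<ge> N" for i j
    proof -
      have "(\<integral>x. norm (f i x - f j x) \<partial>M) \<le> sqrt (D i j) * sqrt (measure M (space M))"
        using L1(2)[OF L2_diff[OF f f]] by (simp add: D_def)
      also have "\<dots> \<le> sqrt (D i j) * sqrt m" by (intro mult_left_mono) (auto simp: m_def D_def ip_nonneg)
      also have "\<dots> < sqrt (e\<^sup>2 / m) * sqrt m" using N[OF that] m by (intro mult_strict_right_mono) auto
      also have "\<dots> = e" using e m by (simp add: real_sqrt_divide)
      finally show ?thesis .
    qed
    then show "\<exists>N. \<forall>i\<ge>N. \<forall>j\<ge>N. (\<integral>x. norm (f i x - f j x) \<partial>M) < e" by blast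
  qed
  define g where "g x = (if Cauchy (\<lambda>i. f (r i) x) then lim (\<lambda>i. f (r i) x) else 0)" for x
  have fm [measurable]: "f n \<in> borel_measurable M" for n using f L2_measurable by blast
  have g [measurable]: "g \<in> borel_measurable M"
    unfolding g_def by measurable
  have lim: "AE x in M. (\<lambda>i. f (r i) x) \<longlonglongrightarrow> g x"
    using r(2) by eventually_elim (auto simp: g_def convergent_LIMSEQ_iff Cauchy_convergent_iff)
  \<comment> \<open>The index \<open>n\<close> stays fixed while the subsequence goes to its limit,
    so that the Cauchy estimate for \<open>D n i\<close> passes to \<open>g\<close>.\<close>
  have fatou: "(\<integral>\<^sup>+x. ennreal ((norm (f n x - g x))\<^sup>2) \<partial>M) \<le> ennreal e"
    if "\<forall>i\<ge>N. D n i \<le> e" for n N e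
  proof -
    have "(\<integral>\<^sup>+x. ennreal ((norm (f n x - g x))\<^sup>2) \<partial>M) =
          (\<integral>\<^sup>+x. liminf (\<lambda>i. ennreal ((norm (f n x - f (r i) x))\<^sup>2)) \<partial>M)"
    proof (rule nn_integral_cong_AE)
      show "AE x in M. ennreal ((norm (f n x - g x))\<^sup>2) = liminf (\<lambda>i. ennreal ((norm (f n x - f (r i) x))\<^sup>2))"
        using lim
      proof eventually_elim
        case (elim x)
        then have "(\<lambda>i. ennreal ((norm (f n x - f (r i) x))\<^sup>2)) \<longlonglongrightarrow> ennreal ((norm (f n x - g x))\<^sup>2)"
          by (intro tendsto_intros tendsto_ennrealI) auto
        then show ?case using lim_imp_Liminf[OF sequentially_bot] by metis
      qed
    qed
    also have "\<dots> \<le> liminf (\<lambda>i. \<integral>\<^sup>+x. ennreal ((norm (f n x - f (r i) x))\<^sup>2) \<partial>M)"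
      by (rule nn_integral_liminf) measurable
    also have "\<dots> = liminf (\<lambda>i. ennreal (D n (r i)))"
      using L2_diff[OF f f]
      by (subst nn_integral_eq_integral) (auto simp: D_def ip_self L2_def)
    also have "\<dots> \<le> ennreal e"
    proof -
      have "\<forall>\<^sub>F i in sequentially. ennreal (D n (r i)) \<le> ennreal e"
        using eventually_ge_at_top[of N]
        by eventually_elim (metis ennreal_leI order_trans seq_suble r(1) that)
      then have "limsup (\<lambda>i. ennreal (D n (r i))) \<le> ennreal e" by (rule Limsup_bounded)
      then show ?thesis by (meson Liminf_le_Limsup order_trans sequentially_bot)
    qed
    finally show ?thesis .
  qed
  have fg: "(\<lambda>x. f n x - g x) \<in> L2 M \<and> ip M (\<lambda>x. f n x - g x) (\<lambda>x. f n x - g x) \<le> e"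
    if "\<forall>i\<ge>N. D n i \<le> e" "0 \<le> e" for n N e
  proof -
    have i: "integrable M (\<lambda>x. (norm (f n x - g x))\<^sup>2)"
      using fatou[OF that(1)] by (intro integrableI_bounded) (auto simp: le_less_trans)
    have "ennreal (ip M (\<lambda>x. f n x - g x) (\<lambda>x. f n x - g x)) \<le> ennreal e"
      using fatou[OF that(1)] by (simp add: ip_self nn_integral_eq_integral[OF i])
    then show ?thesis using i that by (simp add: L2_def)
  qed
  have ev: "\<exists>N. \<forall>n\<ge>N. (\<lambda>x. f n x - g x) \<in> L2 M \<and> ip M (\<lambda>x. f n x - g x) (\<lambda>x. f n x - g x) \<le> e" if "e > 0" for e
    using C[OF that] fg[of _ _ e] that unfolding D_def[symmetric] by (meson less_imp_le)
  obtain N where "(\<lambda>x. f N x - g x) \<in> L2 M" using ev[of 1] by auto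
  from L2_diff[OF f[of N] this] have "g \<in> L2 M" by simp
  moreover have "(\<lambda>n. ip M (\<lambda>x. f n x - g x) (\<lambda>x. f n x - g x)) \<longlonglongrightarrow> 0"
  proof (rule LIMSEQ_I)
    fix e :: real assume "e > 0"
    with ev[of "e/2"] show "\<exists>N. \<forall>n\<ge>N. norm (ip M (\<lambda>x. f n x - g x) (\<lambda>x. f n x - g x) - 0) < e"
      by (fastforce simp: ip_nonneg)
  qed
  ultimately show ?thesis by (rule that)
qed

text \<open>A minimising sequence of $\|h\|^2 - 2 l(h)$ is Cauchy by the parallelogram identity.\<close>

lemma L2_riesz:
  assumes fin: "finite_measure M" and L: "L \<subseteq> L2 M" "L \<noteq> {}"
    and add: "\<And>f g. f \<in> L \<Longrightarrow> g \<in> L \<Longrightarrow> (\<lambda>x. f x + g x) \<in> L"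
    and scale: "\<And>f c. f \<in> L \<Longrightarrow> (\<lambda>x. c *\<^sub>R f x) \<in> L"
    and l_add: "\<And>f g. f \<in> L \<Longrightarrow> g \<in> L \<Longrightarrow> l (\<lambda>x. f x + g x) = l f + l g"
    and l_scale: "\<And>f c. f \<in> L \<Longrightarrow> l (\<lambda>x. c *\<^sub>R f x) = c * l f"
    and bound: "\<And>f. f \<in> L \<Longrightarrow> l f \<le> B * sqrt (ip M f f)"
  shows "\<exists>g\<in>L2 M. (\<forall>h\<in>L. ip M g h = l h) \<and> (\<forall>e>0. \<exists>h\<in>L. ip M (\<lambda>x. h x - g x) (\<lambda>x. h x - g x) < e)"
proof -
  have L2: "h \<in> L \<Longrightarrow> h \<in> L2 M" for h using L by blast
  define J where "J h = ip M h h - 2 * l h" for h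
  \<comment> \<open>Completing the square in the norm of \<open>h\<close>.\<close>
  have Jlow: "J h \<ge> - (B\<^sup>2)" if "h \<in> L" for h
  proof -
    have "0 \<le> (sqrt (ip M h h) - B)\<^sup>2" by simp
    also have "\<dots> = ip M h h - 2 * (B * sqrt (ip M h h)) + B\<^sup>2"
      by (simp add: power2_diff ip_nonneg)
    finally show ?thesis using bound[OF that] by (simp add: J_def)
  qed
  define m where "m = Inf (J ` L)"
  have bdd: "bdd_below (J ` L)" using Jlow by (auto intro!: bdd_belowI[of _ "-(B\<^sup>2)"])
  have m_le: "m \<le> J h" if "h \<in> L" for h
    unfolding m_def using that bdd by (intro cInf_lower) auto
  have "\<exists>h\<in>L. J h < m + 1 / real (Suc n)" for n
  proof -
    have "Inf (J ` L) < m + 1 / real (Suc n)" by (simp add: m_def)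
    then show ?thesis using cInf_lessD[of "J ` L"] L(2) by auto
  qed
  then obtain h where h: "\<And>n. h n \<in> L" "\<And>n. J (h n) < m + 1 / real (Suc n)" by metis
  have par: "ip M (\<lambda>x. h i x - h j x) (\<lambda>x. h i x - h j x) < 2 / real (Suc i) + 2 / real (Suc j)" for i j
  proof -
    define k where "k = (\<lambda>x. (1/2) *\<^sub>R (h i x + h j x))"
    have s: "(\<lambda>x. h i x + h j x) \<in> L" using add h by blast
    have k: "k \<in> L" unfolding k_def by (rule scale[OF s])
    have "4 * ip M k k = ip M (\<lambda>x. h i x + h j x) (\<lambda>x. h i x + h j x)"
      unfolding k_def ip_scale by (simp add: ip_sym[of M _ "\<lambda>x. (1/2) *\<^sub>R (h i x + h j x)"] ip_scale)
    also have "\<dots> = ip M (h i) (h i) + 2 * ip M (h i) (h j) + ip M (h j) (h j)"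
      using ip_add_self[OF L2[OF h(1)[of i]] L2[OF h(1)[of j]], of 1] by simp
    finally have "ip M (\<lambda>x. h i x - h j x) (\<lambda>x. h i x - h j x) =
        2 * ip M (h i) (h i) + 2 * ip M (h j) (h j) - 4 * ip M k k"
      using ip_diff_self[OF L2[OF h(1)[of i]] L2[OF h(1)[of j]]] by simp
    also have "\<dots> = 2 * J (h i) + 2 * J (h j) - 4 * J k"
      unfolding J_def k_def l_scale[OF s] l_add[OF h(1) h(1)] by (simp add: k_def[symmetric] field_simps)
    also have "\<dots> \<le> 2 * J (h i) + 2 * J (h j) - 4 * m" using m_le[OF k] by simp
    also have "\<dots> < 2 / real (Suc i) + 2 / real (Suc j)" using h(2)[of i] h(2)[of j] by simp
    finally show ?thesis .
  qed
  obtain g where g: "g \<in> L2 M" and lim: "(\<lambda>n. ip M (\<lambda>x. h n x - g x) (\<lambda>x. h n x - g x)) \<longlonglongrightarrow> 0"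
  proof (rule L2_complete[OF fin L2[OF h(1)]])
    fix e :: real assume "e > 0"
    then obtain N where N: "inverse (real (Suc N)) < e / 4" using reals_Archimedean[of "e/4"] by auto
    have "ip M (\<lambda>x. h i x - h j x) (\<lambda>x. h i x - h j x) < e" if "i \<ge> N" "j \<ge> N" for i j
    proof -
      have "1 / real (Suc i) \<le> 1 / real (Suc N)" "1 / real (Suc j) \<le> 1 / real (Suc N)"
        using that by (auto intro!: divide_left_mono)
      then have "2 / real (Suc i) + 2 / real (Suc j) < e" using N by (simp add: inverse_eq_divide)
      then show ?thesis using par[of i j] by simp
    qed
    then show "\<exists>N. \<forall>i\<ge>N. \<forall>j\<ge>N. ip M (\<lambda>x. h i x - h j x) (\<lambda>x. h i x - h j x) < e" by blast
  qed
  have rep: "ip M g k = l k" if k: "k \<in> L" for k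
  proof -
    have lim2: "(\<lambda>n. ip M (h n) k) \<longlonglongrightarrow> ip M g k"
    proof (rule LIM_zero_cancel, rule Lim_null_comparison)
      show "\<forall>\<^sub>F n in sequentially. norm (ip M (h n) k - ip M g k) \<le>
          sqrt (ip M (\<lambda>x. h n x - g x) (\<lambda>x. h n x - g x)) * sqrt (ip M k k)"
        using ip_Cauchy_Schwarz[OF L2_diff[OF L2[OF h(1)] g] L2[OF k]] ip_diff[OF L2[OF h(1)] g L2[OF k]]
        by simp
      show "(\<lambda>n. sqrt (ip M (\<lambda>x. h n x - g x) (\<lambda>x. h n x - g x)) * sqrt (ip M k k)) \<longlonglongrightarrow> 0"
        using tendsto_mult_left_zero[OF tendsto_real_sqrt[OF lim, simplified]] by simp
    qed
    \<comment> \<open>Perturbing \<open>h n\<close> by \<open>t k\<close> lowers the functional by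
      less than 1/(n+1). In the limit this leaves a nonnegative quadratic in \<open>t\<close>
      without constant term, so its linear coefficient vanishes.\<close>
    have "0 \<le> 2 * t * (ip M g k - l k) + t\<^sup>2 * ip M k k" for t
    proof (rule tendsto_lowerbound[where F=sequentially])
      show "(\<lambda>n. 1 / real (Suc n) + (2 * t * (ip M (h n) k - l k) + t\<^sup>2 * ip M k k))
              \<longlonglongrightarrow> 2 * t * (ip M g k - l k) + t\<^sup>2 * ip M k k"
        using tendsto_add[OF LIMSEQ_inverse_real_of_nat
          tendsto_add[OF tendsto_mult[OF tendsto_const[of "2*t"] tendsto_diff[OF lim2 tendsto_const[of "l k"]]] tendsto_const[of "t\<^sup>2 * ip M k k"]]]
        by (simp add: inverse_eq_divide)
      have ml: "m \<le> J (\<lambda>x. h n x + t *\<^sub>R k x)" for n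
        by (intro m_le add h scale k)
      have "0 \<le> 1 / real (Suc n) + (2 * t * (ip M (h n) k - l k) + t\<^sup>2 * ip M k k)" for n
        using h(2)[of n] ml[of n] unfolding J_def ip_add_self[OF L2[OF h(1)] L2[OF k]] l_add[OF h(1) scale[OF k]] l_scale[OF k]
        by (simp add: algebra_simps)
      then show "\<forall>\<^sub>F n in sequentially. 0 \<le> 1 / real (Suc n) + (2 * t * (ip M (h n) k - l k) + t\<^sup>2 * ip M k k)"
        by simp
    qed auto
    then have "(ip M g k - l k)\<^sup>2 \<le> 0 * ip M k k"
      by (intro quadratic_nonneg_imp) (auto simp: ip_nonneg)
    then show ?thesis by simp
  qed
  have "\<exists>k\<in>L. ip M (\<lambda>x. k x - g x) (\<lambda>x. k x - g x) < e" if "e > 0" for e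
  proof -
    have "\<forall>\<^sub>F n in sequentially. ip M (\<lambda>x. h n x - g x) (\<lambda>x. h n x - g x) < e"
      using lim that by (rule order_tendstoD)
    then obtain n where "ip M (\<lambda>x. h n x - g x) (\<lambda>x. h n x - g x) < e" by (auto simp: eventually_sequentially)
    then show ?thesis using h(1) by blast
  qed
  then show ?thesis using g rep by blast
qed

text \<open>The diagonal argument is run on the sequence itself: a subsequence makes the pairings
  with every \<open>f k\<close> converge. The test functions with convergent pairings form a linear
  space \<open>L\<close> containing the sequence, and the limit functional on it is represented by
  some \<open>g\<close> in the closure of \<open>L\<close>. A general \<open>h\<close> is replaced
  by its projection on that closure, since the rest is orthogonal to all \<open>f n\<close> and to
  \<open>g\<close>.\<close>

theorem L2_weakly_compact:
  fixes f :: "nat \<Rightarrow> 'a \<Rightarrow> 'b::euclidean_space"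
  assumes fin: "finite_measure M" and f: "\<And>n. f n \<in> L2 M" and B: "\<And>n. ip M (f n) (f n) \<le> B"
  shows "\<exists>r g. strict_mono (r :: nat \<Rightarrow> nat) \<and> g \<in> L2 M \<and> (\<forall>h\<in>L2 M. (\<lambda>n. ip M (f (r n)) h) \<longlonglongrightarrow> ip M g h)"
proof -
  have B0: "0 \<le> B" using B[of 0] ip_nonneg order_trans by blast
  have fB: "\<bar>ip M (f n) h\<bar> \<le> sqrt B * sqrt (ip M h h)" if "h \<in> L2 M" for n h
    using ip_Cauchy_Schwarz[OF f that, of n] mult_right_mono[OF real_sqrt_le_mono[OF B[of n]], of "sqrt (ip M h h)"]
    by (simp add: ip_nonneg)
  define P where "P k s = convergent (\<lambda>j. ip M (f (s j)) (f k))" for k s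
  interpret subseqs P
  proof
    fix n and s :: "nat \<Rightarrow> nat" assume "strict_mono s"
    have "bounded (range (\<lambda>j. ip M (f (s j)) (f n)))"
      using fB[OF f] by (auto simp: bounded_iff)
    then obtain l r' where "strict_mono r'" "((\<lambda>j. ip M (f (s j)) (f n)) \<circ> r') \<longlonglongrightarrow> l"
      using bounded_imp_convergent_subsequence by blast
    then show "\<exists>r'. strict_mono r' \<and> P n (s \<circ> r')"
      by (auto simp: P_def o_def convergent_def)
  qed
  define r where "r = diagseq"
  have r: "strict_mono r" unfolding r_def by (rule subseq_diagseq)
  have conv: "convergent (\<lambda>j. ip M (f (r j)) (f k))" for k
  proof -
    have "P k (diagseq \<circ> (+) (Suc k))"
    proof (rule diagseq_holds)
      fix s' s :: "nat \<Rightarrow> nat" and n assume "strict_mono s'" "P n s"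
      then show "P n (s \<circ> s')"
        using convergent_subseq_convergent[of "\<lambda>j. ip M (f (s j)) (f n)" s'] by (simp add: P_def o_def)
    qed
    then have "convergent (\<lambda>j. ip M (f (r (j + Suc k))) (f k))"
      by (simp add: P_def r_def o_def add.commute)
    then show ?thesis using convergent_ignore_initial_segment[of "\<lambda>j. ip M (f (r j)) (f k)" "Suc k"] by simp
  qed
  define L where "L = {h \<in> L2 M. convergent (\<lambda>j. ip M (f (r j)) h)}"
  define l where "l h = lim (\<lambda>j. ip M (f (r j)) h)" for h
  have L2: "h \<in> L \<Longrightarrow> h \<in> L2 M" for h by (simp add: L_def)
  have fL: "f k \<in> L" for k using conv f by (simp add: L_def)
  have lim: "(\<lambda>j. ip M (f (r j)) h) \<longlonglongrightarrow> l h" if "h \<in> L" for h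
    using that by (simp add: L_def l_def convergent_LIMSEQ_iff)
  have ips: "ip M (f n) (\<lambda>x. h x + k x) = ip M (f n) h + ip M (f n) k" if "h \<in> L2 M" "k \<in> L2 M" for n h k
    using ip_add[OF that f] by (simp add: ip_sym)
  have ipc: "ip M (f n) (\<lambda>x. c *\<^sub>R h x) = c * ip M (f n) h" for n h c
    using ip_scale[of M c h "f n"] by (simp add: ip_sym)
  have addL: "(\<lambda>x. h x + k x) \<in> L" "l (\<lambda>x. h x + k x) = l h + l k" if "h \<in> L" "k \<in> L" for h k
  proof -
    have *: "(\<lambda>j. ip M (f (r j)) (\<lambda>x. h x + k x)) \<longlonglongrightarrow> l h + l k"
      unfolding ips[OF L2[OF that(1)] L2[OF that(2)]] by (intro tendsto_add lim that)
    then show "(\<lambda>x. h x + k x) \<in> L" using L2_add[OF L2 L2, OF that] by (auto simp: L_def convergent_def)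
    show "l (\<lambda>x. h x + k x) = l h + l k" unfolding l_def[of "\<lambda>x. h x + k x"] by (rule limI[OF *])
  qed
  have scL: "(\<lambda>x. c *\<^sub>R h x) \<in> L" "l (\<lambda>x. c *\<^sub>R h x) = c * l h" if "h \<in> L" for h c
  proof -
    have *: "(\<lambda>j. ip M (f (r j)) (\<lambda>x. c *\<^sub>R h x)) \<longlonglongrightarrow> c * l h"
      unfolding ipc by (intro tendsto_mult tendsto_const lim that)
    then show "(\<lambda>x. c *\<^sub>R h x) \<in> L" using L2_scale[OF L2, OF that] by (auto simp: L_def convergent_def)
    show "l (\<lambda>x. c *\<^sub>R h x) = c * l h" unfolding l_def[of "\<lambda>x. c *\<^sub>R h x"] by (rule limI[OF *])
  qed
  have sub: "L \<subseteq> L2 M" "L \<noteq> {}" using L2 fL by auto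
  have lB: "l h \<le> sqrt B * sqrt (ip M h h)" if "h \<in> L" for h
    using LIMSEQ_le_const2[OF lim[OF that]] fB[OF L2[OF that]] abs_le_D1 by blast
  obtain g where g: "g \<in> L2 M" "\<And>h. h \<in> L \<Longrightarrow> ip M g h = l h"
    "\<And>e. e > 0 \<Longrightarrow> \<exists>h\<in>L. ip M (\<lambda>x. h x - g x) (\<lambda>x. h x - g x) < e"
    using L2_riesz[OF fin sub addL(1) scL(1) addL(2) scL(2) lB] by blast
  have "(\<lambda>n. ip M (f (r n)) h) \<longlonglongrightarrow> ip M g h" if h: "h \<in> L2 M" for h
  proof -
    have h1: "ip M h (\<lambda>x. k x + k' x) = ip M h k + ip M h k'" if "k \<in> L" "k' \<in> L" for k k'
      using ip_add[OF L2 L2 h, OF that] by (simp add: ip_sym)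
    have h2: "ip M h (\<lambda>x. c *\<^sub>R k x) = c * ip M h k" for k c
      using ip_scale[of M c k h] by (simp add: ip_sym)
    have h3: "ip M h k \<le> sqrt (ip M h h) * sqrt (ip M k k)" if "k \<in> L" for k
      using ip_Cauchy_Schwarz[OF h L2[OF that]] by simp
    \<comment> \<open>\<open>p\<close> is the orthogonal projection of \<open>h\<close> on the
      closure of \<open>L\<close>, found as the representative of the pairing with \<open>h\<close>
      restricted to \<open>L\<close>.\<close>
    obtain p where p: "p \<in> L2 M" "\<And>k. k \<in> L \<Longrightarrow> ip M p k = ip M h k"
      "\<And>e. e > 0 \<Longrightarrow> \<exists>k\<in>L. ip M (\<lambda>x. k x - p x) (\<lambda>x. k x - p x) < e"
      using L2_riesz[OF fin sub addL(1) scL(1) h1 h2 h3] by blast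
    have fp: "ip M (f n) h = ip M (f n) p" for n
      using p(2)[OF fL[of n]] by (simp add: ip_sym)
    \<comment> \<open>\<open>g\<close> is a limit of elements of \<open>L\<close>, and
      \<open>h - p\<close> is orthogonal to \<open>L\<close>.\<close>
    have gp: "ip M g h = ip M g p"
    proof -
      define d where "d = (\<lambda>x. h x - p x)"
      have d: "d \<in> L2 M" unfolding d_def by (rule L2_diff[OF h p(1)])
      have small: "(ip M g d)\<^sup>2 \<le> e * ip M d d" if e: "e > 0" for e
      proof -
        obtain k where k: "k \<in> L" "ip M (\<lambda>x. k x - g x) (\<lambda>x. k x - g x) < e" using g(3)[OF e] by blast
        have "ip M k d = 0"
          using ip_diff[OF h p(1) L2[OF k(1)]] p(2)[OF k(1)] by (simp add: d_def ip_sym)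
        then have "(ip M g d)\<^sup>2 = (ip M (\<lambda>x. k x - g x) d)\<^sup>2"
          using ip_diff[OF L2[OF k(1)] g(1) d] by simp
        also have "\<dots> \<le> ip M (\<lambda>x. k x - g x) (\<lambda>x. k x - g x) * ip M d d"
          by (rule ip_Cauchy_Schwarz_sq[OF L2_diff[OF L2[OF k(1)] g(1)] d])
        also have "\<dots> \<le> e * ip M d d" using k(2) by (intro mult_right_mono) (auto simp: ip_nonneg)
        finally show ?thesis .
      qed
      have "(ip M g d)\<^sup>2 \<le> 0"
      proof (rule field_le_epsilon)
        fix e :: real assume e: "e > 0"
        have pos: "0 < ip M d d + 1" by (simp add: add_nonneg_pos ip_nonneg)
        have "(ip M g d)\<^sup>2 \<le> e / (ip M d d + 1) * ip M d d" using small[of "e / (ip M d d + 1)"] e pos by simp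
        also have "\<dots> \<le> e" using e pos by (simp add: field_simps)
        finally show "(ip M g d)\<^sup>2 \<le> 0 + e" by simp
      qed
      then have "ip M g d = 0" by simp
      then show ?thesis using ip_diff[OF h p(1) g(1)] by (simp add: d_def ip_sym)
    qed
    show ?thesis
      unfolding fp gp
    proof (rule LIMSEQ_I)
      fix e :: real assume e: "e > 0"
      \<comment> \<open>\<open>K\<close> bounds the norm of every \<open>f n\<close> plus that of
        \<open>g\<close>; the 1 keeps it positive.\<close>
      define K where "K = sqrt B + sqrt (ip M g g) + 1"
      have K: "K > 0" using B0 by (simp add: K_def add_nonneg_pos ip_nonneg)
      obtain k where k: "k \<in> L" "ip M (\<lambda>x. k x - p x) (\<lambda>x. k x - p x) < (e / (2 * K))\<^sup>2"
        using p(3)[of "(e / (2 * K))\<^sup>2"] e K by auto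
      define d where "d = (\<lambda>x. k x - p x)"
      have d: "d \<in> L2 M" unfolding d_def by (rule L2_diff[OF L2[OF k(1)] p(1)])
      have sd: "sqrt (ip M d d) < e / (2 * K)"
        using real_sqrt_less_mono[OF k(2)] e K by (simp add: d_def)
      have "(\<lambda>n. ip M (f (r n)) k) \<longlonglongrightarrow> ip M g k" using lim[OF k(1)] g(2)[OF k(1)] by simp
      then obtain N where N: "\<And>n. n \<ge> N \<Longrightarrow> \<bar>ip M (f (r n)) k - ip M g k\<bar> < e / 2"
        using LIMSEQ_D[of _ _ "e/2"] e by (metis half_gt_zero real_norm_def)
      have "norm (ip M (f (r n)) p - ip M g p) < e" if "n \<ge> N" for n
      proof -
        have 1: "ip M (f (r n)) p = ip M (f (r n)) k - ip M (f (r n)) d"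
          using ip_diff[OF L2[OF k(1)] p(1) f] by (simp add: d_def ip_sym)
        have 2: "ip M g p = ip M g k - ip M g d"
          using ip_diff[OF L2[OF k(1)] p(1) g(1)] by (simp add: d_def ip_sym)
        have "\<bar>ip M (f (r n)) d\<bar> + \<bar>ip M g d\<bar> \<le> (sqrt B + sqrt (ip M g g)) * sqrt (ip M d d)"
          using fB[OF d, of "r n"] ip_Cauchy_Schwarz[OF g(1) d] by (simp add: distrib_right)
        also have "\<dots> \<le> K * sqrt (ip M d d)" by (intro mult_right_mono) (auto simp: K_def ip_nonneg)
        also have "\<dots> \<le> K * (e / (2 * K))" using sd K by (intro mult_left_mono) auto
        also have "\<dots> = e / 2" using K by simp
        finally show ?thesis using N[OF that] 1 2 by (simp add: abs_if split: if_splits)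
      qed
      then show "\<exists>N. \<forall>n\<ge>N. norm (ip M (f (r n)) p - ip M g p) < e" by blast
    qed
  qed
  then show ?thesis using r g(1) by blast
qed

section \<open>Radial integrals and a Riesz convolution bound\<close>

lemma nn_integral_powr_0:
  fixes p a :: real assumes "p > -1" "a \<ge> 0"
  shows "(\<integral>\<^sup>+r. ennreal (r powr p) * indicator {0..a} r \<partial>lborel) = ennreal (a powr (p + 1) / (p + 1))"
  by (rule nn_integral_has_integral_lebesgue'[OF _ has_integral_powr_from_0[OF assms]]) simp

lemma nn_integral_powr_inf:
  fixes p a :: real assumes "p < -1" "a > 0"
  shows "(\<integral>\<^sup>+r. ennreal (r powr p) * indicator {a..} r \<partial>lborel) = ennreal (- (a powr (p + 1)) / (p + 1))"
  by (rule nn_integral_has_integral_lebesgue'[OF _ has_integral_powr_to_inf[OF assms]]) simp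

lemma emeasure_cball_R2: "r \<ge> 0 \<Longrightarrow> emeasure lborel (cball (c::R2) r) = ennreal (pi * r\<^sup>2)"
  using emeasure_cball[of r c] by (simp add: unit_ball_vol_2)

text \<open>Polar coordinates without the angle: both measures are determined by their values on
  half-lines, where the left side is the area of a disc. A negative radius gives the empty
  disc.\<close>

lemma distr_norm_R2:
  "distr lborel borel (norm :: R2 \<Rightarrow> real) = density lborel (\<lambda>r. ennreal (2 * pi * r) * indicator {0..} r)"
  (is "?M = ?N")
proof (rule measure_eqI_generator_eq[where E = "range (\<lambda>a::real. {..a})" and \<Omega> = UNIV and A = "\<lambda>n. {..real n}"])
  show "Int_stable (range (\<lambda>a::real. {..a}))"
    by (auto simp: Int_stable_def)
  have s: "sets borel = sigma_sets UNIV (range (\<lambda>a::real. {..a}))"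
    by (simp add: borel_eq_atMost)
  show "sets ?M = sigma_sets UNIV (range (\<lambda>a::real. {..a}))" by (simp add: s)
  show "sets ?N = sigma_sets UNIV (range (\<lambda>a::real. {..a}))" by (simp add: s)
  have M: "emeasure ?M {..a} = (if a < 0 then 0 else ennreal (pi * a\<^sup>2))" for a
  proof -
    have "emeasure ?M {..a} = emeasure lborel (cball (0::R2) a)"
      by (subst emeasure_distr) (auto intro!: arg_cong[where f = "emeasure lborel"])
    then show ?thesis by (auto simp: emeasure_cball_R2 cball_empty)
  qed
  have N: "emeasure ?N {..a} = (if a < 0 then 0 else ennreal (pi * a\<^sup>2))" for a
  proof (cases "a < 0")
    case True
    have "emeasure ?N {..a} = (\<integral>\<^sup>+r. 0 \<partial>(lborel :: real measure))"
      using True by (subst emeasure_density, measurable, intro nn_integral_cong) (auto simp: indicator_def)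
    then show ?thesis using True by simp
  next
    case False
    have "emeasure ?N {..a} = (\<integral>\<^sup>+r. ennreal (2 * pi) * (ennreal (r powr 1) * indicator {0..a} r) \<partial>lborel)"
      by (subst emeasure_density) (auto intro!: nn_integral_cong simp: indicator_def ennreal_mult)
    also have "\<dots> = ennreal (2 * pi) * ennreal (a\<^sup>2 / 2)"
      using False nn_integral_powr_0[of 1 a] by (subst nn_integral_cmult) auto
    finally show ?thesis using False by (simp add: ennreal_mult[symmetric])
  qed
  show "emeasure ?M X = emeasure ?N X" if "X \<in> range (\<lambda>a::real. {..a})" for X
    using that M N by auto
  show "(\<Union>i. {..real i}) = (UNIV :: real set)" using real_arch_simple by fastforce
  show "emeasure ?M {..real i} \<noteq> \<infinity>" for i by (simp add: M)
qed auto

lemma nn_integral_radial: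
  fixes f :: "real \<Rightarrow> ennreal" assumes [measurable]: "f \<in> borel_measurable borel"
  shows "(\<integral>\<^sup>+x. f (norm (x::R2)) \<partial>lborel) = (\<integral>\<^sup>+r. ennreal (2 * pi * r) * indicator {0..} r * f r \<partial>lborel)"
proof -
  have "(\<integral>\<^sup>+x. f (norm (x::R2)) \<partial>lborel) = (\<integral>\<^sup>+r. f r \<partial>distr lborel borel (norm :: R2 \<Rightarrow> real))"
    by (subst nn_integral_distr) auto
  also have "\<dots> = (\<integral>\<^sup>+r. ennreal (2 * pi * r) * indicator {0..} r * f r \<partial>lborel)"
    unfolding distr_norm_R2 by (subst nn_integral_density) auto
  finally show ?thesis .
qed

lemma nn_integral_lborel_reflect:
  fixes f :: "'a::euclidean_space \<Rightarrow> ennreal" assumes [measurable]: "f \<in> borel_measurable borel"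
  shows "(\<integral>\<^sup>+y. f (x - y) \<partial>lborel) = (\<integral>\<^sup>+y. f y \<partial>lborel)"
proof -
  have "(\<integral>\<^sup>+y. f y \<partial>lborel) = (\<integral>\<^sup>+y. f y \<partial>density (distr lborel borel (\<lambda>y::'a. x + (-1) *\<^sub>R y)) (\<lambda>_. ennreal (\<bar>-1\<bar> ^ DIM('a))))"
    using lborel_affine[of "-1" x] by simp
  also have "\<dots> = (\<integral>\<^sup>+y. f (x - y) \<partial>lborel)"
    by (subst nn_integral_density) (auto simp: nn_integral_distr)
  finally show ?thesis by simp
qed

lemma nn_integral_lborel_translate:
  fixes f :: "'a::euclidean_space \<Rightarrow> ennreal" assumes [measurable]: "f \<in> borel_measurable borel"
  shows "(\<integral>\<^sup>+y. f (y - x) \<partial>lborel) = (\<integral>\<^sup>+y. f y \<partial>lborel)"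
proof -
  have "(\<integral>\<^sup>+y. f y \<partial>lborel) = (\<integral>\<^sup>+y. f y \<partial>distr lborel borel ((+) (-x)))"
    by (subst lborel_distr_plus) simp
  also have "\<dots> = (\<integral>\<^sup>+y. f (y - x) \<partial>lborel)" by (subst nn_integral_distr) auto
  finally show ?thesis by simp
qed

text \<open>With \<^term>\<open>a = norm (x - y)\<close>, \<^term>\<open>b = norm y\<close> and \<^term>\<open>2 * R = norm x\<close>, either \<^term>\<open>a \<ge> R\<close> or
  \<^term>\<open>b \<ge> R\<close>, so the product of the two singular factors splits into a function of \<^term>\<open>a\<close> and a
  function of \<^term>\<open>b\<close>.\<close>

lemma riesz_split:
  fixes a b R \<alpha> :: real
  assumes "a > 0" "b > 0" "R > 0" "2 * R \<le> a + b" "0 < \<alpha>" "\<alpha> < 2"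
  shows "a powr (\<alpha> - 2) / b \<le> max R b powr (\<alpha> - 2) / b + a powr (\<alpha> - 2) / max R a"
proof (cases "a \<ge> b")
  case True
  then have "max R b \<le> a" using assms by auto
  then have "a powr (\<alpha> - 2) \<le> max R b powr (\<alpha> - 2)"
    using assms by (intro powr_mono2') auto
  then have "a powr (\<alpha> - 2) / b \<le> max R b powr (\<alpha> - 2) / b" using assms by (simp add: divide_right_mono)
  moreover have "0 \<le> a powr (\<alpha> - 2) / max R a" using assms by (intro divide_nonneg_nonneg) auto
  ultimately show ?thesis by linarith
next
  case False
  then have "max R a \<le> b" using assms by auto
  then have "a powr (\<alpha> - 2) / b \<le> a powr (\<alpha> - 2) / max R a" using assms by (intro divide_left_mono) auto
  moreover have "0 \<le> max R b powr (\<alpha> - 2) / b" using assms by (intro divide_nonneg_nonneg) auto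
  ultimately show ?thesis by linarith
qed

text \<open>Up to the factor 2 pi, the disc of radius R contributes R^(\<alpha>-2) R, because 1/|x|
  cancels the radial factor of the area element, and the outside contributes
  R^(\<alpha>-1)/(1-\<alpha>), at most twice as much by \<alpha> \<le> 1/2; hence the 6.\<close>

lemma riesz_radial_1:
  fixes R \<alpha> :: real assumes R: "R > 0" and \<alpha>: "0 < \<alpha>" "\<alpha> \<le> 1/2"
  shows "(\<integral>\<^sup>+x. ennreal (max R (norm (x::R2)) powr (\<alpha> - 2) / norm x) \<partial>lborel) \<le> ennreal (6 * pi * R powr (\<alpha> - 1))"
proof -
  have "(\<integral>\<^sup>+x. ennreal (max R (norm (x::R2)) powr (\<alpha> - 2) / norm x) \<partial>lborel) =
      (\<integral>\<^sup>+r. ennreal (2 * pi * r) * indicator {0..} r * ennreal (max R r powr (\<alpha> - 2) / r) \<partial>lborel)"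
    by (rule nn_integral_radial) measurable
  also have "\<dots> \<le> (\<integral>\<^sup>+r. ennreal (2 * pi * R powr (\<alpha> - 2)) * (ennreal (r powr 0) * indicator {0..R} r)
        + ennreal (2 * pi) * (ennreal (r powr (\<alpha> - 2)) * indicator {R..} r) \<partial>lborel)"
  proof (rule nn_integral_mono)
    fix r :: real
    show "ennreal (2 * pi * r) * indicator {0..} r * ennreal (max R r powr (\<alpha> - 2) / r) \<le>
       ennreal (2 * pi * R powr (\<alpha> - 2)) * (ennreal (r powr 0) * indicator {0..R} r)
        + ennreal (2 * pi) * (ennreal (r powr (\<alpha> - 2)) * indicator {R..} r)"
      by (cases "r > 0"; cases "r \<le> R")
        (auto simp: indicator_def ennreal_mult[symmetric] max_def ennreal_plus[symmetric] simp del: ennreal_plus)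
  qed
  also have "\<dots> = ennreal (2 * pi * R powr (\<alpha> - 2)) * ennreal R + ennreal (2 * pi) * ennreal (R powr (\<alpha> - 1) / (1 - \<alpha>))"
  proof -
    have "- (R powr (\<alpha> - 2 + 1)) / (\<alpha> - 2 + 1) = R powr (\<alpha> - 1) / (1 - \<alpha>)"
      by (smt (verit) minus_divide_divide)
    then have 1: "(\<integral>\<^sup>+r. (ennreal (r powr (\<alpha> - 2)) * indicator {R..} r) \<partial>lborel) = ennreal (R powr (\<alpha> - 1) / (1 - \<alpha>))"
      using nn_integral_powr_inf[of "\<alpha> - 2" R] R \<alpha> by simp
    have 2: "(\<integral>\<^sup>+r. (ennreal (r powr 0) * indicator {0..R} r) \<partial>lborel) = ennreal R"
      using nn_integral_powr_0[of 0 R] R by simp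
    show ?thesis
      by (subst nn_integral_add, measurable, subst (1 2) nn_integral_cmult, measurable) (simp only: 1 2)
  qed
  also have "\<dots> = ennreal (2 * pi * (R powr (\<alpha> - 1) + R powr (\<alpha> - 1) / (1 - \<alpha>)))"
  proof -
    have "R powr (\<alpha> - 2) * R = R powr (\<alpha> - 1)"
      using R powr_add[of R "\<alpha> - 2" 1] by simp
    then show ?thesis using R \<alpha>
      by (simp add: ennreal_mult[symmetric] ennreal_plus[symmetric] distrib_left mult.assoc del: ennreal_plus)
  qed
  also have "\<dots> \<le> ennreal (6 * pi * R powr (\<alpha> - 1))"
  proof (rule ennreal_leI)
    have "R powr (\<alpha> - 1) / (1 - \<alpha>) \<le> R powr (\<alpha> - 1) / (1/2)"
      using \<alpha> by (intro divide_left_mono) auto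
    then have "R powr (\<alpha> - 1) + R powr (\<alpha> - 1) / (1 - \<alpha>) \<le> 3 * R powr (\<alpha> - 1)" by simp
    then have "2 * pi * (R powr (\<alpha> - 1) + R powr (\<alpha> - 1) / (1 - \<alpha>)) \<le> 2 * pi * (3 * R powr (\<alpha> - 1))"
      by (rule mult_left_mono) auto
    then show "2 * pi * (R powr (\<alpha> - 1) + R powr (\<alpha> - 1) / (1 - \<alpha>)) \<le> 6 * pi * R powr (\<alpha> - 1)" by simp
  qed
  finally show ?thesis .
qed

text \<open>Here the factor with the strong singularity is kept at the origin: the inner disc gives
  a multiple of R^(\<alpha>-1)/\<alpha>, the only term that degenerates as \<alpha> tends to 0. It
  dominates the tail because \<alpha> \<le> 1-\<alpha>.\<close>

lemma riesz_radial_2: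
  fixes R \<alpha> :: real assumes R: "R > 0" and \<alpha>: "0 < \<alpha>" "\<alpha> \<le> 1/2"
  shows "(\<integral>\<^sup>+x. ennreal (norm (x::R2) powr (\<alpha> - 2) / max R (norm x)) \<partial>lborel) \<le> ennreal (4 * pi * R powr (\<alpha> - 1) / \<alpha>)"
proof -
  have "(\<integral>\<^sup>+x. ennreal (norm (x::R2) powr (\<alpha> - 2) / max R (norm x)) \<partial>lborel) =
      (\<integral>\<^sup>+r. ennreal (2 * pi * r) * indicator {0..} r * ennreal (r powr (\<alpha> - 2) / max R r) \<partial>lborel)"
    by (rule nn_integral_radial) measurable
  also have "\<dots> \<le> (\<integral>\<^sup>+r. ennreal (2 * pi / R) * (ennreal (r powr (\<alpha> - 1)) * indicator {0..R} r)
        + ennreal (2 * pi) * (ennreal (r powr (\<alpha> - 2)) * indicator {R..} r) \<partial>lborel)"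
  proof (rule nn_integral_mono)
    fix r :: real
    have *: "r * r powr (\<alpha> - 2) = r powr (\<alpha> - 1)" if "r > 0"
      using that powr_add[of r "\<alpha> - 2" 1] by (simp add: mult.commute)
    show "ennreal (2 * pi * r) * indicator {0..} r * ennreal (r powr (\<alpha> - 2) / max R r) \<le>
       ennreal (2 * pi / R) * (ennreal (r powr (\<alpha> - 1)) * indicator {0..R} r)
        + ennreal (2 * pi) * (ennreal (r powr (\<alpha> - 2)) * indicator {R..} r)"
      using R
      by (cases "r > 0"; cases "r \<le> R")
        (auto simp: indicator_def ennreal_mult[symmetric] max_def *[symmetric] mult_ac intro!: ennreal_leI)
  qed
  also have "\<dots> = ennreal (2 * pi / R) * ennreal (R powr \<alpha> / \<alpha>) + ennreal (2 * pi) * ennreal (R powr (\<alpha> - 1) / (1 - \<alpha>))"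
  proof -
    have "- (R powr (\<alpha> - 2 + 1)) / (\<alpha> - 2 + 1) = R powr (\<alpha> - 1) / (1 - \<alpha>)"
      by (smt (verit) minus_divide_divide)
    then have 1: "(\<integral>\<^sup>+r. (ennreal (r powr (\<alpha> - 2)) * indicator {R..} r) \<partial>lborel) = ennreal (R powr (\<alpha> - 1) / (1 - \<alpha>))"
      using nn_integral_powr_inf[of "\<alpha> - 2" R] R \<alpha> by simp
    have 2: "(\<integral>\<^sup>+r. (ennreal (r powr (\<alpha> - 1)) * indicator {0..R} r) \<partial>lborel) = ennreal (R powr \<alpha> / \<alpha>)"
      using nn_integral_powr_0[of "\<alpha> - 1" R] R \<alpha> by simp
    show ?thesis
      by (subst nn_integral_add, measurable, subst (1 2) nn_integral_cmult, measurable) (simp only: 1 2)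
  qed
  also have "\<dots> = ennreal (2 * pi * (R powr (\<alpha> - 1) / \<alpha> + R powr (\<alpha> - 1) / (1 - \<alpha>)))"
  proof -
    have "R powr \<alpha> / R = R powr (\<alpha> - 1)"
      using R by (simp add: powr_diff)
    then show ?thesis using R \<alpha>
      by (simp add: ennreal_mult[symmetric] ennreal_plus[symmetric] distrib_left mult.assoc del: ennreal_plus)
        (simp add: field_simps)
  qed
  also have "\<dots> \<le> ennreal (4 * pi * R powr (\<alpha> - 1) / \<alpha>)"
  proof (rule ennreal_leI)
    have "R powr (\<alpha> - 1) / (1 - \<alpha>) \<le> R powr (\<alpha> - 1) / \<alpha>"
      using \<alpha> by (intro divide_left_mono) auto
    then have "R powr (\<alpha> - 1) / \<alpha> + R powr (\<alpha> - 1) / (1 - \<alpha>) \<le> 2 * (R powr (\<alpha> - 1) / \<alpha>)" by simp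
    then have "2 * pi * (R powr (\<alpha> - 1) / \<alpha> + R powr (\<alpha> - 1) / (1 - \<alpha>)) \<le> 2 * pi * (2 * (R powr (\<alpha> - 1) / \<alpha>))"
      by (rule mult_left_mono) auto
    then show "2 * pi * (R powr (\<alpha> - 1) / \<alpha> + R powr (\<alpha> - 1) / (1 - \<alpha>)) \<le> 4 * pi * R powr (\<alpha> - 1) / \<alpha>" by simp
  qed
  finally show ?thesis .
qed

text \<open>A version, uniform in \<alpha>, of the composition rule of Riesz kernels, by which the
  potential of 1/|y| is a multiple of |x|^(\<alpha>-1). The factor \<alpha> compensates the
  1/\<alpha> of \<open>riesz_radial_2\<close>. Passing from R back to |x| costs 2^(1-\<alpha>) \<le>
  2, and 7 times 2 is rounded up to 16.\<close>

lemma riesz_convolution_bound: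
  fixes x :: R2 and \<alpha> :: real
  assumes x: "x \<noteq> 0" and \<alpha>: "0 < \<alpha>" "\<alpha> \<le> 1/2"
  shows "(\<integral>\<^sup>+y. ennreal (\<alpha> * norm (x - y) powr (\<alpha> - 2) / norm y) \<partial>lborel) \<le> ennreal (16 * pi * norm x powr (\<alpha> - 1))"
proof -
  define R where "R = norm x / 2"
  have R: "R > 0" using x by (simp add: R_def)
  let ?f = "\<lambda>y::R2. ennreal (max R (norm y) powr (\<alpha> - 2) / norm y)"
  let ?g = "\<lambda>z::R2. ennreal (norm z powr (\<alpha> - 2) / max R (norm z))"
  have ae: "AE y in lborel. y \<noteq> 0 \<and> y \<noteq> x"
    using AE_lborel_singleton[of "0::R2"] AE_lborel_singleton[of x] by eventually_elim auto
  have "(\<integral>\<^sup>+y. ennreal (\<alpha> * norm (x - y) powr (\<alpha> - 2) / norm y) \<partial>lborel) \<le> (\<integral>\<^sup>+y. ennreal \<alpha> * (?f y + ?g (x - y)) \<partial>lborel)"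
  proof (rule nn_integral_mono_AE, use ae in eventually_elim)
    fix y assume y: "y \<noteq> 0 \<and> y \<noteq> x"
    have "norm x \<le> norm (x - y) + norm y" by (metis diff_add_cancel norm_triangle_ineq)
    then have "norm (x - y) powr (\<alpha> - 2) / norm y \<le>
        max R (norm y) powr (\<alpha> - 2) / norm y + norm (x - y) powr (\<alpha> - 2) / max R (norm (x - y))"
      using y R \<alpha> by (intro riesz_split) (auto simp: R_def)
    then have "\<alpha> * norm (x - y) powr (\<alpha> - 2) / norm y \<le>
        \<alpha> * (max R (norm y) powr (\<alpha> - 2) / norm y + norm (x - y) powr (\<alpha> - 2) / max R (norm (x - y)))"
      using \<alpha> by (metis mult_left_mono order_less_imp_le times_divide_eq_right)
    then show "ennreal (\<alpha> * norm (x - y) powr (\<alpha> - 2) / norm y) \<le> ennreal \<alpha> * (?f y + ?g (x - y))"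
      using \<alpha> R by (simp add: ennreal_plus[symmetric] ennreal_mult[symmetric] le_max_iff_disj del: ennreal_plus)
  qed
  also have "\<dots> = ennreal \<alpha> * ((\<integral>\<^sup>+y. ?f y \<partial>lborel) + (\<integral>\<^sup>+y. ?g (x - y) \<partial>lborel))"
    by (subst nn_integral_cmult, measurable, subst nn_integral_add, auto)
  also have "(\<integral>\<^sup>+y. ?g (x - y) \<partial>lborel) = (\<integral>\<^sup>+y. ?g y \<partial>lborel)"
    by (rule nn_integral_lborel_reflect) measurable
  also have "ennreal \<alpha> * ((\<integral>\<^sup>+y. ?f y \<partial>lborel) + (\<integral>\<^sup>+y. ?g y \<partial>lborel)) \<le>
      ennreal \<alpha> * (ennreal (6 * pi * R powr (\<alpha> - 1)) + ennreal (4 * pi * R powr (\<alpha> - 1) / \<alpha>))"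
    by (intro mult_left_mono add_mono riesz_radial_1 riesz_radial_2 R \<alpha>) auto
  also have "\<dots> = ennreal ((6 * \<alpha> + 4) * (pi * R powr (\<alpha> - 1)))"
    using \<alpha> by (simp add: ennreal_plus[symmetric] ennreal_mult[symmetric] field_simps del: ennreal_plus)
  also have "\<dots> \<le> ennreal (16 * pi * norm x powr (\<alpha> - 1))"
  proof (rule ennreal_leI)
    have "R powr (\<alpha> - 1) = norm x powr (\<alpha> - 1) * 2 powr (1 - \<alpha>)"
      using x by (simp add: R_def powr_divide powr_diff)
    also have "\<dots> \<le> norm x powr (\<alpha> - 1) * 2"
      using \<alpha> powr_mono[of "1 - \<alpha>" 1 2] by (intro mult_left_mono) auto
    finally have r: "pi * R powr (\<alpha> - 1) \<le> pi * (norm x powr (\<alpha> - 1) * 2)" by (intro mult_left_mono) auto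
    have "(6 * \<alpha> + 4) * (pi * R powr (\<alpha> - 1)) \<le> 7 * (pi * (norm x powr (\<alpha> - 1) * 2))"
      by (rule mult_mono) (use r \<alpha> in auto)
    also have "\<dots> \<le> 16 * pi * norm x powr (\<alpha> - 1)" by simp
    finally show "(6 * \<alpha> + 4) * (pi * R powr (\<alpha> - 1)) \<le> 16 * pi * norm x powr (\<alpha> - 1)" .
  qed
  finally show ?thesis .
qed

lemma nn_integral_norm_powr_cball:
  fixes p R :: real assumes "p > -2" "R \<ge> 0"
  shows "(\<integral>\<^sup>+x. ennreal (norm (x::R2) powr p) * indicator (cball 0 R) x \<partial>lborel) = ennreal (2 * pi * R powr (p + 2) / (p + 2))"
proof -
  have "(\<integral>\<^sup>+x. ennreal (norm (x::R2) powr p) * indicator (cball 0 R) x \<partial>lborel) =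
     (\<integral>\<^sup>+x. (\<lambda>r. ennreal (r powr p) * indicator {0..R} r) (norm (x::R2)) \<partial>lborel)"
    by (intro nn_integral_cong) (auto simp: indicator_def)
  also have "\<dots> = (\<integral>\<^sup>+r. ennreal (2 * pi * r) * indicator {0..} r * (ennreal (r powr p) * indicator {0..R} r) \<partial>lborel)"
    by (rule nn_integral_radial) measurable
  also have "\<dots> = (\<integral>\<^sup>+r. ennreal (2 * pi) * (ennreal (r powr (p + 1)) * indicator {0..R} r) \<partial>lborel)"
  proof (intro nn_integral_cong)
    fix r :: real
    show "ennreal (2 * pi * r) * indicator {0..} r * (ennreal (r powr p) * indicator {0..R} r) =
      ennreal (2 * pi) * (ennreal (r powr (p + 1)) * indicator {0..R} r)"
      by (cases "r > 0") (auto simp: indicator_def ennreal_mult[symmetric] powr_add mult_ac)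
  qed
  also have "\<dots> = ennreal (2 * pi * R powr (p + 2) / (p + 2))"
    using assms nn_integral_powr_0[of "p + 1" R]
    by (subst nn_integral_cmult) (auto simp: ennreal_mult[symmetric] add.assoc)
  finally show ?thesis .
qed

section \<open>The kernel with finite horizon\<close>

text \<open>The values of \<open>w\<close> at negative arguments are arbitrary, so the last fact
  concerns \<open>w (max 0 t)\<close>, which is measurable because it is monotone on the whole
  line.\<close>

lemma horizon_profileD:
  assumes "horizon_profile w"
  shows "t \<ge> 0 \<Longrightarrow> 0 \<le> w t" "t \<ge> 0 \<Longrightarrow> w t \<le> 1" "0 \<le> t \<Longrightarrow> t \<le> 1/2 \<Longrightarrow> w t = 1" "t \<ge> 1 \<Longrightarrow> w t = 0"
    "(\<lambda>t. w (max 0 t)) \<in> borel_measurable borel"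
proof -
  note h = assms[unfolded horizon_profile_def]
  show "t \<ge> 0 \<Longrightarrow> 0 \<le> w t" "t \<ge> 0 \<Longrightarrow> w t \<le> 1" "0 \<le> t \<Longrightarrow> t \<le> 1/2 \<Longrightarrow> w t = 1" using h by auto
  show "w t = 0" if "t \<ge> 1"
  proof (rule ccontr)
    assume "w t \<noteq> 0"
    then have "t \<in> closure {t \<in> {0..}. w t \<noteq> 0}" using that closure_subset by fastforce
    then show False using h that by auto
  qed
  have "antimono_on {0..} w" using h by blast
  then have "mono (\<lambda>t. - w (max 0 t))" by (auto simp: mono_def monotone_on_def max_def)
  from borel_measurable_mono[OF this] have "(\<lambda>t. - (- w (max 0 t))) \<in> borel_measurable borel"
    by measurable
  then show "(\<lambda>t. w (max 0 t)) \<in> borel_measurable borel" by simp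
qed

lemma gamma_const_pos: "0 < \<alpha> \<Longrightarrow> \<alpha> < 1 \<Longrightarrow> gamma_const \<alpha> > 0"
  by (auto simp: gamma_const_def intro!: divide_pos_pos mult_pos_pos Gamma_real_pos)

text \<open>The mass of the kernel is $\kappa_\alpha\,\rho^\alpha$ up to the factor
  $\alpha \int_0^1 \overline w(t)\,t^{\alpha-1}\,dt \in [2^{-\alpha}, 1]$.\<close>

definition kap :: "real \<Rightarrow> real" where
  "kap \<alpha> = (2 - \<alpha>) * pi / (\<alpha> * gamma_const \<alpha>)"

text \<open>The pole of Gamma at 0 is removed by Gamma(1 + \<alpha>/2) = (\<alpha>/2)
  Gamma(\<alpha>/2); what remains is continuous at 0 with value 1.\<close>

lemma kap_tendsto: "(kap \<longlongrightarrow> 1) (at_right 0)"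
proof -
  have *: "kap \<alpha> = (2 - \<alpha>) * Gamma (1 - \<alpha> / 2) / (2 * 2 powr \<alpha> * Gamma (1 + \<alpha> / 2))" if "\<alpha> > 0" "\<alpha> < 1" for \<alpha>
  proof -
    have "\<alpha> / 2 \<notin> \<int>\<^sub>\<le>\<^sub>0" using that by (auto elim!: nonpos_Ints_cases)
    then have e1: "Gamma (1 + \<alpha> / 2) = \<alpha> / 2 * Gamma (\<alpha> / 2)"
      using Gamma_plus1[of "\<alpha> / 2"] by (simp add: add.commute[of 1 "\<alpha> / 2"])
    have e2: "(2 - \<alpha>) / 2 = 1 - \<alpha> / 2" by (simp add: field_simps)
    have *: "(2 - \<alpha>) * pi / (\<alpha> * (pi * P * G / H)) = (2 - \<alpha>) * H / (2 * P * (\<alpha> / 2 * G))"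
      if "G > 0" "H > 0" "P > 0" for G H P :: real
      using that \<open>\<alpha> > 0\<close> by (simp add: divide_simps)
    show ?thesis unfolding kap_def gamma_const_def e1 e2
      by (rule *) (use that in \<open>auto intro!: Gamma_real_pos\<close>)
  qed
  have "((\<lambda>\<alpha>::real. (2 - \<alpha>) * Gamma (1 - \<alpha> / 2) / (2 * 2 powr \<alpha> * Gamma (1 + \<alpha> / 2))) \<longlongrightarrow>
      (2 - 0) * Gamma (1 - 0 / 2) / (2 * 2 powr 0 * Gamma (1 + 0 / 2))) (at_right 0)"
    by (intro tendsto_intros) (auto simp: Gamma_eq_zero_iff)
  then have "((\<lambda>\<alpha>::real. (2 - \<alpha>) * Gamma (1 - \<alpha> / 2) / (2 * 2 powr \<alpha> * Gamma (1 + \<alpha> / 2))) \<longlongrightarrow> 1) (at_right 0)"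
    by (simp add: Gamma_1)
  moreover have "\<forall>\<^sub>F \<alpha> in at_right 0. kap \<alpha> = (2 - \<alpha>) * Gamma (1 - \<alpha> / 2) / (2 * 2 powr \<alpha> * Gamma (1 + \<alpha> / 2))"
    unfolding eventually_at_right_field using * by (intro exI[of _ 1]) auto
  ultimately show ?thesis by (subst tendsto_cong)
qed

context
  fixes w :: "real \<Rightarrow> real" and \<alpha> \<rho> :: real
  assumes w: "horizon_profile w" and \<alpha>: "0 < \<alpha>" "\<alpha> < 1" and \<rho>: "0 < \<rho>"
begin

text \<open>The integrand of the kernel as a joint function of point and radius, with the
  restriction |x| \<le> r built in, so that the order of integration can be exchanged. The
  \<open>max 0\<close> gives measurability for all real \<open>r\<close>.\<close>

private definition "h x r = (if norm (x::R2) \<le> r then w (max 0 (r / \<rho>)) / r powr (3 - \<alpha>) else 0)"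

private lemma h_meas [measurable]: "(\<lambda>(x, r). h x r) \<in> borel_measurable (borel \<Otimes>\<^sub>M borel)"
proof -
  note [measurable] = horizon_profileD(5)[OF w]
  have "(\<lambda>p. if norm (fst p) \<le> snd p then (\<lambda>t. w (max 0 t)) (snd p / \<rho>) / (snd p) powr (3 - \<alpha>) else 0)
     \<in> borel_measurable ((borel :: R2 measure) \<Otimes>\<^sub>M borel)"
    by measurable
  then show ?thesis by (simp add: h_def case_prod_unfold)
qed

private lemma h_nonneg: "0 \<le> h x r"
  using horizon_profileD(1)[OF w, of "max 0 (r/\<rho>)"] by (simp add: h_def)

private lemma h_le: "h x r \<le> r powr (\<alpha> - 3) * indicator {norm x..} r"
proof -
  have e: "r powr (\<alpha> - 3) = inverse (r powr (3 - \<alpha>))" using powr_minus[of r "3 - \<alpha>"] by simp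
  have "w (max 0 (r/\<rho>)) * inverse (r powr (3 - \<alpha>)) \<le> 1 * inverse (r powr (3 - \<alpha>))"
    using horizon_profileD(2)[OF w, of "max 0 (r/\<rho>)"] by (intro mult_right_mono) auto
  then show ?thesis unfolding h_def e by (simp add: divide_inverse)
qed

lemma riesz_kernel_eq: "riesz_kernel w \<alpha> \<rho> x = (2 - \<alpha>) / gamma_const \<alpha> * (\<integral>r. h x r \<partial>lborel)"
proof -
  have "indicator {norm x..} r *\<^sub>R (w (r / \<rho>) / r powr (3 - \<alpha>)) = h x r" for r
  proof (cases "norm x \<le> r")
    case True
    then have "0 \<le> r / \<rho>" using \<rho> by (meson divide_nonneg_pos norm_ge_zero order_trans)
    then show ?thesis using True by (simp add: h_def)
  qed (simp add: h_def)
  then have "(LINT r:{norm x..}|lebesgue. w (r / \<rho>) / r powr (3 - \<alpha>)) = (\<integral>r. h x r \<partial>lebesgue)"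
    unfolding set_lebesgue_integral_def by simp
  also have "\<dots> = (\<integral>r. h x r \<partial>lborel)"
    by (rule integral_completion) measurable
  finally show ?thesis by (simp add: riesz_kernel_def)
qed

lemma riesz_kernel_measurable [measurable]: "riesz_kernel w \<alpha> \<rho> \<in> borel_measurable borel"
  unfolding riesz_kernel_eq[abs_def] by measurable

lemma riesz_kernel_nonneg: "0 \<le> riesz_kernel w \<alpha> \<rho> x"
  unfolding riesz_kernel_eq using gamma_const_pos[OF \<alpha>] \<alpha>
  by (intro mult_nonneg_nonneg integral_nonneg_AE) (auto simp: h_nonneg)

lemma riesz_kernel_eq_0: "norm x \<ge> \<rho> \<Longrightarrow> riesz_kernel w \<alpha> \<rho> x = 0"
proof -
  assume x: "norm x \<ge> \<rho>"
  have "h x r = 0" for r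
    using x \<rho> horizon_profileD(4)[OF w, of "max 0 (r/\<rho>)"] by (auto simp: h_def max_def)
  then show ?thesis by (simp add: riesz_kernel_eq)
qed

text \<open>With the profile replaced by 1 this is the tail integral of r^(\<alpha>-3). Its
  denominator cancels against the prefactor of the kernel, which therefore lies below the plain
  Riesz kernel.\<close>

private lemma h_nn_le: "x \<noteq> 0 \<Longrightarrow> (\<integral>\<^sup>+r. ennreal (h x r) \<partial>lborel) \<le> ennreal (norm x powr (\<alpha> - 2) / (2 - \<alpha>))"
proof -
  assume x: "x \<noteq> 0"
  have "(\<integral>\<^sup>+r. ennreal (h x r) \<partial>lborel) \<le> (\<integral>\<^sup>+r. ennreal (r powr (\<alpha> - 3)) * indicator {norm x..} r \<partial>lborel)"
  proof (rule nn_integral_mono)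
    fix r
    show "ennreal (h x r) \<le> ennreal (r powr (\<alpha> - 3)) * indicator {norm x..} r"
      using h_le[of x r] by (cases "norm x \<le> r") (auto simp: h_def intro!: ennreal_leI)
  qed
  also have "\<dots> = ennreal (- (norm x powr (\<alpha> - 3 + 1)) / (\<alpha> - 3 + 1))"
    using x \<alpha> by (intro nn_integral_powr_inf) auto
  also have "- (norm x powr (\<alpha> - 3 + 1)) / (\<alpha> - 3 + 1) = norm x powr (\<alpha> - 2) / (2 - \<alpha>)"
    by (smt (verit) minus_divide_divide)
  finally show ?thesis .
qed

private lemma h_integrable: "x \<noteq> 0 \<Longrightarrow> integrable lborel (h x)"
  using h_nn_le[of x] by (intro integrableI_nonneg) (auto simp: h_nonneg intro: le_less_trans)

text \<open>The origin is excluded: there \<open>h\<close> is not integrable and the Bochner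
  integral takes its default value 0.\<close>

private lemma riesz_kernel_nn: "x \<noteq> 0 \<Longrightarrow> ennreal (riesz_kernel w \<alpha> \<rho> x) =
    ennreal ((2 - \<alpha>) / gamma_const \<alpha>) * (\<integral>\<^sup>+r. ennreal (h x r) \<partial>lborel)"
  using \<alpha> gamma_const_pos[OF \<alpha>] unfolding riesz_kernel_eq
  by (subst nn_integral_eq_integral[OF h_integrable])
     (auto simp: h_nonneg ennreal_mult[symmetric] integral_nonneg_AE)

lemma riesz_kernel_le: "x \<noteq> 0 \<Longrightarrow> riesz_kernel w \<alpha> \<rho> x \<le> norm x powr (\<alpha> - 2) / gamma_const \<alpha>"
proof -
  assume x: "x \<noteq> 0"
  have "ennreal (riesz_kernel w \<alpha> \<rho> x) \<le> ennreal ((2 - \<alpha>) / gamma_const \<alpha>) * ennreal (norm x powr (\<alpha> - 2) / (2 - \<alpha>))"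
    unfolding riesz_kernel_nn[OF x] by (intro mult_left_mono h_nn_le x) auto
  also have "\<dots> = ennreal (norm x powr (\<alpha> - 2) / gamma_const \<alpha>)"
    using \<alpha> gamma_const_pos[OF \<alpha>] by (subst ennreal_mult[symmetric]) auto
  finally show ?thesis using gamma_const_pos[OF \<alpha>] by (subst (asm) ennreal_le_iff) auto
qed

text \<open>A layer cake formula: for fixed r the integrand is constant on the disc of radius r,
  whose area pi r^2 turns r^(\<alpha>-3) into r^(\<alpha>-1).\<close>

private lemma riesz_kernel_nn_integral:
  "(\<integral>\<^sup>+x. ennreal (riesz_kernel w \<alpha> \<rho> x) \<partial>lborel) =
    ennreal ((2 - \<alpha>) / gamma_const \<alpha> * pi) * (\<integral>\<^sup>+r. ennreal (w (r / \<rho>) * r powr (\<alpha> - 1)) * indicator {0..} r \<partial>lborel)"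
proof -
  define c where "c = (2 - \<alpha>) / gamma_const \<alpha>"
  have c: "c \<ge> 0" using \<alpha> gamma_const_pos[OF \<alpha>] by (simp add: c_def)
  have "(\<integral>\<^sup>+x. ennreal (riesz_kernel w \<alpha> \<rho> x) \<partial>lborel) = (\<integral>\<^sup>+x. ennreal c * (\<integral>\<^sup>+r. ennreal (h x r) \<partial>lborel) \<partial>lborel)"
    using AE_lborel_singleton[of "0::R2"]
    by (intro nn_integral_cong_AE) (auto elim!: eventually_mono simp: riesz_kernel_nn c_def)
  also have "\<dots> = ennreal c * (\<integral>\<^sup>+x. \<integral>\<^sup>+r. ennreal (h x r) \<partial>lborel \<partial>lborel)"
    by (rule nn_integral_cmult) measurable
  also have "(\<integral>\<^sup>+x. \<integral>\<^sup>+r. ennreal (h x r) \<partial>lborel \<partial>lborel) = (\<integral>\<^sup>+r. \<integral>\<^sup>+x. ennreal (h x r) \<partial>lborel \<partial>lborel)"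
    by (rule lborel_pair.Fubini'[symmetric]) measurable
  also have "\<dots> = (\<integral>\<^sup>+r. ennreal pi * (ennreal (w (r / \<rho>) * r powr (\<alpha> - 1)) * indicator {0..} r) \<partial>lborel)"
  proof (rule nn_integral_cong)
    fix r :: real
    show "(\<integral>\<^sup>+x. ennreal (h x r) \<partial>lborel) = ennreal pi * (ennreal (w (r / \<rho>) * r powr (\<alpha> - 1)) * indicator {0..} r)"
    proof (cases "r > 0")
      case True
      have "(\<integral>\<^sup>+x. ennreal (h x r) \<partial>lborel) =
          (\<integral>\<^sup>+x. ennreal (w (max 0 (r / \<rho>)) / r powr (3 - \<alpha>)) * indicator (cball (0::R2) r) x \<partial>lborel)"
        by (intro nn_integral_cong) (auto simp: h_def indicator_def)
      also have "\<dots> = ennreal (w (max 0 (r / \<rho>)) / r powr (3 - \<alpha>)) * ennreal (pi * r\<^sup>2)"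
        using True by (subst nn_integral_cmult_indicator) (auto simp: emeasure_cball_R2)
      also have "\<dots> = ennreal pi * ennreal (w (r / \<rho>) * (r\<^sup>2 / r powr (3 - \<alpha>)))"
        using True \<rho> horizon_profileD(1)[OF w, of "r / \<rho>"]
        by (simp add: ennreal_mult[symmetric] max_def mult_ac)
      also have "r\<^sup>2 / r powr (3 - \<alpha>) = r powr (\<alpha> - 1)"
        using True by (simp add: powr_diff powr_numeral[symmetric] field_simps del: powr_numeral) (simp add: powr_add[symmetric] power2_eq_square power3_eq_cube)
      finally show ?thesis using True by simp
    next
      case False
      have "h x r = 0" for x using False by (auto simp: h_def dest: order_trans[OF norm_ge_zero])
      then show ?thesis using False by (cases "r = 0") auto
    qed
  qed
  also have "\<dots> = ennreal pi * (\<integral>\<^sup>+r. (ennreal (w (r / \<rho>) * r powr (\<alpha> - 1)) * indicator {0..} r) \<partial>lborel)"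
  proof (rule nn_integral_cmult)
    note [measurable] = horizon_profileD(5)[OF w]
    have "(\<lambda>r. ennreal ((\<lambda>t. w (max 0 t)) (r / \<rho>) * r powr (\<alpha> - 1)) * indicator {0..} r) \<in> borel_measurable borel"
      by measurable
    moreover have "(\<lambda>r. ennreal ((\<lambda>t. w (max 0 t)) (r / \<rho>) * r powr (\<alpha> - 1)) * indicator {0..} r) =
        (\<lambda>r. ennreal (w (r / \<rho>) * r powr (\<alpha> - 1)) * indicator {0..} r)"
      using \<rho> by (auto simp: fun_eq_iff indicator_def max_def)
    ultimately show "(\<lambda>r. ennreal (w (r / \<rho>) * r powr (\<alpha> - 1)) * indicator {0..} r) \<in> borel_measurable lborel" by simp
  qed
  finally show ?thesis
    unfolding c_def[symmetric] using c by (subst ennreal_mult) (auto simp: mult.assoc)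
qed

text \<open>The scaled profile lies between the indicators of [0, \<rho>/2] and [0, \<rho>], and the
  integrals of r^(\<alpha>-1) over these intervals are explicit. The two bounds have the same limit
  as soon as \<rho>^\<alpha> tends to 1.\<close>

lemma riesz_kernel_mass:
  "integrable lborel (riesz_kernel w \<alpha> \<rho>)"
  "(\<integral>x. riesz_kernel w \<alpha> \<rho> x \<partial>lborel) \<le> kap \<alpha> * \<rho> powr \<alpha>"
  "kap \<alpha> * (\<rho> / 2) powr \<alpha> \<le> (\<integral>x. riesz_kernel w \<alpha> \<rho> x \<partial>lborel)"
proof -
  define c where "c = (2 - \<alpha>) / gamma_const \<alpha> * pi"
  have c: "c \<ge> 0" "c / \<alpha> = kap \<alpha>" using \<alpha> gamma_const_pos[OF \<alpha>] by (auto simp: c_def kap_def)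
  let ?I = "\<integral>\<^sup>+x. ennreal (riesz_kernel w \<alpha> \<rho> x) \<partial>lborel"
  have p: "(\<integral>\<^sup>+r. (ennreal (r powr (\<alpha> - 1)) * indicator {0..a} r) \<partial>lborel) = ennreal (a powr \<alpha> / \<alpha>)" if "a \<ge> 0" for a
    using nn_integral_powr_0[of "\<alpha> - 1" a] that \<alpha> by simp
  have "?I \<le> ennreal c * (\<integral>\<^sup>+r. (ennreal (r powr (\<alpha> - 1)) * indicator {0..\<rho>} r) \<partial>lborel)"
    unfolding riesz_kernel_nn_integral c_def[symmetric]
  proof (intro mult_left_mono nn_integral_mono)
    fix r :: real
    show "ennreal (w (r / \<rho>) * r powr (\<alpha> - 1)) * indicator {0..} r \<le> ennreal (r powr (\<alpha> - 1)) * indicator {0..\<rho>} r"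
    proof (cases "r > \<rho>")
      case True
      then have "w (r / \<rho>) = 0" using \<rho> by (intro horizon_profileD(4)[OF w]) auto
      then show ?thesis by simp
    next
      case False
      have "w (r / \<rho>) \<le> 1" if "0 \<le> r" using \<rho> that horizon_profileD(2)[OF w] by simp
      then show ?thesis using False mult_right_mono[of "w (r / \<rho>)" 1 "r powr (\<alpha> - 1)"]
        by (auto simp: indicator_def intro!: ennreal_leI)
    qed
  qed auto
  also have "\<dots> = ennreal (kap \<alpha> * \<rho> powr \<alpha>)"
    using p[of \<rho>] \<rho> c \<alpha> by (simp add: ennreal_mult[symmetric] c(2)[symmetric])
  finally have up: "?I \<le> ennreal (kap \<alpha> * \<rho> powr \<alpha>)" .
  then show int: "integrable lborel (riesz_kernel w \<alpha> \<rho>)"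
    by (intro integrableI_nonneg) (auto simp: riesz_kernel_nonneg intro: le_less_trans)
  have I: "?I = ennreal (\<integral>x. riesz_kernel w \<alpha> \<rho> x \<partial>lborel)"
    by (rule nn_integral_eq_integral[OF int]) (simp add: riesz_kernel_nonneg)
  have k0: "kap \<alpha> \<ge> 0" using c \<alpha> by (simp add: c(2)[symmetric])
  show "(\<integral>x. riesz_kernel w \<alpha> \<rho> x \<partial>lborel) \<le> kap \<alpha> * \<rho> powr \<alpha>"
    using up k0 unfolding I by simp
  have "ennreal (kap \<alpha> * (\<rho> / 2) powr \<alpha>) = ennreal c * (\<integral>\<^sup>+r. (ennreal (r powr (\<alpha> - 1)) * indicator {0..\<rho> / 2} r) \<partial>lborel)"
    using p[of "\<rho> / 2"] \<rho> c \<alpha> by (simp add: ennreal_mult[symmetric] c(2)[symmetric])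
  also have "\<dots> \<le> ?I"
    unfolding riesz_kernel_nn_integral c_def[symmetric]
  proof (intro mult_left_mono nn_integral_mono)
    fix r :: real
    have "w (r / \<rho>) = 1" if "0 \<le> r" "r \<le> \<rho> / 2"
      using that \<rho> by (intro horizon_profileD(3)[OF w]) (auto simp: field_simps)
    then show "ennreal (r powr (\<alpha> - 1)) * indicator {0..\<rho> / 2} r \<le> ennreal (w (r / \<rho>) * r powr (\<alpha> - 1)) * indicator {0..} r"
      by (auto simp: indicator_def)
  qed auto
  finally show "kap \<alpha> * (\<rho> / 2) powr \<alpha> \<le> (\<integral>x. riesz_kernel w \<alpha> \<rho> x \<partial>lborel)"
    unfolding I by (simp add: integral_nonneg_AE riesz_kernel_nonneg)
qed

end

section \<open>Convolution with a compactly supported kernel\<close>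

definition conv :: "(R2 \<Rightarrow> real) \<Rightarrow> (R2 \<Rightarrow> 'b::euclidean_space) \<Rightarrow> R2 \<Rightarrow> 'b" where
  "conv Q f x = (\<integral>y. Q (x - y) *\<^sub>R f y \<partial>lebesgue)"

text \<open>Fubini is applied to the product of two copies of \<open>lborel\<close>, hence the wish
  for a Borel representative; it is found coordinate by coordinate and reassembled in the
  basis.\<close>

lemma lebesgue_ex_borel_measurable:
  fixes f :: "'a::euclidean_space \<Rightarrow> 'b::euclidean_space"
  assumes f: "f \<in> borel_measurable lebesgue"
  obtains g where "g \<in> borel_measurable borel" "AE x in lborel. f x = g x"
proof -
  have "\<exists>g\<in>borel_measurable lborel. AE x in lborel. f x \<bullet> b = g x" for b
    using f by (intro completion_ex_borel_measurable_real borel_measurable_inner) auto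
  then obtain g where g: "\<And>b. g b \<in> borel_measurable lborel" "\<And>b. AE x in lborel. f x \<bullet> b = g b x"
    by metis
  have "AE x in lborel. \<forall>b\<in>Basis. f x \<bullet> b = g b x"
    using g(2) by (intro AE_finite_allI) auto
  then have "AE x in lborel. f x = (\<Sum>b\<in>Basis. g b x *\<^sub>R b)"
  proof eventually_elim
    case (elim x)
    then have "(\<Sum>b\<in>Basis. g b x *\<^sub>R b) = (\<Sum>b\<in>Basis. (f x \<bullet> b) *\<^sub>R b)" by (intro sum.cong) auto
    then show ?case by (simp add: euclidean_representation)
  qed
  moreover have "(\<lambda>x. \<Sum>b\<in>Basis. g b x *\<^sub>R b) \<in> borel_measurable borel"
    using g(1) by simp
  ultimately show ?thesis by (rule that[rotated])
qed

text \<open>The radius is bounded by 1 so that, for |x| \<le> R, a convolution sees only the ball of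
  radius R+1, whatever the index in the sequence.\<close>

locale kernel =
  fixes Q :: "R2 \<Rightarrow> real" and \<rho> :: real
  assumes Q_meas [measurable]: "Q \<in> borel_measurable borel"
    and Q_nonneg: "\<And>z. 0 \<le> Q z"
    and Q_int: "integrable lborel Q"
    and Q_supp: "\<And>z. norm z \<ge> \<rho> \<Longrightarrow> Q z = 0"
    and \<rho>_le: "\<rho> \<le> 1"
begin

definition q where "q = (\<integral>z. Q z \<partial>lborel)"

lemma nn_Q: "(\<integral>\<^sup>+z. ennreal (Q z) \<partial>lborel) = ennreal q"
  unfolding q_def by (rule nn_integral_eq_integral[OF Q_int]) (simp add: Q_nonneg)

lemma q_nonneg: "0 \<le> q" unfolding q_def by (simp add: Q_nonneg)

lemma nn_Q_reflect: "(\<integral>\<^sup>+y. ennreal (Q (x - y)) \<partial>lborel) = ennreal q"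
  using nn_integral_lborel_reflect[of "\<lambda>z. ennreal (Q z)" x] nn_Q by simp

lemma Q_shift_integrable: "integrable lebesgue (\<lambda>y. Q (x - y))" "(\<integral>y. Q (x - y) \<partial>lebesgue) = q"
proof -
  have "has_bochner_integral lborel (\<lambda>y. Q (x - y)) q"
    by (rule has_bochner_integral_nn_integral) (auto simp: Q_nonneg nn_Q_reflect q_nonneg)
  then show "integrable lebesgue (\<lambda>y. Q (x - y))" "(\<integral>y. Q (x - y) \<partial>lebesgue) = q"
    by (auto simp: has_bochner_integral_iff integrable_completion integral_completion)
qed

text \<open>The function is cut off outside the ball seen by the kernel and then made Borel; neither
  step changes the integrand at points with |x| \<le> R except on null sets, so value and
  integrability both carry over.\<close>

lemma conv_local_representative:
  fixes f :: "R2 \<Rightarrow> 'b::euclidean_space"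
  assumes "f absolutely_integrable_on cball 0 (R + 1)"
  shows "\<exists>g. g \<in> borel_measurable borel \<and> integrable lborel g \<and>
    (\<forall>x. norm x \<le> R \<longrightarrow> conv Q f x = (\<integral>y. Q (x - y) *\<^sub>R g y \<partial>lborel) \<and>
      integrable lebesgue (\<lambda>y. Q (x - y) *\<^sub>R f y) = integrable lborel (\<lambda>y. Q (x - y) *\<^sub>R g y))"
proof -
  define f1 where "f1 y = indicator (cball 0 (R + 1)) y *\<^sub>R f y" for y
  have f1: "integrable lebesgue f1" using assms by (simp add: set_integrable_def f1_def[abs_def])
  then have f1m [measurable]: "f1 \<in> borel_measurable lebesgue" by auto
  obtain g where g[measurable]: "g \<in> borel_measurable borel" and ae: "AE x in lborel. f1 x = g x"
    using lebesgue_ex_borel_measurable[OF f1m] by blast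
  have ae': "AE x in lebesgue. f1 x = g x" using ae by (rule AE_completion)
  have gm: "g \<in> borel_measurable lebesgue" using measurable_completion[of g lborel borel] by simp
  have "integrable lebesgue g" using f1 integrable_cong_AE[OF f1m gm ae'] by simp
  then have gi: "integrable lborel g" by (subst (asm) integrable_completion) auto
  have eq: "Q (x - y) *\<^sub>R f y = Q (x - y) *\<^sub>R f1 y" if "norm x \<le> R" for x y
  proof (cases "norm y \<le> R + 1")
    case False
    then have "norm (x - y) \<ge> \<rho>" using that \<rho>_le norm_triangle_sub[of y x] by (simp add: norm_minus_commute)
    then show ?thesis by (simp add: Q_supp)
  qed (simp add: f1_def)
  have Qm: "(\<lambda>y. Q (x - y)) \<in> borel_measurable lebesgue" for x
    using measurable_completion[of "\<lambda>y. Q (x - y)" lborel borel] by simp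
  have ae2: "AE y in lebesgue. Q (x - y) *\<^sub>R f1 y = Q (x - y) *\<^sub>R g y" for x
    using ae' by eventually_elim simp
  have m1: "(\<lambda>y. Q (x - y) *\<^sub>R f1 y) \<in> borel_measurable lebesgue"
       "(\<lambda>y. Q (x - y) *\<^sub>R g y) \<in> borel_measurable lebesgue" for x
    using Qm[of x] gm by (auto intro!: borel_measurable_scaleR)
  show ?thesis
  proof (intro exI[of _ g] conjI g gi allI impI)
    fix x :: R2 assume x: "norm x \<le> R"
    show "conv Q f x = (\<integral>y. Q (x - y) *\<^sub>R g y \<partial>lborel)"
      unfolding conv_def eq[OF x] integral_cong_AE[OF m1[of x] ae2] by (rule integral_completion) measurable
    show "integrable lebesgue (\<lambda>y. Q (x - y) *\<^sub>R f y) = integrable lborel (\<lambda>y. Q (x - y) *\<^sub>R g y)"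
      unfolding eq[OF x] integrable_cong_AE[OF m1[of x] ae2] by (rule integrable_completion) measurable
  qed
qed

text \<open>Tonelli: the double integral of Q(x-y) |g(y)| is the mass of \<open>Q\<close> times the
  L1 norm of \<open>g\<close>, so the inner integral is finite for almost every x.\<close>

lemma conv_AE_integrable:
  fixes f :: "R2 \<Rightarrow> 'b::euclidean_space"
  assumes "f absolutely_integrable_on cball 0 (R + 1)"
  shows "AE x in lebesgue. norm x \<le> R \<longrightarrow> integrable lebesgue (\<lambda>y. Q (x - y) *\<^sub>R f y)"
proof -
  obtain g :: "R2 \<Rightarrow> 'b" where g[measurable]: "g \<in> borel_measurable borel" and gi: "integrable lborel g"
    and *: "\<And>x. norm x \<le> R \<Longrightarrow> integrable lebesgue (\<lambda>y. Q (x - y) *\<^sub>R f y) = integrable lborel (\<lambda>y. Q (x - y) *\<^sub>R g y)"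
    using conv_local_representative[OF assms] by blast
  have "(\<integral>\<^sup>+x. \<integral>\<^sup>+y. ennreal (Q (x - y)) * ennreal (norm (g y)) \<partial>lborel \<partial>lborel) =
        (\<integral>\<^sup>+y. \<integral>\<^sup>+x. ennreal (Q (x - y)) * ennreal (norm (g y)) \<partial>lborel \<partial>lborel)"
    by (rule lborel_pair.Fubini') measurable
  also have "\<dots> = (\<integral>\<^sup>+y. ennreal q * ennreal (norm (g y)) \<partial>lborel)"
  proof (rule nn_integral_cong)
    fix y :: R2
    show "(\<integral>\<^sup>+x. ennreal (Q (x - y)) * ennreal (norm (g y)) \<partial>lborel) = ennreal q * ennreal (norm (g y))"
      using nn_integral_lborel_translate[of "\<lambda>z. ennreal (Q z)" y]
      by (subst nn_integral_multc) (auto simp: nn_Q)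
  qed
  also have "\<dots> = ennreal q * (\<integral>\<^sup>+y. ennreal (norm (g y)) \<partial>lborel)" by (rule nn_integral_cmult) measurable
  also have "\<dots> < \<infinity>" using gi by (auto simp: integrable_iff_bounded ennreal_mult_less_top)
  finally have fin: "(\<integral>\<^sup>+x. \<integral>\<^sup>+y. ennreal (Q (x - y)) * ennreal (norm (g y)) \<partial>lborel \<partial>lborel) \<noteq> \<infinity>" by simp
  have "AE x in lborel. (\<integral>\<^sup>+y. ennreal (Q (x - y)) * ennreal (norm (g y)) \<partial>lborel) \<noteq> \<infinity>"
    by (rule nn_integral_PInf_AE[OF _ fin]) measurable
  then have "AE x in lborel. norm x \<le> R \<longrightarrow> integrable lebesgue (\<lambda>y. Q (x - y) *\<^sub>R f y)"
  proof eventually_elim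
    case (elim x)
    have "integrable lborel (\<lambda>y. Q (x - y) *\<^sub>R g y)"
    proof (rule integrableI_bounded)
      have "(\<integral>\<^sup>+y. ennreal (norm (Q (x - y) *\<^sub>R g y)) \<partial>lborel) = (\<integral>\<^sup>+y. ennreal (Q (x - y)) * ennreal (norm (g y)) \<partial>lborel)"
        by (intro nn_integral_cong) (simp add: Q_nonneg ennreal_mult)
      then show "(\<integral>\<^sup>+y. ennreal (norm (Q (x - y) *\<^sub>R g y)) \<partial>lborel) < \<infinity>" using elim by (simp add: less_top)
    qed measurable
    then show ?case using * by simp
  qed
  then show ?thesis by (rule AE_completion)
qed

lemma conv_measurable:
  fixes f :: "R2 \<Rightarrow> 'b::euclidean_space"
  assumes "f absolutely_integrable_on cball 0 (R + 1)" "\<Omega> \<subseteq> cball 0 R" "\<Omega> \<in> sets lebesgue"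
  shows "conv Q f \<in> borel_measurable (lebesgue_on \<Omega>)"
proof -
  obtain g :: "R2 \<Rightarrow> 'b" where g[measurable]: "g \<in> borel_measurable borel"
    and *: "\<And>x. norm x \<le> R \<Longrightarrow> conv Q f x = (\<integral>y. Q (x - y) *\<^sub>R g y \<partial>lborel)"
    using conv_local_representative[OF assms(1)] by blast
  have "(\<lambda>x. \<integral>y. Q (x - y) *\<^sub>R g y \<partial>lborel) \<in> borel_measurable lborel"
    by measurable
  then have "(\<lambda>x. \<integral>y. Q (x - y) *\<^sub>R g y \<partial>lborel) \<in> borel_measurable (lebesgue_on \<Omega>)"
    by (intro measurable_restrict_space1 measurable_completion)
  then show ?thesis
  proof (rule measurable_cong[THEN iffD1, rotated])
    fix x assume "x \<in> space (lebesgue_on \<Omega>)"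
    then have "norm x \<le> R" using assms(2) by (auto simp: space_restrict_space)
    then show "(\<integral>y. Q (x - y) *\<^sub>R g y \<partial>lborel) = conv Q f x" using * by simp
  qed
qed

end

lemma riesz_potential_conv: "riesz_potential w \<alpha> \<rho> f = conv (riesz_kernel w \<alpha> \<rho>) f"
  by (simp add: fun_eq_iff riesz_potential_def conv_def)

lemma kernel_riesz:
  assumes "horizon_profile w" "0 < \<alpha>" "\<alpha> < 1" "0 < \<rho>" "\<rho> < 1"
  shows "kernel (riesz_kernel w \<alpha> \<rho>) \<rho>"
  using assms by unfold_locales
    (auto simp: riesz_kernel_measurable riesz_kernel_nonneg riesz_kernel_mass(1) riesz_kernel_eq_0)

section \<open>Symmetric parts of matrices and of potentials\<close>

lemma linear_sym_part: "linear sym_part"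
  by (auto simp: linear_iff sym_part_def transpose_def vec_eq_iff algebra_simps)

lemma bounded_linear_sym_part: "bounded_linear sym_part"
  using linear_sym_part linear_conv_bounded_linear by blast

lemma transpose_sym_part [simp]: "transpose (sym_part F) = sym_part F"
  by (simp add: sym_part_def transpose_def vec_eq_iff algebra_simps)

lemma sym_part_of_sym: "transpose F = F \<Longrightarrow> sym_part F = F"
  by (simp add: sym_part_def scaleR_add_left[symmetric])

lemma norm_transpose: "norm (transpose (F::M22)) = norm F"
proof -
  have "transpose F \<bullet> transpose F = F \<bullet> F"
    unfolding inner_vec_def transpose_def by (simp add: UNIV_2)
  then show ?thesis by (simp add: norm_eq_sqrt_inner)
qed

lemma norm_sym_part_le: "norm (sym_part F) \<le> norm F"
  using norm_triangle_ineq[of F "transpose F"] by (simp add: sym_part_def norm_transpose)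

text \<open>Integrability matters: where the potential of \<open>f\<close> diverges it has the
  default value 0, whereas the integral of the symmetric part may converge to something
  else.\<close>

lemma conv_sym_part:
  assumes "integrable lebesgue (\<lambda>y. Q (x - y) *\<^sub>R f y)"
  shows "conv Q (\<lambda>y. sym_part (f y)) x = sym_part (conv Q f x)"
proof -
  have "conv Q (\<lambda>y. sym_part (f y)) x = (\<integral>y. sym_part (Q (x - y) *\<^sub>R f y) \<partial>lebesgue)"
    by (simp add: conv_def linear_scale[OF linear_sym_part])
  then show ?thesis using integral_bounded_linear[OF bounded_linear_sym_part assms] by (simp add: conv_def)
qed

text \<open>This holds at every point, since the default value 0 at points of divergence is
  symmetric too.\<close>

lemma transpose_conv_sym_part:
  "transpose (conv Q (\<lambda>y. sym_part (f y)) x) = conv Q (\<lambda>y. sym_part (f y)) x"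
proof (cases "integrable lebesgue (\<lambda>y. Q (x - y) *\<^sub>R sym_part (f y))")
  case True
  have sym: "sym_part (sym_part (f y)) = sym_part (f y)" for y
    by (rule sym_part_of_sym) simp
  have "conv Q (\<lambda>y. sym_part (f y)) x = sym_part (conv Q (\<lambda>y. sym_part (f y)) x)"
    using conv_sym_part[OF True] by (simp add: sym)
  then show ?thesis by (metis transpose_sym_part)
next
  case False
  then have "conv Q (\<lambda>y. sym_part (f y)) x = 0" by (simp add: conv_def not_integrable_integral_eq)
  then show ?thesis by (simp add: transpose_def vec_eq_iff)
qed

lemma transpose_rescaled: "transpose (rescaled_strain w \<alpha> \<rho> N \<beta> x) = rescaled_strain w \<alpha> \<rho> N \<beta> x"
proof -
  have "transpose (c *\<^sub>R F) = c *\<^sub>R transpose F" for c and F :: M22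
    by (simp add: transpose_def vec_eq_iff)
  then show ?thesis by (simp add: rescaled_strain_def riesz_potential_conv transpose_conv_sym_part)
qed

section \<open>Compactness and the lower bound\<close>

lemma L2_sym_iff:
  assumes "open \<Omega>"
  shows "f \<in> L2_sym \<Omega> \<longleftrightarrow> f \<in> L2 (lebesgue_on \<Omega>) \<and> (AE x in lebesgue_on \<Omega>. transpose (f x) = f x)"
proof -
  have "\<Omega> \<in> sets lebesgue" using assms by simp
  then show ?thesis
    unfolding L2_sym_def L2_def set_borel_measurable_def set_integrable_def
    by (simp add: borel_measurable_restrict_space_iff integrable_restrict_space AE_restrict_space_iff)
qed

lemma set_integral_eq_ip:
  assumes "open \<Omega>" shows "(LINT x:\<Omega>|lebesgue. f x \<bullet> h x) = ip (lebesgue_on \<Omega>) f h"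
  using assms by (simp add: ip_def set_lebesgue_integral_def integral_restrict_space)

lemma finite_measure_lebesgue_on:
  assumes "open \<Omega>" "bounded \<Omega>" shows "finite_measure (lebesgue_on (\<Omega> :: 'a::euclidean_space set))"
  using assms emeasure_bounded_finite[of \<Omega>] by (intro finite_measureI)
    (simp add: emeasure_restrict_space space_restrict_space)

text \<open>For functions in L2 this is twice the energy, as a real number.\<close>

definition quad :: "(M22 \<Rightarrow> M22) \<Rightarrow> R2 set \<Rightarrow> (R2 \<Rightarrow> M22) \<Rightarrow> real" where
  "quad C \<Omega> f = ip (lebesgue_on \<Omega>) (\<lambda>x. C (f x)) f"

locale elastic =
  fixes \<Omega> :: "R2 set" and C :: "M22 \<Rightarrow> M22" and w :: "real \<Rightarrow> real"
  assumes op: "open \<Omega>" and bd: "bounded \<Omega>" and el: "elasticity_tensor C" and hp: "horizon_profile w"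
begin

abbreviation "M \<equiv> lebesgue_on \<Omega>"

lemma fin: "finite_measure M" by (rule finite_measure_lebesgue_on[OF op bd])

lemma C_linear: "linear C" using el by (simp add: elasticity_tensor_def)

lemma C_bounded_linear: "bounded_linear C" using C_linear linear_conv_bounded_linear by blast

lemma C_self_adjoint: "C F \<bullet> G = C G \<bullet> F"
  using el by (simp add: elasticity_tensor_def inner_commute)

lemma C_quad_sym_part: "C (sym_part F) \<bullet> sym_part F = C F \<bullet> F"
proof -
  have s: "\<And>F. C F = C (sym_part F)" using el by (auto simp: elasticity_tensor_def)
  have "C (sym_part F) \<bullet> sym_part F = C F \<bullet> sym_part F" using s[of F] by simp
  also have "\<dots> = C (sym_part F) \<bullet> F" by (rule C_self_adjoint)
  finally show ?thesis using s[of F] by simp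
qed

lemma C_nonneg: "0 \<le> C F \<bullet> F"
proof -
  obtain \<nu> where "0 < \<nu>" "\<nu> * (norm (sym_part F))\<^sup>2 \<le> C F \<bullet> F" using el by (auto simp: elasticity_tensor_def)
  then show ?thesis by (smt (verit) mult_nonneg_nonneg zero_le_power2)
qed

lemma C_lower: "\<exists>\<nu>>0. \<forall>F. transpose F = F \<longrightarrow> \<nu> * (norm F)\<^sup>2 \<le> C F \<bullet> F"
proof -
  obtain \<nu> where \<nu>: "0 < \<nu>" "\<And>F. \<nu> * (norm (sym_part F))\<^sup>2 \<le> C F \<bullet> F"
    using el unfolding elasticity_tensor_def by blast
  have "\<nu> * (norm F)\<^sup>2 \<le> C F \<bullet> F" if "transpose F = F" for F
    using \<nu>(2)[of F] sym_part_of_sym[OF that] by simp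
  then show ?thesis using \<nu>(1) by blast
qed

lemma C_upper: "\<exists>\<nu>>0. \<forall>F. C F \<bullet> F \<le> \<nu> * (norm F)\<^sup>2"
proof -
  obtain \<nu>1 \<nu> where \<nu>: "0 < \<nu>1" "\<nu>1 \<le> \<nu>" "\<And>F. C F \<bullet> F \<le> \<nu> * (norm (sym_part F))\<^sup>2"
    using el unfolding elasticity_tensor_def by blast
  have "C F \<bullet> F \<le> \<nu> * (norm F)\<^sup>2" for F
  proof -
    have "C F \<bullet> F \<le> \<nu> * (norm (sym_part F))\<^sup>2" by (rule \<nu>)
    also have "\<dots> \<le> \<nu> * (norm F)\<^sup>2" using \<nu> by (intro mult_left_mono power_mono norm_sym_part_le) auto
    finally show ?thesis .
  qed
  then show ?thesis using \<nu>(1,2) by (intro exI[of _ \<nu>]) auto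
qed

lemma C_comp_L2: "f \<in> L2 M \<Longrightarrow> (\<lambda>x. C (f x)) \<in> L2 M"
  by (rule L2_bounded_linear[OF _ C_bounded_linear])

lemma C_comp_L2_sym: "f \<in> L2_sym \<Omega> \<Longrightarrow> (\<lambda>x. C (f x)) \<in> L2_sym \<Omega>"
  using el C_comp_L2 by (simp add: L2_sym_iff[OF op] elasticity_tensor_def)

lemma quad_nonneg: "0 \<le> quad C \<Omega> f"
  unfolding quad_def ip_def by (intro integral_nonneg_AE) (simp add: C_nonneg)

lemma F_super_eq: "f \<in> L2 M \<Longrightarrow> F_super C \<Omega> f = ennreal (quad C \<Omega> f / 2)"
proof -
  assume f: "f \<in> L2 M"
  have "(\<integral>\<^sup>+x\<in>\<Omega>. ennreal (C (f x) \<bullet> f x) \<partial>lebesgue) = (\<integral>\<^sup>+x. ennreal (C (f x) \<bullet> f x) \<partial>M)"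
    using op by (subst nn_integral_restrict_space) auto
  also have "\<dots> = ennreal (quad C \<Omega> f)"
    unfolding quad_def ip_def by (rule nn_integral_eq_integral[OF L2_integrable_inner[OF C_comp_L2[OF f] f]]) (simp add: C_nonneg)
  finally have "F_super C \<Omega> f = ennreal (1 / 2) * ennreal (quad C \<Omega> f)"
    by (simp only: F_super_def elastic_energy_def)
  also have "\<dots> = ennreal (1 / 2 * quad C \<Omega> f)"
    by (rule ennreal_mult[symmetric]) (auto simp: quad_nonneg)
  finally show ?thesis by simp
qed

lemma ip_C_sym:
  assumes "f \<in> L2 M" "g \<in> L2 M"
  shows "ip M (\<lambda>x. C (g x)) f = ip M (\<lambda>x. C (f x)) g"
  unfolding ip_def using C_self_adjoint by (intro Bochner_Integration.integral_cong) auto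

lemma quad_diff:
  assumes f: "f \<in> L2 M" and g: "g \<in> L2 M"
  shows "quad C \<Omega> (\<lambda>x. f x - g x) = quad C \<Omega> f - 2 * ip M (\<lambda>x. C (g x)) f + quad C \<Omega> g"
proof -
  have "(\<lambda>x. C (f x - g x)) = (\<lambda>x. C (f x) - C (g x))" by (simp add: linear_diff[OF C_linear])
  then have "quad C \<Omega> (\<lambda>x. f x - g x) = ip M (\<lambda>x. C (f x) - C (g x)) (\<lambda>x. f x - g x)"
    by (simp add: quad_def)
  also have "\<dots> = ip M (\<lambda>x. C (f x)) f - ip M (\<lambda>x. C (f x)) g - (ip M (\<lambda>x. C (g x)) f - ip M (\<lambda>x. C (g x)) g)"
    using ip_diff[OF C_comp_L2[OF f] C_comp_L2[OF g] L2_diff[OF f g]]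
      ip_diff[OF f g C_comp_L2[OF f]] ip_diff[OF f g C_comp_L2[OF g]]
    by (simp add: ip_sym)
  finally show ?thesis using ip_C_sym[OF f g] by (simp add: quad_def)
qed

text \<open>The tangent to the convex form at \<open>g\<close>. Being affine in \<open>f\<close> it
  passes to weak limits, which the form itself does not.\<close>

lemma quad_lower: assumes "f \<in> L2 M" "g \<in> L2 M"
  shows "2 * ip M (\<lambda>x. C (g x)) f - quad C \<Omega> g \<le> quad C \<Omega> f"
  using quad_diff[OF assms] quad_nonneg[of "\<lambda>x. f x - g x"] by simp

lemma bounded_Omega: obtains R where "\<Omega> \<subseteq> cball 0 R" "0 < R"
  using bounded_subset_ballD[OF bd, of 0] ball_subset_cball that by blast

lemma L1_loc_cball: "\<beta> \<in> L1_loc \<Longrightarrow> \<beta> absolutely_integrable_on cball 0 R"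
  by (auto simp: L1_loc_def)

lemma L1_loc_sym_part: assumes "\<beta> \<in> L1_loc" shows "(\<lambda>y. sym_part (\<beta> y)) \<in> L1_loc"
  unfolding L1_loc_def
proof (intro CollectI allI impI)
  fix K :: "R2 set" assume "compact K"
  then have "\<beta> absolutely_integrable_on K" using assms by (auto simp: L1_loc_def)
  from absolutely_integrable_linear[OF this bounded_linear_sym_part]
  show "(\<lambda>y. sym_part (\<beta> y)) absolutely_integrable_on K" by (simp add: o_def)
qed

context
  fixes \<alpha> \<rho> :: real and N :: nat and \<beta> :: "R2 \<Rightarrow> M22"
  assumes \<alpha>: "0 < \<alpha>" "\<alpha> < 1" and \<rho>: "0 < \<rho>" "\<rho> < 1" and N: "0 < N" and \<beta>: "\<beta> \<in> L1_loc"
begin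

interpretation kernel "riesz_kernel w \<alpha> \<rho>" \<rho> by (rule kernel_riesz[OF hp \<alpha> \<rho>])

lemma conv_measurable_on: "conv (riesz_kernel w \<alpha> \<rho>) \<beta> \<in> borel_measurable M"
proof -
  obtain R where "\<Omega> \<subseteq> cball 0 R" by (rule bounded_Omega)
  then show ?thesis using conv_measurable[OF L1_loc_cball[OF \<beta>]] op by auto
qed

lemma rescaled_measurable: "rescaled_strain w \<alpha> \<rho> N \<beta> \<in> borel_measurable M"
proof -
  obtain R where "\<Omega> \<subseteq> cball 0 R" by (rule bounded_Omega)
  then have "conv (riesz_kernel w \<alpha> \<rho>) (\<lambda>y. sym_part (\<beta> y)) \<in> borel_measurable M"
    using conv_measurable[OF L1_loc_cball[OF L1_loc_sym_part[OF \<beta>]]] op by auto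
  then show ?thesis by (simp add: rescaled_strain_def riesz_potential_conv)
qed

text \<open>The exceptional points are those at which the potential of \<beta> diverges; its
  symmetric part may still have a convergent potential there.\<close>

lemma rescaled_AE:
  "AE x in M. rescaled_strain w \<alpha> \<rho> N \<beta> x = (1 / real N) *\<^sub>R sym_part (conv (riesz_kernel w \<alpha> \<rho>) \<beta> x)"
proof -
  obtain R where R: "\<Omega> \<subseteq> cball 0 R" by (rule bounded_Omega)
  have "AE x in lebesgue. x \<in> \<Omega> \<longrightarrow> rescaled_strain w \<alpha> \<rho> N \<beta> x = (1 / real N) *\<^sub>R sym_part (conv (riesz_kernel w \<alpha> \<rho>) \<beta> x)"
    using conv_AE_integrable[OF L1_loc_cball[OF \<beta>], of R]
  proof eventually_elim
    case (elim x)
    show ?case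
    proof
      assume "x \<in> \<Omega>"
      then have "norm x \<le> R" using R by auto
      then show "rescaled_strain w \<alpha> \<rho> N \<beta> x = (1 / real N) *\<^sub>R sym_part (conv (riesz_kernel w \<alpha> \<rho>) \<beta> x)"
        using elim conv_sym_part by (simp add: rescaled_strain_def riesz_potential_conv)
    qed
  qed
  then show ?thesis using op by (subst AE_restrict_space_iff) auto
qed

text \<open>The skew part of a potential does not contribute to the form, and the factor 1/N enters
  it quadratically. Infinite energies are included, as the identity is one in
  \<open>ennreal\<close>.\<close>

lemma energy_rescaled:
  "ennreal (1 / (real N)\<^sup>2) * elastic_energy C \<Omega> (riesz_potential w \<alpha> \<rho> \<beta>) =
    F_super C \<Omega> (rescaled_strain w \<alpha> \<rho> N \<beta>)"
proof -
  let ?g = "conv (riesz_kernel w \<alpha> \<rho>) \<beta>" and ?f = "rescaled_strain w \<alpha> \<rho> N \<beta>"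
  have Cm: "C \<in> borel_measurable borel"
    using C_bounded_linear borel_measurable_continuous_onI linear_continuous_on by blast
  have [measurable]: "(\<lambda>x. ennreal (C (?g x) \<bullet> ?g x)) \<in> borel_measurable M"
    using conv_measurable_on Cm by measurable
  have "ennreal (1 / (real N)\<^sup>2) * (\<integral>\<^sup>+x\<in>\<Omega>. ennreal (C (?g x) \<bullet> ?g x) \<partial>lebesgue) =
      ennreal (1 / (real N)\<^sup>2) * (\<integral>\<^sup>+x. ennreal (C (?g x) \<bullet> ?g x) \<partial>M)"
    using op by (subst nn_integral_restrict_space) auto
  also have "\<dots> = (\<integral>\<^sup>+x. ennreal (1 / (real N)\<^sup>2) * ennreal (C (?g x) \<bullet> ?g x) \<partial>M)"
    by (rule nn_integral_cmult[symmetric]) measurable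
  also have "\<dots> = (\<integral>\<^sup>+x. ennreal (C (?f x) \<bullet> ?f x) \<partial>M)"
  proof (rule nn_integral_cong_AE, use rescaled_AE in eventually_elim)
    case (elim x)
    have "C (?f x) \<bullet> ?f x = 1 / (real N)\<^sup>2 * (C (?g x) \<bullet> ?g x)"
      unfolding elim using C_quad_sym_part[of "?g x"]
      by (simp add: linear_scale[OF C_linear] power2_eq_square)
    moreover have "ennreal (1 / (real N)\<^sup>2 * (C (?g x) \<bullet> ?g x)) = ennreal (1 / (real N)\<^sup>2) * ennreal (C (?g x) \<bullet> ?g x)"
      by (rule ennreal_mult) (auto simp: C_nonneg)
    ultimately show ?case by simp
  qed
  also have "\<dots> = (\<integral>\<^sup>+x\<in>\<Omega>. ennreal (C (?f x) \<bullet> ?f x) \<partial>lebesgue)"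
    using op by (subst nn_integral_restrict_space) auto
  finally show ?thesis
    by (simp add: elastic_energy_def F_super_def riesz_potential_conv mult.left_commute)
qed

lemma F_super_approx_ge: "F_super C \<Omega> (rescaled_strain w \<alpha> \<rho> N \<beta>) \<le> F_super_approx C w \<Omega> b1 b2 \<alpha> \<rho> N \<mu> \<beta>"
  by (simp add: F_super_approx_def energy_rescaled)

text \<open>The rescaled strain is symmetric at every point, so coercivity on symmetric matrices
  bounds its full L2 norm.\<close>

lemma finite_energy_rescaled:
  assumes "F_super C \<Omega> (rescaled_strain w \<alpha> \<rho> N \<beta>) < \<infinity>"
  shows "rescaled_strain w \<alpha> \<rho> N \<beta> \<in> L2_sym \<Omega>"
proof -
  let ?f = "rescaled_strain w \<alpha> \<rho> N \<beta>"
  obtain \<nu> where \<nu>: "0 < \<nu>" "\<And>F. transpose F = F \<Longrightarrow> \<nu> * (norm F)\<^sup>2 \<le> C F \<bullet> F" using C_lower by blast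
  have "ennreal \<nu> * (\<integral>\<^sup>+x. ennreal ((norm (?f x))\<^sup>2) \<partial>M) = (\<integral>\<^sup>+x. ennreal \<nu> * ennreal ((norm (?f x))\<^sup>2) \<partial>M)"
    using rescaled_measurable by (intro nn_integral_cmult[symmetric]) measurable
  also have "\<dots> \<le> (\<integral>\<^sup>+x. ennreal (C (?f x) \<bullet> ?f x) \<partial>M)"
    using \<nu> by (intro nn_integral_mono) (simp add: ennreal_mult''[symmetric] ennreal_leI transpose_rescaled)
  also have "\<dots> = (\<integral>\<^sup>+x\<in>\<Omega>. ennreal (C (?f x) \<bullet> ?f x) \<partial>lebesgue)"
    using op by (subst nn_integral_restrict_space) auto
  also have "\<dots> < \<infinity>"
    using assms by (auto simp: F_super_def elastic_energy_def ennreal_mult_less_top)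
  finally have "(\<integral>\<^sup>+x. ennreal ((norm (?f x))\<^sup>2) \<partial>M) < \<infinity>"
    using \<nu> by (auto simp: ennreal_mult_less_top)
  then have "integrable M (\<lambda>x. (norm (?f x))\<^sup>2)"
    using rescaled_measurable by (intro integrableI_bounded) auto
  then show ?thesis
    using rescaled_measurable by (simp add: L2_sym_iff[OF op] L2_def transpose_rescaled)
qed

end

text \<open>Coercivity turns the energy bound into a bound in L2, where a weak limit can be
  extracted. It remains to see that this limit is symmetric.\<close>

lemma compactness:
  assumes par: "\<And>j. 0 < \<alpha> j \<and> \<alpha> j < 1" "\<And>j. 0 < \<rho> j \<and> \<rho> j < 1" "\<And>j. 0 < N j"
    and \<beta>: "\<And>j. \<beta> j \<in> L1_loc"
    and sup: "(SUP j. F_super_approx C w \<Omega> b1 b2 (\<alpha> j) (\<rho> j) (N j) (\<mu> j) (\<beta> j)) < \<infinity>"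
  shows "\<exists>r :: nat \<Rightarrow> nat. \<exists>g\<in>L2_sym \<Omega>. strict_mono r \<and>
    weakly_L2_sym \<Omega> (\<lambda>k. rescaled_strain w (\<alpha> (r k)) (\<rho> (r k)) (N (r k)) (\<beta> (r k))) g"
proof -
  define f where "f j = rescaled_strain w (\<alpha> j) (\<rho> j) (N j) (\<beta> j)" for j
  obtain s where s: "0 \<le> s" "(SUP j. F_super_approx C w \<Omega> b1 b2 (\<alpha> j) (\<rho> j) (N j) (\<mu> j) (\<beta> j)) = ennreal s"
    using sup by (cases "SUP j. F_super_approx C w \<Omega> b1 b2 (\<alpha> j) (\<rho> j) (N j) (\<mu> j) (\<beta> j)") auto
  have Fs: "F_super C \<Omega> (f j) \<le> ennreal s" for j
  proof -
    have "F_super C \<Omega> (f j) \<le> F_super_approx C w \<Omega> b1 b2 (\<alpha> j) (\<rho> j) (N j) (\<mu> j) (\<beta> j)"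
      unfolding f_def using par \<beta> by (intro F_super_approx_ge) auto
    also have "\<dots> \<le> ennreal s" unfolding s(2)[symmetric] by (rule SUP_upper) simp
    finally show ?thesis .
  qed
  have fs: "f j \<in> L2_sym \<Omega>" for j
    unfolding f_def using par \<beta>
    by (intro finite_energy_rescaled) (auto simp: f_def[symmetric] intro: le_less_trans[OF Fs])
  then have fL: "f j \<in> L2 M" for j by (simp add: L2_sym_iff[OF op])
  obtain \<nu> where \<nu>: "0 < \<nu>" "\<And>F. transpose F = F \<Longrightarrow> \<nu> * (norm F)\<^sup>2 \<le> C F \<bullet> F" using C_lower by blast
  have bound: "ip M (f j) (f j) \<le> 2 * s / \<nu>" for j
  proof -
    have "\<nu> * ip M (f j) (f j) = (\<integral>x. \<nu> * (norm (f j x))\<^sup>2 \<partial>M)" by (simp add: ip_self)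
    also have "\<dots> \<le> quad C \<Omega> (f j)"
      unfolding quad_def ip_def
    proof (rule integral_mono)
      show "integrable M (\<lambda>x. \<nu> * (norm (f j x))\<^sup>2)" using L2_integrable_sq[OF fL] by simp
      show "integrable M (\<lambda>x. C (f j x) \<bullet> f j x)" by (rule L2_integrable_inner[OF C_comp_L2[OF fL] fL])
    qed (simp add: \<nu> f_def transpose_rescaled)
    also have "quad C \<Omega> (f j) \<le> 2 * s"
      using Fs[of j] s(1) by (simp add: F_super_eq[OF fL] ennreal_le_iff)
    finally show ?thesis using \<nu> by (simp add: field_simps)
  qed
  obtain r g where r: "strict_mono r" and g: "g \<in> L2 M"
    and lim: "\<And>h. h \<in> L2 M \<Longrightarrow> (\<lambda>n. ip M (f (r n)) h) \<longlonglongrightarrow> ip M g h"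
    using L2_weakly_compact[of M f "2 * s / \<nu>", OF fin fL bound] by blast
  have "linear (transpose :: M22 \<Rightarrow> M22)"
    by (auto simp: linear_iff transpose_def vec_eq_iff)
  then have bt: "bounded_linear (transpose :: M22 \<Rightarrow> M22)"
    using linear_conv_bounded_linear by blast
  \<comment> \<open>Twice the skew part of the limit, used as a test function; this is why weak
    compactness is taken in all of L2. Every \<open>f j\<close> is symmetric and hence orthogonal to
    it.\<close>
  define h where "h x = g x - transpose (g x)" for x
  have h: "h \<in> L2 M" unfolding h_def[abs_def] by (rule L2_diff[OF g L2_bounded_linear[OF g bt]])
  have orth: "F \<bullet> (G - transpose G) = 0" if "transpose F = F" for F G :: M22
  proof -
    have "F \<bullet> transpose G = transpose F \<bullet> G"
      unfolding inner_vec_def transpose_def by (simp add: UNIV_2 algebra_simps)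
    then show ?thesis using that by (simp add: inner_diff_right)
  qed
  have "ip M (f j) h = 0" for j
    unfolding ip_def h_def by (simp add: orth f_def transpose_rescaled)
  then have "(\<lambda>n. ip M (f (r n)) h) \<longlonglongrightarrow> 0" by simp
  then have "ip M g h = 0" using LIMSEQ_unique[OF lim[OF h]] by blast
  \<comment> \<open>The symmetric part of \<open>g x\<close> is orthogonal to \<open>h x\<close>,
    and the skew part is half of \<open>h x\<close>.\<close>
  moreover have "g x \<bullet> h x = (norm (h x))\<^sup>2 / 2" for x
  proof -
    have "g x \<bullet> g x = transpose (g x) \<bullet> transpose (g x)"
      unfolding inner_vec_def transpose_def by (simp add: UNIV_2)
    then show ?thesis
      by (simp add: h_def power2_norm_eq_inner inner_diff_left inner_diff_right inner_commute)
  qed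
  ultimately have "(\<integral>x. (norm (h x))\<^sup>2 \<partial>M) = 0" by (simp add: ip_def)
  then have "AE x in M. (norm (h x))\<^sup>2 = 0"
    using integral_nonneg_eq_0_iff_AE[OF L2_integrable_sq[OF h]] by simp
  then have "AE x in M. transpose (g x) = g x" by eventually_elim (simp add: h_def)
  then have gs: "g \<in> L2_sym \<Omega>" using g by (simp add: L2_sym_iff[OF op])
  have "weakly_L2_sym \<Omega> (\<lambda>k. f (r k)) g"
    unfolding weakly_L2_sym_def set_integral_eq_ip[OF op]
    using fs gs lim by (auto simp: L2_sym_iff[OF op])
  then show ?thesis using r gs unfolding f_def by blast
qed

text \<open>The functionals enter only through their lower bound by the form of the rescaled strain,
  so that inadmissible pairs are covered as well. The tangent to the form at the limit is then
  followed along the weak convergence.\<close>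

lemma liminf_inequality:
  assumes par: "\<And>j. 0 < \<alpha> j \<and> \<alpha> j < 1" "\<And>j. 0 < \<rho> j \<and> \<rho> j < 1" "\<And>j. 0 < N j"
    and \<beta>: "\<And>j. \<beta> j \<in> L1_loc"
    and conv: "weakly_L2_sym \<Omega> (\<lambda>j. rescaled_strain w (\<alpha> j) (\<rho> j) (N j) (\<beta> j)) g"
  shows "F_super C \<Omega> g \<le> liminf (\<lambda>j. F_super_approx C w \<Omega> b1 b2 (\<alpha> j) (\<rho> j) (N j) (\<mu> j) (\<beta> j))"
proof -
  define f where "f j = rescaled_strain w (\<alpha> j) (\<rho> j) (N j) (\<beta> j)" for j
  have gs: "g \<in> L2_sym \<Omega>" and f: "f j \<in> L2 M" for j
    using conv unfolding weakly_L2_sym_def f_def by (auto simp: L2_sym_iff[OF op])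
  then have g: "g \<in> L2 M" by (simp add: L2_sym_iff[OF op])
  have lim: "(\<lambda>j. ip M (f j) (\<lambda>x. C (g x))) \<longlonglongrightarrow> ip M g (\<lambda>x. C (g x))"
    using conv C_comp_L2_sym[OF gs] unfolding weakly_L2_sym_def set_integral_eq_ip[OF op] f_def by blast
  have "(\<lambda>j. ennreal ((2 * ip M (f j) (\<lambda>x. C (g x)) - quad C \<Omega> g) / 2)) \<longlonglongrightarrow>
      ennreal ((2 * ip M g (\<lambda>x. C (g x)) - quad C \<Omega> g) / 2)"
    by (intro tendsto_ennrealI tendsto_intros lim) simp
  also have "(2 * ip M g (\<lambda>x. C (g x)) - quad C \<Omega> g) / 2 = quad C \<Omega> g / 2"
    by (simp add: quad_def ip_sym)
  finally have "ennreal (quad C \<Omega> g / 2) = liminf (\<lambda>j. ennreal ((2 * ip M (f j) (\<lambda>x. C (g x)) - quad C \<Omega> g) / 2))"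
    using lim_imp_Liminf[OF sequentially_bot] by metis
  also have "\<dots> \<le> liminf (\<lambda>j. F_super_approx C w \<Omega> b1 b2 (\<alpha> j) (\<rho> j) (N j) (\<mu> j) (\<beta> j))"
  proof (intro Liminf_mono always_eventually allI)
    fix j
    have "(2 * ip M (f j) (\<lambda>x. C (g x)) - quad C \<Omega> g) / 2 \<le> quad C \<Omega> (f j) / 2"
      using quad_lower[OF f g, of j] by (simp add: ip_sym)
    then have "ennreal ((2 * ip M (f j) (\<lambda>x. C (g x)) - quad C \<Omega> g) / 2) \<le> F_super C \<Omega> (f j)"
      unfolding F_super_eq[OF f] by (rule ennreal_leI)
    also have "\<dots> \<le> F_super_approx C w \<Omega> b1 b2 (\<alpha> j) (\<rho> j) (N j) (\<mu> j) (\<beta> j)"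
      unfolding f_def using par \<beta> by (intro F_super_approx_ge) auto
    finally show "ennreal ((2 * ip M (f j) (\<lambda>x. C (g x)) - quad C \<Omega> g) / 2) \<le>
        F_super_approx C w \<Omega> b1 b2 (\<alpha> j) (\<rho> j) (N j) (\<mu> j) (\<beta> j)" .
  qed
  finally show ?thesis by (simp add: F_super_eq[OF g])
qed

end

section \<open>Atomic measures\<close>

text \<open>Negative weights are cut off by \<open>ennreal\<close>, so this is already the positive
  part of the signed combination of Dirac masses.\<close>

definition atoms :: "nat \<Rightarrow> (nat \<Rightarrow> real) \<Rightarrow> (nat \<Rightarrow> R2) \<Rightarrow> R2 measure" where
  "atoms n a x = distr (point_measure {..<n} (\<lambda>i. ennreal (a i))) borel x"

lemma emeasure_atoms:
  assumes "A \<in> sets borel"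
  shows "emeasure (atoms n a x) A = (\<Sum>i<n. ennreal (a i) * indicator A (x i))"
proof -
  have "emeasure (atoms n a x) A = (\<integral>\<^sup>+i. indicator A (x i) \<partial>point_measure {..<n} (\<lambda>i. ennreal (a i)))"
    unfolding atoms_def using assms
    by (subst nn_integral_indicator[symmetric], simp, subst nn_integral_distr)
       (auto simp: measurable_point_measure_eq1)
  also have "\<dots> = (\<Sum>i<n. ennreal (a i) * indicator A (x i))"
    by (rule nn_integral_point_measure_finite) auto
  finally show ?thesis .
qed

text \<open>The supremum over subsets is attained on the atoms of positive weight. The positions
  have to be distinct: coinciding atoms of opposite signs would cancel in the set function but not
  in \<open>atoms\<close>.\<close>

lemma positive_part_atomic:
  assumes inj: "inj_on x {..<n}"
  shows "positive_part (\<lambda>A. if A \<in> sets borel then \<Sum>i<n. indicator A (x i) * a i else 0) = atoms n a x"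
proof -
  let ?\<nu> = "\<lambda>A. if A \<in> sets borel then \<Sum>i<n. indicator A (x i) * a i else (0::real)"
  have "positive_part ?\<nu> = measure_of UNIV (sets borel) (emeasure (atoms n a x))"
    unfolding positive_part_def
  proof (rule measure_of_eq)
    fix A :: "R2 set" assume "A \<in> sigma_sets UNIV (sets borel)"
    then have A: "A \<in> sets borel" by (metis sets.sigma_sets_eq space_borel)
    have e: "ennreal r = ennreal (max 0 r)" for r :: real
      by (cases "r \<ge> 0") (auto simp: max_def ennreal_neg)
    have t: "ennreal (a i) * indicator A (x i) = ennreal (indicator A (x i) * max 0 (a i))" for i
      by (cases "x i \<in> A") (auto simp: e[symmetric])
    have S: "(\<Sum>i<n. ennreal (a i) * indicator A (x i)) = ennreal (\<Sum>i<n. indicator A (x i) * max 0 (a i))"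
      unfolding t by (rule sum_ennreal) auto
    have "(SUP B\<in>{B \<in> sets borel. B \<subseteq> A}. ennreal (?\<nu> B)) = ennreal (\<Sum>i<n. indicator A (x i) * max 0 (a i))"
    proof (rule antisym)
      show "(SUP B\<in>{B \<in> sets borel. B \<subseteq> A}. ennreal (?\<nu> B)) \<le> ennreal (\<Sum>i<n. indicator A (x i) * max 0 (a i))"
      proof (rule SUP_least)
        fix B assume B: "B \<in> {B \<in> sets borel. B \<subseteq> A}"
        have "(\<Sum>i<n. indicator B (x i) * a i) \<le> (\<Sum>i<n. indicator A (x i) * max 0 (a i))"
          using B by (intro sum_mono) (auto simp: indicator_def)
        then show "ennreal (?\<nu> B) \<le> ennreal (\<Sum>i<n. indicator A (x i) * max 0 (a i))"
          using B by (auto intro: ennreal_leI)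
      qed
      define B where "B = A \<inter> x ` {i. i < n \<and> a i > 0}"
      have "x ` {i. i < n \<and> a i > 0} \<in> sets borel" by (intro borel_closed finite_imp_closed) simp
      then have B: "B \<in> sets borel" using A unfolding B_def by (rule sets.Int[rotated])
      have "x i \<in> B \<longleftrightarrow> x i \<in> A \<and> a i > 0" if "i < n" for i
        using that by (auto simp: B_def dest: inj_onD[OF inj])
      then have "indicator B (x i) * a i = indicator A (x i) * max 0 (a i)" if "i < n" for i
        using that by (auto simp: indicator_def)
      then have "(\<Sum>i<n. indicator B (x i) * a i) = (\<Sum>i<n. indicator A (x i) * max 0 (a i))"
        by (intro sum.cong) auto
      then have "ennreal (\<Sum>i<n. indicator A (x i) * max 0 (a i)) = ennreal (?\<nu> B)" using B by simp
      also have "\<dots> \<le> (SUP B\<in>{B \<in> sets borel. B \<subseteq> A}. ennreal (?\<nu> B))"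
        using B by (intro SUP_upper) (auto simp: B_def)
      finally show "ennreal (\<Sum>i<n. indicator A (x i) * max 0 (a i)) \<le> (SUP B\<in>{B \<in> sets borel. B \<subseteq> A}. ennreal (?\<nu> B))" .
    qed
    then show "(SUP B\<in>{B \<in> sets borel. B \<subseteq> A}. ennreal (?\<nu> B)) = emeasure (atoms n a x) A"
      unfolding emeasure_atoms[OF A] S .
  qed auto
  also have "\<dots> = atoms n a x"
    using measure_of_of_measure[of "atoms n a x"] by (simp add: atoms_def)
  finally show ?thesis .
qed

lemma integral_atoms:
  fixes \<phi> :: "R2 \<Rightarrow> real"
  assumes "\<phi> \<in> borel_measurable borel"
  shows "integral\<^sup>L (atoms n a x) \<phi> = (\<Sum>i<n. max 0 (a i) * \<phi> (x i))"
proof -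
  have e: "ennreal r = ennreal (max 0 r)" for r :: real
    by (cases "r \<ge> 0") (auto simp: max_def ennreal_neg)
  have "integral\<^sup>L (atoms n a x) \<phi> = (\<integral>i. \<phi> (x i) \<partial>point_measure {..<n} (\<lambda>i. ennreal (a i)))"
    unfolding atoms_def using assms by (subst integral_distr) (auto simp: measurable_point_measure_eq1)
  also have "\<dots> = (\<integral>i. \<phi> (x i) \<partial>point_measure {..<n} (\<lambda>i. ennreal (max 0 (a i))))"
    by (simp only: e[symmetric])
  also have "\<dots> = (\<Sum>i<n. max 0 (a i) * \<phi> (x i))"
    by (subst lebesgue_integral_point_measure_finite) auto
  finally show ?thesis .
qed

text \<open>Links the curl condition, which is stated through Jordan decompositions, with evaluation
  at the atoms: the positive and the negative part of each weight recombine.\<close>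

lemma measure_distr_diracs:
  fixes n :: nat
  assumes "inj_on x {..<n}" "\<phi> \<in> borel_measurable borel"
  shows "measure_distr (\<lambda>A. \<Sum>i<n. dirac (\<xi> i) (x i) A) \<phi> = (\<Sum>i<n. \<phi> (x i) *\<^sub>R \<xi> i)"
proof -
  have *: "(\<lambda>A. (\<Sum>i<n. dirac (\<xi> i) (x i) A) $ k) =
      (\<lambda>A. if A \<in> sets borel then \<Sum>i<n. indicator A (x i) * (\<xi> i $ k) else 0)" for k
    by (auto simp: fun_eq_iff dirac_def)
  have **: "(\<lambda>A. - ((\<Sum>i<n. dirac (\<xi> i) (x i) A) $ k)) =
      (\<lambda>A. if A \<in> sets borel then \<Sum>i<n. indicator A (x i) * (- (\<xi> i $ k)) else 0)" for k
    by (auto simp: fun_eq_iff dirac_def sum_negf)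
  have "signed_integral (\<lambda>A. (\<Sum>i<n. dirac (\<xi> i) (x i) A) $ k) \<phi> = (\<Sum>i<n. \<phi> (x i) *\<^sub>R \<xi> i) $ k" for k
  proof -
    have "signed_integral (\<lambda>A. (\<Sum>i<n. dirac (\<xi> i) (x i) A) $ k) \<phi> =
        (\<Sum>i<n. max 0 (\<xi> i $ k) * \<phi> (x i)) - (\<Sum>i<n. max 0 (- (\<xi> i $ k)) * \<phi> (x i))"
      unfolding signed_integral_def ** unfolding * positive_part_atomic[OF assms(1)] integral_atoms[OF assms(2)] ..
    also have "\<dots> = (\<Sum>i<n. \<phi> (x i) * (\<xi> i $ k))"
      unfolding sum_subtractf[symmetric] by (intro sum.cong) (auto simp: max_def)
    finally show ?thesis by simp
  qed
  then show ?thesis by (simp add: measure_distr_def vec_eq_iff)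
qed

lemma dirac_sum_vector_measure: "(\<lambda>A. \<Sum>i<(n::nat). dirac (\<xi> i) (x i) A) \<in> vector_measures"
  unfolding vector_measures_def
proof (intro CollectI conjI allI impI)
  fix A :: "R2 set" assume "A \<notin> sets borel"
  then show "(\<Sum>i<n. dirac (\<xi> i) (x i) A) = 0" by (simp add: dirac_def)
next
  fix A :: "nat \<Rightarrow> R2 set" assume A: "range A \<subseteq> sets borel \<and> disjoint_family A"
  have "(\<lambda>m. dirac (\<xi> i) (x i) (A m)) sums dirac (\<xi> i) (x i) (\<Union>m. A m)" for i
  proof -
    have m: "\<And>m. A m \<in> sets borel" "(\<Union>m. A m) \<in> sets borel" using A by auto
    show ?thesis
    proof (cases "x i \<in> (\<Union>m. A m)")
      case True
      then obtain k where k: "x i \<in> A k" by auto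
      then have "x i \<notin> A m" if "m \<noteq> k" for m using A that by (auto simp: disjoint_family_on_def)
      then have "(\<lambda>m. dirac (\<xi> i) (x i) (A m)) = (\<lambda>m. if m = k then \<xi> i else 0)"
        using k m by (auto simp: dirac_def fun_eq_iff)
      then show ?thesis using True m sums_single[of k "\<lambda>_. \<xi> i"] by (simp add: dirac_def)
    next
      case False
      then have "(\<lambda>m. dirac (\<xi> i) (x i) (A m)) = (\<lambda>m. 0)" "dirac (\<xi> i) (x i) (\<Union>m. A m) = 0"
        using m by (auto simp: dirac_def fun_eq_iff)
      then show ?thesis by simp
    qed
  qed
  then show "(\<lambda>m. \<Sum>i<n. dirac (\<xi> i) (x i) (A m)) sums (\<Sum>i<n. dirac (\<xi> i) (x i) (\<Union>m. A m))"
    by (intro sums_sum)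
qed

section \<open>Test functions and elementary fluxes\<close>

text \<open>Keeps the direction of the flux a parameter \<open>i\<close>, so that one argument
  covers both coordinate directions.\<close>

definition other :: "2 \<Rightarrow> 2" where "other i = (if i = 1 then 2 else 1)"

lemma other: "other i \<noteq> i" "i \<noteq> other i" "k \<noteq> i \<longleftrightarrow> k = other i" "UNIV = {i, other i}"
  using exhaust_2[of i] exhaust_2[of k] by (auto simp: other_def UNIV_2)

lemma sum_other: "(\<Sum>k\<in>UNIV. f k) = f i + f (other i)"
  by (subst other(4)[of i]) (simp add: other)

definition mk :: "2 \<Rightarrow> real \<Rightarrow> real \<Rightarrow> R2" where
  "mk i a b = (\<chi> k. if k = i then a else b)"

lemma mk_simps [simp]: "mk i a b $ i = a" "mk i a b $ other i = b"
  by (auto simp: mk_def other)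

lemma vec_eq_other: "x = y \<longleftrightarrow> x $ i = y $ i \<and> x $ other i = (y :: 'a^2) $ other i"
  unfolding vec_eq_iff by (metis other(3))

lemma mk_eq: "mk i a b = a *\<^sub>R axis i 1 + b *\<^sub>R axis (other i) 1"
  by (simp add: vec_eq_other[of _ _ i] axis_def other)

lemma mk_measurable [measurable]: "(\<lambda>(a, b). mk i a b) \<in> borel \<Otimes>\<^sub>M borel \<rightarrow>\<^sub>M borel"
  unfolding mk_eq by measurable

text \<open>Fubini needs a product of two lines; the plane is identified with one by the coordinates
  along and across the direction \<open>i\<close>.\<close>

lemma lborel_R2_eq: "lborel = distr (lborel \<Otimes>\<^sub>M lborel) borel (\<lambda>(a, b). mk i a b)"
proof (rule lborel_eqI)
  fix l u :: R2 assume lu: "\<And>b. b \<in> Basis \<Longrightarrow> l \<bullet> b \<le> u \<bullet> b"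
  have B: "(Basis :: R2 set) = {axis i 1, axis (other i) 1}"
    by (auto simp: Basis_vec_def) (metis other(3))
  have ne: "axis i (1::real) \<noteq> axis (other i) 1" by (simp add: axis_eq_axis other)
  have le: "l $ i \<le> u $ i" "l $ other i \<le> u $ other i"
    using lu[of "axis i 1"] lu[of "axis (other i) 1"] by (auto simp: B inner_axis)
  have "(\<lambda>(a, b). mk i a b) -` box l u = {l $ i<..<u $ i} \<times> {l $ other i<..<u $ other i}"
    by (auto simp: mem_box B inner_axis)
  then have "emeasure (distr (lborel \<Otimes>\<^sub>M lborel) borel (\<lambda>(a, b). mk i a b)) (box l u) =
      emeasure (lborel \<Otimes>\<^sub>M lborel) ({l $ i<..<u $ i} \<times> {l $ other i<..<u $ other i})"
    by (subst emeasure_distr) (auto simp: space_pair_measure)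
  also have "\<dots> = ennreal (u $ i - l $ i) * ennreal (u $ other i - l $ other i)"
    using le by (subst lborel.emeasure_pair_measure_Times) auto
  also have "\<dots> = ennreal (\<Prod>b\<in>Basis. (u - l) \<bullet> b)"
    using le ne by (simp add: B inner_axis ennreal_mult)
  finally show "emeasure (distr (lborel \<Otimes>\<^sub>M lborel) borel (\<lambda>(a, b). mk i a b)) (box l u) = ennreal (\<Prod>b\<in>Basis. (u - l) \<bullet> b)" .
qed simp

text \<open>Both orders occur: \<open>cell_flux\<close> integrates along the direction
  \<open>i\<close> first, \<open>fan_flux\<close> across it.\<close>

lemma integral_R2_iterated:
  fixes f :: "R2 \<Rightarrow> real"
  assumes f: "integrable lborel f"
  shows "(\<integral>x. f x \<partial>lborel) = (\<integral>a. \<integral>b. f (mk i a b) \<partial>lborel \<partial>lborel)"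
    and "(\<integral>x. f x \<partial>lborel) = (\<integral>b. \<integral>a. f (mk i a b) \<partial>lborel \<partial>lborel)"
proof -
  have [measurable]: "f \<in> borel_measurable borel" using f by auto
  have i: "integrable (lborel \<Otimes>\<^sub>M lborel) (\<lambda>(a, b). f (mk i a b))"
    using f by (subst (asm) lborel_R2_eq[of i], subst (asm) integrable_distr_eq) (auto simp: case_prod_unfold)
  have "(\<integral>x. f x \<partial>lborel) = (\<integral>p. f (mk i (fst p) (snd p)) \<partial>(lborel \<Otimes>\<^sub>M lborel))"
    by (subst lborel_R2_eq[of i], subst integral_distr) (auto simp: case_prod_unfold)
  then have e: "(\<integral>x. f x \<partial>lborel) = (\<integral>p. (case p of (a, b) \<Rightarrow> f (mk i a b)) \<partial>(lborel \<Otimes>\<^sub>M lborel))"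
    by (simp add: case_prod_unfold)
  show "(\<integral>x. f x \<partial>lborel) = (\<integral>a. \<integral>b. f (mk i a b) \<partial>lborel \<partial>lborel)"
    unfolding e by (rule lborel_pair.integral_fst[OF i, symmetric])
  show "(\<integral>x. f x \<partial>lborel) = (\<integral>b. \<integral>a. f (mk i a b) \<partial>lborel \<partial>lborel)"
    unfolding e by (rule lborel_pair.integral_snd[OF i, symmetric])
qed

locale test_function =
  fixes \<phi> :: "R2 \<Rightarrow> real" and U :: "R2 set"
  assumes \<phi>: "\<phi> \<in> test_functions U"
begin

abbreviation "D k \<equiv> partial_at k \<phi>"

lemma \<phi>_derivative: "(\<phi> has_derivative (\<lambda>v. \<Sum>k\<in>UNIV. v $ k * D k x)) (at x)"
proof -
  have "\<phi> differentiable_on UNIV"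
    using \<phi> unfolding test_functions_def smooth_fun_def by (auto dest: spec[of _ "[]"])
  then have "\<phi> differentiable at x" by (simp add: differentiable_on_def)
  then have d: "(\<phi> has_derivative frechet_derivative \<phi> (at x)) (at x)"
    using frechet_derivative_works by blast
  then have lin: "linear (frechet_derivative \<phi> (at x))" by (rule has_derivative_linear)
  have "frechet_derivative \<phi> (at x) v = (\<Sum>k\<in>UNIV. v $ k * D k x)" for v
  proof -
    have "v = (\<Sum>k\<in>UNIV. v $ k *\<^sub>R axis k 1)"
      using basis_expansion[of v] by (simp only: scalar_mult_eq_scaleR)
    then have "frechet_derivative \<phi> (at x) v = frechet_derivative \<phi> (at x) (\<Sum>k\<in>UNIV. v $ k *\<^sub>R axis k 1)"
      by (rule arg_cong)
    also have "\<dots> = (\<Sum>k\<in>UNIV. frechet_derivative \<phi> (at x) (v $ k *\<^sub>R axis k 1))"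
      by (rule linear_sum[OF lin])
    also have "\<dots> = (\<Sum>k\<in>UNIV. v $ k * D k x)"
      by (intro sum.cong) (simp_all only: linear_scale[OF lin] partial_at_def real_scaleR_def)
    finally show ?thesis .
  qed
  then have "frechet_derivative \<phi> (at x) = (\<lambda>v. \<Sum>k\<in>UNIV. v $ k * D k x)" by auto
  then show ?thesis using d by simp
qed

lemma D_continuous: "continuous_on A (D k)"
proof -
  have "D k differentiable_on UNIV"
    using \<phi> unfolding test_functions_def smooth_fun_def by (auto dest: spec[of _ "[k]"])
  then show ?thesis using differentiable_imp_continuous_on continuous_on_subset by blast
qed

lemma \<phi>_continuous: "continuous_on A \<phi>"
  by (intro continuous_at_imp_continuous_on ballI has_derivative_continuous[OF \<phi>_derivative])

lemma \<phi>_measurable [measurable]: "\<phi> \<in> borel_measurable borel"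
  by (rule borel_measurable_continuous_onI[OF \<phi>_continuous])

lemma D_measurable [measurable]: "D k \<in> borel_measurable borel"
  by (rule borel_measurable_continuous_onI[OF D_continuous])

lemma D_eq_0: "x \<notin> closure {x. \<phi> x \<noteq> 0} \<Longrightarrow> D k x = 0"
proof -
  assume x: "x \<notin> closure {x. \<phi> x \<noteq> 0}"
  have "(\<phi> has_derivative (\<lambda>_. 0)) (at x)"
  proof (rule has_derivative_transform_within_open[of "\<lambda>_. 0"])
    show "open (- closure {x. \<phi> x \<noteq> 0})" by (rule open_Compl[OF closed_closure])
    show "x \<in> - closure {x. \<phi> x \<noteq> 0}" using x by simp
    show "0 = \<phi> y" if "y \<in> - closure {x. \<phi> x \<noteq> 0}" for y
      using that closure_subset[of "{x. \<phi> x \<noteq> 0}"] by auto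
  qed simp
  then show "D k x = 0" by (simp add: partial_at_def frechet_derivative_at[symmetric])
qed

lemma D_eq_0': "x \<notin> U \<Longrightarrow> D k x = 0"
  using \<phi> D_eq_0 by (auto simp: test_functions_def)

lemma D_bounded: "\<exists>K>0. \<forall>k x. \<bar>D k x\<bar> \<le> K"
proof -
  have c: "compact (closure {x. \<phi> x \<noteq> 0})" using \<phi> by (simp add: test_functions_def)
  have "\<exists>K. \<forall>x. \<bar>D k x\<bar> \<le> K" for k
  proof -
    have "bounded (D k ` closure {x. \<phi> x \<noteq> 0})"
      by (intro compact_imp_bounded compact_continuous_image D_continuous c)
    then obtain K where K: "\<And>x. x \<in> closure {x. \<phi> x \<noteq> 0} \<Longrightarrow> \<bar>D k x\<bar> \<le> K" by (auto simp: bounded_iff)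
    have "\<bar>D k x\<bar> \<le> max K 0" for x
      using K[of x] D_eq_0[of x k] by (cases "x \<in> closure {x. \<phi> x \<noteq> 0}") auto
    then show ?thesis by blast
  qed
  then obtain K where K: "\<And>k x. \<bar>D k x\<bar> \<le> K k" by metis
  have "\<bar>D k x\<bar> \<le> max 1 (max (K 1) (K 2))" for k x
    using K[of k x] exhaust_2[of k] by auto
  then show ?thesis by (intro exI[of _ "max 1 (max (K 1) (K 2))"]) auto
qed

lemma D_mult_integrable:
  assumes f: "integrable lborel f"
  shows "integrable lborel (\<lambda>x. f x * D k x)"
proof -
  obtain K where K: "\<And>k x. \<bar>D k x\<bar> \<le> K" using D_bounded by blast
  have fm [measurable]: "f \<in> borel_measurable borel" using f by auto
  show ?thesis
  proof (rule Bochner_Integration.integrable_bound)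
    show "integrable lborel (\<lambda>x. K * f x)" using f by simp
    show "AE x in lborel. norm (f x * D k x) \<le> norm (K * f x)"
    proof (rule AE_I2)
      fix x
      have "\<bar>f x\<bar> * \<bar>D k x\<bar> \<le> \<bar>f x\<bar> * \<bar>K\<bar>"
        using K[of k x] by (intro mult_left_mono) auto
      then show "norm (f x * D k x) \<le> norm (K * f x)" by (simp add: abs_mult mult.commute)
    qed
  qed measurable
qed

lemma \<phi>_line_derivative:
  "((\<lambda>r. \<phi> (c + r *\<^sub>R v)) has_real_derivative (\<Sum>k\<in>UNIV. v $ k * D k (c + r *\<^sub>R v))) (at r)"
proof -
  have "((\<lambda>r. c + r *\<^sub>R v) has_derivative (\<lambda>t. t *\<^sub>R v)) (at r)"
    by (auto intro!: derivative_eq_intros)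
  from has_derivative_compose[OF this \<phi>_derivative]
  have "((\<lambda>r. \<phi> (c + r *\<^sub>R v)) has_derivative (\<lambda>t. \<Sum>k\<in>UNIV. (t *\<^sub>R v) $ k * D k (c + r *\<^sub>R v))) (at r)" .
  moreover have "(\<lambda>t. \<Sum>k\<in>UNIV. (t *\<^sub>R v) $ k * D k (c + r *\<^sub>R v)) = (*) (\<Sum>k\<in>UNIV. v $ k * D k (c + r *\<^sub>R v))"
    by (simp add: fun_eq_iff sum_distrib_right sum_distrib_left mult_ac)
  ultimately show ?thesis by (simp add: has_field_derivative_def)
qed

lemma \<phi>_line_FTC:
  assumes "0 \<le> a"
  shows "(\<integral>r. (\<Sum>k\<in>UNIV. v $ k * D k (c + r *\<^sub>R v)) * indicator {0<..<a} r \<partial>lborel) = \<phi> (c + a *\<^sub>R v) - \<phi> c"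
proof -
  have cont: "isCont (\<lambda>r. \<Sum>k\<in>UNIV. v $ k * D k (c + r *\<^sub>R v)) r" for r
  proof -
    have "continuous_on UNIV (\<lambda>r. \<Sum>k\<in>UNIV. v $ k * D k (c + r *\<^sub>R v))"
      by (intro continuous_intros continuous_on_compose2[OF D_continuous[of UNIV]]) auto
    then show ?thesis by (simp add: continuous_on_eq_continuous_at)
  qed
  have "(\<integral>r. (\<Sum>k\<in>UNIV. v $ k * D k (c + r *\<^sub>R v)) * indicator {0..a} r \<partial>lborel) = \<phi> (c + a *\<^sub>R v) - \<phi> (c + 0 *\<^sub>R v)"
    by (rule integral_FTC_Icc_real[OF assms \<phi>_line_derivative cont])
  moreover have "(\<integral>r. (\<Sum>k\<in>UNIV. v $ k * D k (c + r *\<^sub>R v)) * indicator {0<..<a} r \<partial>lborel) =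
      (\<integral>r. (\<Sum>k\<in>UNIV. v $ k * D k (c + r *\<^sub>R v)) * indicator {0..a} r \<partial>lborel)"
  proof (rule integral_cong_AE)
    show "AE r in lborel. (\<Sum>k\<in>UNIV. v $ k * D k (c + r *\<^sub>R v)) * indicator {0<..<a} r =
        (\<Sum>k\<in>UNIV. v $ k * D k (c + r *\<^sub>R v)) * indicator {0..a} r"
      using AE_lborel_singleton[of 0] AE_lborel_singleton[of a]
      by eventually_elim (auto simp: indicator_def)
  qed measurable
  ultimately show ?thesis by simp
qed

end

section \<open>Elementary fluxes: fans and cells\<close>

text \<open>The field \<^term>\<open>fan i s\<close> spreads a unit flux from the origin over the edge
  $\{z_i = s/2,\ |z_{i'}| < s/2\}$ along straight rays.\<close>

definition fan :: "2 \<Rightarrow> real \<Rightarrow> R2 \<Rightarrow> R2" where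
  "fan i s z = (if 0 < z $ i \<and> z $ i < s / 2 \<and> \<bar>z $ other i\<bar> < z $ i then (1 / (2 * (z $ i)\<^sup>2)) *\<^sub>R z else 0)"

lemma fan_measurable [measurable]: "fan i s \<in> borel_measurable borel"
proof -
  have [measurable]: "(\<lambda>z::R2. z $ k) \<in> borel_measurable borel" for k
    by (intro borel_measurable_continuous_onI continuous_intros)
  show ?thesis unfolding fan_def by measurable
qed

lemma norm_R2_sq: "(norm (z::R2))\<^sup>2 = (z $ i)\<^sup>2 + (z $ other i)\<^sup>2"
  unfolding power2_norm_eq_inner inner_vec_def sum_other[of _ i] by (simp add: power2_eq_square)

text \<open>In the sector where the transversal coordinate is smaller than z_i one has |z|^2 \<le> 2
  z_i^2. This bounds the field and, together with z_i < s/2, the extent of its support.\<close>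

lemma norm_fan_le: "norm (fan i s z) \<le> indicator (ball 0 s) z / norm z"
proof (cases "0 < z $ i \<and> z $ i < s / 2 \<and> \<bar>z $ other i\<bar> < z $ i")
  case True
  then have "(z $ other i)\<^sup>2 \<le> (z $ i)\<^sup>2"
    by (metis abs_ge_self abs_le_square_iff less_eq_real_def order_trans)
  then have n: "(norm z)\<^sup>2 \<le> 2 * (z $ i)\<^sup>2" by (simp add: norm_R2_sq[of z i])
  have "z \<noteq> 0" using True by auto
  then have nz: "norm z > 0" by simp
  have "(norm z)\<^sup>2 < s\<^sup>2"
  proof -
    have "(z $ i)\<^sup>2 < (s / 2)\<^sup>2" using True by (intro power_strict_mono) auto
    moreover have "(s / 2)\<^sup>2 = s\<^sup>2 / 4" by (simp add: power_divide)
    ultimately show ?thesis using n zero_le_power2[of s] by linarith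
  qed
  then have "norm z < s" using True by (intro power_less_imp_less_base[of "norm z" 2 s]) auto
  moreover have "norm (fan i s z) \<le> 1 / norm z"
  proof -
    have "norm (fan i s z) = norm z / (2 * (z $ i)\<^sup>2)" using True by (simp add: fan_def)
    also have "\<dots> \<le> norm z / (norm z)\<^sup>2" using n nz True by (intro divide_left_mono mult_pos_pos) auto
    also have "\<dots> = 1 / norm z" using nz by (simp add: power2_eq_square)
    finally show ?thesis .
  qed
  ultimately show ?thesis by (simp add: indicator_def)
next
  case False
  then show ?thesis by (auto simp: fan_def)
qed

lemma fan_support: "norm z \<ge> s \<Longrightarrow> fan i s z = 0"
  using norm_fan_le[of i s z] by auto

lemma fan_cell:
  assumes "fan i s z \<noteq> 0" shows "\<bar>z $ k\<bar> < s / 2"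
  using assms other(3)[of k i] by (cases "k = i") (auto simp: fan_def split: if_splits)

lemma integrable_fan: "integrable lborel (fan i s)"
proof (cases "s > 0")
  case True
  show ?thesis
  proof (rule integrableI_bounded)
    have "(\<integral>\<^sup>+z. ennreal (norm (fan i s z)) \<partial>lborel) \<le> (\<integral>\<^sup>+z. ennreal (norm (z::R2) powr (-1)) * indicator (cball 0 s) z \<partial>lborel)"
    proof (rule nn_integral_mono)
      fix z :: R2
      have "norm z powr (-1) = 1 / norm z" by (cases "z = 0") (auto simp: powr_minus_divide)
      then show "ennreal (norm (fan i s z)) \<le> ennreal (norm z powr (-1)) * indicator (cball 0 s) z"
        using norm_fan_le[of i s z] fan_support[of s z i]
        by (cases "norm z < s") (auto simp: indicator_def intro!: ennreal_leI)
    qed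
    also have "\<dots> < \<infinity>" using True by (subst nn_integral_norm_powr_cball) auto
    finally show "(\<integral>\<^sup>+z. ennreal (norm (fan i s z)) \<partial>lborel) < \<infinity>" .
  qed measurable
next
  case False
  then have "fan i s = (\<lambda>z. 0)" by (auto simp: fun_eq_iff fan_def)
  then show ?thesis by simp
qed

text \<open>Half-open in both coordinates, so that the cells of a lattice tile the plane without
  overlap.\<close>

definition cell :: "2 \<Rightarrow> real \<Rightarrow> R2 \<Rightarrow> R2 set" where
  "cell i s p = {x. p $ i \<le> x $ i \<and> x $ i < p $ i + s \<and> p $ other i \<le> x $ other i \<and> x $ other i < p $ other i + s}"

lemma cell_measurable [measurable]: "cell i s p \<in> sets borel"
proof -
  have [measurable]: "(\<lambda>z::R2. z $ k) \<in> borel_measurable borel" for k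
    by (intro borel_measurable_continuous_onI continuous_intros)
  have "{x \<in> space borel. p $ i \<le> x $ i \<and> x $ i < p $ i + s \<and> p $ other i \<le> x $ other i \<and> x $ other i < p $ other i + s} \<in> sets borel"
    by measurable
  then show ?thesis by (simp add: cell_def)
qed

lemma integrable_cell: "integrable lborel (indicator (cell i s p) :: R2 \<Rightarrow> real)"
proof -
  have "bounded (cell i s p)"
  proof (rule boundedI)
    fix x assume x: "x \<in> cell i s p"
    have "norm x \<le> \<bar>x $ i\<bar> + \<bar>x $ other i\<bar>"
      using norm_le_l1_cart[of x] by (simp add: sum_other[of _ i])
    also have "\<dots> \<le> (\<bar>p $ i\<bar> + s) + (\<bar>p $ other i\<bar> + s)"
      using x by (auto simp: cell_def)
    finally show "norm x \<le> (\<bar>p $ i\<bar> + s) + (\<bar>p $ other i\<bar> + s)" .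
  qed
  then show ?thesis
    by (intro integrable_real_indicator) (auto dest: emeasure_bounded_finite)
qed

text \<open>The mean of \<phi> over the edge of length \<open>s\<close> that starts at
  \<open>p\<close> and is orthogonal to the direction \<open>i\<close>. Both elementary fluxes are
  tested in terms of these means, which is what lets them cancel.\<close>

definition (in test_function) edge :: "2 \<Rightarrow> real \<Rightarrow> R2 \<Rightarrow> real" where
  "edge i s p = (1 / s) * (\<integral>t. \<phi> (mk i (p $ i) t) * indicator {p $ other i..<p $ other i + s} t \<partial>lborel)"

context test_function
begin

lemma integrable_strip: "integrable lborel (\<lambda>t. \<phi> (mk i a t) * indicator {b..<b + s} t)"
proof -
  have c: "continuous_on {b..b+s} (\<lambda>t. \<phi> (mk i a t))"
    unfolding mk_eq by (intro continuous_on_compose2[OF \<phi>_continuous[of UNIV]] continuous_intros) auto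
  have i: "integrable lborel (\<lambda>t. indicator {b..b+s} t *\<^sub>R \<phi> (mk i a t))"
    using borel_integrable_compact[OF _ c] by simp
  have [measurable]: "(\<lambda>t. \<phi> (mk i a t)) \<in> borel_measurable borel"
    unfolding mk_eq by measurable
  show ?thesis
    by (rule Bochner_Integration.integrable_bound[OF i]) (auto simp: indicator_def)
qed

text \<open>The divergence theorem for the constant field along \<open>i\<close> on a square: only
  the two edges orthogonal to \<open>i\<close> contribute.\<close>

lemma cell_flux:
  assumes s: "s > 0"
  shows "(\<integral>x. indicator (cell i s p) x * D i x \<partial>lborel) = s * (edge i s (p + s *\<^sub>R axis i 1) - edge i s p)"
proof -
  define a b where "a = p $ i" and "b = p $ other i"
  have "(\<integral>x. indicator (cell i s p) x * D i x \<partial>lborel) =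
      (\<integral>t. (\<integral>r. indicator (cell i s p) (mk i r t) * D i (mk i r t) \<partial>lborel) \<partial>lborel)"
    by (rule integral_R2_iterated(2)[OF D_mult_integrable[OF integrable_cell]])
  also have "\<dots> = (\<integral>t. \<phi> (mk i (a + s) t) * indicator {b..<b + s} t - \<phi> (mk i a t) * indicator {b..<b + s} t \<partial>lborel)"
  proof (rule Bochner_Integration.integral_cong[OF refl])
    fix t :: real
    have "(\<integral>r. indicator (cell i s p) (mk i r t) * D i (mk i r t) \<partial>lborel) =
        indicator {b..<b + s} t * (\<integral>r. D i (mk i r t) * indicator {a..<a + s} r \<partial>lborel)"
      by (subst integral_mult_right_zero[symmetric])
         (auto intro!: Bochner_Integration.integral_cong simp: cell_def indicator_def a_def b_def)
    also have "(\<integral>r. D i (mk i r t) * indicator {a..<a + s} r \<partial>lborel) =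
        (\<integral>r. D i (mk i (a + r) t) * indicator {0..<s} r \<partial>lborel)"
      using lborel_integral_real_affine[of 1 "\<lambda>r. D i (mk i r t) * indicator {a..<a + s} r" a]
      by (simp add: indicator_def)
    also have "\<dots> = (\<integral>r. (\<Sum>k\<in>UNIV. axis i 1 $ k * D k (mk i a t + r *\<^sub>R axis i 1)) * indicator {0<..<s} r \<partial>lborel)"
    proof (rule integral_cong_AE)
      have e: "(\<Sum>k\<in>UNIV. axis i 1 $ k * D k (mk i a t + r *\<^sub>R axis i 1)) = D i (mk i (a + r) t)" for r
        by (simp add: sum_other[of _ i] axis_def other mk_eq algebra_simps)
      show "AE r in lborel. D i (mk i (a + r) t) * indicator {0..<s} r =
         (\<Sum>k\<in>UNIV. axis i 1 $ k * D k (mk i a t + r *\<^sub>R axis i 1)) * indicator {0<..<s} r"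
        unfolding e using AE_lborel_singleton[of 0] by eventually_elim (auto simp: indicator_def)
      show "(\<lambda>r. D i (mk i (a + r) t) * indicator {0..<s} r) \<in> borel_measurable lborel"
        unfolding mk_eq by measurable
    qed measurable
    also have "\<dots> = \<phi> (mk i a t + s *\<^sub>R axis i 1) - \<phi> (mk i a t)"
      using s by (intro \<phi>_line_FTC) simp
    also have "mk i a t + s *\<^sub>R axis i 1 = mk i (a + s) t" by (simp add: mk_eq algebra_simps)
    finally show "(\<integral>r. indicator (cell i s p) (mk i r t) * D i (mk i r t) \<partial>lborel) =
       \<phi> (mk i (a + s) t) * indicator {b..<b + s} t - \<phi> (mk i a t) * indicator {b..<b + s} t"
      by (simp add: algebra_simps)
  qed
  also have "\<dots> = s * (edge i s (p + s *\<^sub>R axis i 1) - edge i s p)"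
    unfolding Bochner_Integration.integral_diff[OF integrable_strip integrable_strip]
    using s by (simp add: edge_def a_def b_def axis_def other right_diff_distrib)
  finally show ?thesis .
qed

text \<open>In the coordinates z = r (1, u) the field times the area element is half of (1, u),
  independently of r: the Jacobian r and the length factor r cancel against 1/(2 r^2). Integration
  along each ray gives a difference of end point values, and averaging over u in (-1, 1) gives the
  mean over the edge minus the value at the apex.\<close>

lemma fan_flux:
  assumes s: "s > 0"
  shows "(\<integral>z. (\<Sum>k\<in>UNIV. fan i s z $ k * D k (c + z)) \<partial>lborel) =
    edge i s (c + mk i (s / 2) (- s / 2)) - \<phi> c"
proof -
  define v where "v u = mk i 1 u" for u
  define G where "G r u = (\<Sum>k\<in>UNIV. v u $ k * D k (c + r *\<^sub>R v u)) * indicator {0<..<s/2} r * indicator {-1<..<1} u" for r u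
  obtain K where K: "0 < K" "\<And>k x. \<bar>D k x\<bar> \<le> K" using D_bounded by blast
  have comp: "integrable lborel (\<lambda>z. fan i s z $ k)" for k
    by (rule integrable_bounded_linear[OF bounded_linear_vec_nth integrable_fan])
  have Dm [measurable]: "(\<lambda>z. D k (c + z)) \<in> borel_measurable borel" for k by measurable
  have int: "integrable lborel (\<lambda>z. \<Sum>k\<in>UNIV. fan i s z $ k * D k (c + z))"
  proof (rule Bochner_Integration.integrable_sum)
    fix k :: 2
    show "integrable lborel (\<lambda>z. fan i s z $ k * D k (c + z))"
    proof (rule Bochner_Integration.integrable_bound)
      show "integrable lborel (\<lambda>z. K * fan i s z $ k)" using comp by simp
      show "(\<lambda>z. fan i s z $ k * D k (c + z)) \<in> borel_measurable lborel"
        using comp[of k] by (intro borel_measurable_times) auto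
      show "AE z in lborel. norm (fan i s z $ k * D k (c + z)) \<le> norm (K * fan i s z $ k)"
        using K by (intro AE_I2) (auto simp: abs_mult mult.commute intro!: mult_right_mono)
    qed
  qed
  have "(\<integral>z. (\<Sum>k\<in>UNIV. fan i s z $ k * D k (c + z)) \<partial>lborel) =
      (\<integral>r. \<integral>t. (\<Sum>k\<in>UNIV. fan i s (mk i r t) $ k * D k (c + mk i r t)) \<partial>lborel \<partial>lborel)"
    by (rule integral_R2_iterated(1)[OF int])
  also have "\<dots> = (\<integral>r. (1/2) * (\<integral>u. G r u \<partial>lborel) \<partial>lborel)"
  proof (rule Bochner_Integration.integral_cong[OF refl])
    fix r :: real
    show "(\<integral>t. (\<Sum>k\<in>UNIV. fan i s (mk i r t) $ k * D k (c + mk i r t)) \<partial>lborel) = (1/2) * (\<integral>u. G r u \<partial>lborel)"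
    proof (cases "0 < r \<and> r < s / 2")
      case True
      have mv: "mk i r (r * u) = r *\<^sub>R v u" for u by (simp add: mk_eq v_def algebra_simps)
      have "(\<integral>t. (\<Sum>k\<in>UNIV. fan i s (mk i r t) $ k * D k (c + mk i r t)) \<partial>lborel) =
         r * (\<integral>u. (\<Sum>k\<in>UNIV. fan i s (mk i r (r * u)) $ k * D k (c + mk i r (r * u))) \<partial>lborel)"
        using True lborel_integral_real_affine[of r "\<lambda>t. \<Sum>k\<in>UNIV. fan i s (mk i r t) $ k * D k (c + mk i r t)" 0] by simp
      also have "\<dots> = (\<integral>u. r * (\<Sum>k\<in>UNIV. fan i s (mk i r (r * u)) $ k * D k (c + mk i r (r * u))) \<partial>lborel)"
        by simp
      also have "\<dots> = (\<integral>u. (1/2) * G r u \<partial>lborel)"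
      proof (rule Bochner_Integration.integral_cong[OF refl])
        fix u :: real
        have iff: "\<bar>r * u\<bar> < r \<longleftrightarrow> -1 < u \<and> u < 1" using True by (auto simp: abs_mult)
        have "fan i s (mk i r (r * u)) = (indicator {-1<..<1} u / (2 * r\<^sup>2)) *\<^sub>R mk i r (r * u)"
          using True iff by (auto simp: fan_def indicator_def)
        then have e: "fan i s (mk i r (r * u)) $ k = (1 / (2 * r)) * v u $ k * indicator {-1<..<1} u" for k
          using True by (simp add: mv power2_eq_square)
        show "r * (\<Sum>k\<in>UNIV. fan i s (mk i r (r * u)) $ k * D k (c + mk i r (r * u))) = (1/2) * G r u"
          unfolding e using True by (simp add: G_def mv sum_other[of _ i] field_simps)
      qed
      finally show ?thesis by simp
    next
      case False
      then have "G r u = 0" "fan i s (mk i r u) = 0" for u by (auto simp: G_def fan_def)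
      then show ?thesis by simp
    qed
  qed
  also have "\<dots> = (1/2) * (\<integral>r. \<integral>u. G r u \<partial>lborel \<partial>lborel)" by simp
  \<comment> \<open>In these coordinates the singularity of the fan has disappeared: the integrand
    is bounded by \<open>2 * K\<close> on a bounded rectangle, so the order of integration can be
    exchanged.\<close>
  also have "(\<integral>r. \<integral>u. G r u \<partial>lborel \<partial>lborel) = (\<integral>u. \<integral>r. G r u \<partial>lborel \<partial>lborel)"
  proof (rule lborel_pair.Fubini_integral)
    have vm [measurable]: "v \<in> borel_measurable borel" unfolding v_def[abs_def] mk_eq by measurable
    have vk [measurable]: "(\<lambda>u. v u $ k) \<in> borel_measurable borel" for k
      by (cases "k = i") (auto simp: v_def other(3)[of k i])
    show "integrable (lborel \<Otimes>\<^sub>M lborel) (\<lambda>(u, r). G r u)"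
    proof (rule integrableI_bounded_set[where A = "{-1<..<1} \<times> {0<..<s/2}" and B = "2 * K"])
      show "(\<lambda>(u, r). G r u) \<in> borel_measurable (lborel \<Otimes>\<^sub>M lborel)"
        unfolding G_def by measurable
      show "emeasure (lborel \<Otimes>\<^sub>M lborel) ({-1<..<1::real} \<times> {0<..<s/2}) < (\<infinity>::ennreal)"
        using s by (subst lborel.emeasure_pair_measure_Times) (auto simp: ennreal_mult_less_top)
      have "norm (G r u) \<le> 2 * K" if "-1 < u" "u < 1" for r u
      proof -
        have "\<bar>u\<bar> * \<bar>D (other i) (c + r *\<^sub>R v u)\<bar> \<le> 1 * K"
          using K that by (intro mult_mono) auto
        then have "\<bar>D i (c + r *\<^sub>R v u) + u * D (other i) (c + r *\<^sub>R v u)\<bar> \<le> K + 1 * K"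
          using K by (intro order_trans[OF abs_triangle_ineq] add_mono) (auto simp: abs_mult)
        then show ?thesis using K by (auto simp: G_def sum_other[of _ i] v_def indicator_def)
      qed
      then show "AE x in lborel \<Otimes>\<^sub>M lborel. x \<in> {-1<..<1} \<times> {0<..<s/2} \<longrightarrow> norm (case x of (u, r) \<Rightarrow> G r u) \<le> 2 * K"
        by (intro AE_I2) auto
      show "AE x in lborel \<Otimes>\<^sub>M lborel. x \<notin> {-1<..<1} \<times> {0<..<s/2} \<longrightarrow> (case x of (u, r) \<Rightarrow> G r u) = 0"
        by (intro AE_I2) (auto simp: G_def indicator_def)
    qed auto
  qed
  also have "\<dots> = (\<integral>u. (\<phi> (c + (s/2) *\<^sub>R v u) - \<phi> c) * indicator {-1<..<1} u \<partial>lborel)"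
  proof (rule Bochner_Integration.integral_cong[OF refl])
    fix u :: real
    have "(\<integral>r. G r u \<partial>lborel) = (\<integral>r. (\<Sum>k\<in>UNIV. v u $ k * D k (c + r *\<^sub>R v u)) * indicator {0<..<s/2} r \<partial>lborel) * indicator {-1<..<1} u"
      by (simp add: G_def)
    then show "(\<integral>r. G r u \<partial>lborel) = (\<phi> (c + (s/2) *\<^sub>R v u) - \<phi> c) * indicator {-1<..<1} u"
      using s by (subst (asm) \<phi>_line_FTC) auto
  qed
  \<comment> \<open>The end point -1 is added to match the half-open edges.\<close>
  also have "\<dots> = (\<integral>u. \<phi> (c + (s/2) *\<^sub>R v u) * indicator {-1..<1} u - \<phi> c * indicator {-1..<1} u \<partial>lborel)"
  proof (rule integral_cong_AE)
    have vm [measurable]: "v \<in> borel_measurable borel" unfolding v_def[abs_def] mk_eq by measurable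
    show "(\<lambda>u. (\<phi> (c + (s/2) *\<^sub>R v u) - \<phi> c) * indicator {-1<..<1} u) \<in> borel_measurable lborel"
      by measurable
    show "(\<lambda>u. \<phi> (c + (s/2) *\<^sub>R v u) * indicator {-1..<1} u - \<phi> c * indicator {-1..<1} u) \<in> borel_measurable lborel"
      by measurable
    show "AE u in lborel. (\<phi> (c + (s/2) *\<^sub>R v u) - \<phi> c) * indicator {-1<..<1} u =
        \<phi> (c + (s/2) *\<^sub>R v u) * indicator {-1..<1} u - \<phi> c * indicator {-1..<1} u"
      using AE_lborel_singleton[of "-1"] by eventually_elim (auto simp: indicator_def)
  qed
  also have "\<dots> = 2 * edge i s (c + mk i (s / 2) (- s / 2)) - 2 * \<phi> c"
  proof -
    define p where "p = c + mk i (s / 2) (- s / 2)"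
    \<comment> \<open>The midpoint of the edge, so that u in [-1, 1) runs through it with speed
      s/2.\<close>
    define t0 where "t0 = p $ other i + s / 2"
    let ?f = "\<lambda>t. \<phi> (mk i (p $ i) t) * indicator {p $ other i..<p $ other i + s} t"
    have cv: "\<phi> (c + (s/2) *\<^sub>R v u) * indicator {-1..<1} u = ?f (t0 + (s/2) * u)" for u
    proof -
      have "c + (s/2) *\<^sub>R v u = mk i (p $ i) (t0 + (s/2) * u)"
        by (simp add: vec_eq_other[of _ _ i] v_def p_def t0_def)
      moreover have "t0 + (s/2) * u \<in> {p $ other i..<p $ other i + s} \<longleftrightarrow> u \<in> {-1..<1}"
      proof -
        have "t0 + (s/2) * u - p $ other i = (s/2) * (u + 1)" "p $ other i + s - (t0 + (s/2) * u) = (s/2) * (1 - u)"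
          by (auto simp: t0_def algebra_simps)
        then show ?thesis using s
          by (smt (verit) atLeastLessThan_iff half_gt_zero mult_nonneg_nonneg mult_pos_neg mult_pos_pos mult_nonneg_nonpos)
      qed
      ultimately show ?thesis by (simp add: indicator_def)
    qed
    have i1: "integrable lborel (\<lambda>u. ?f (t0 + (s/2) * u))"
      using s by (intro lborel_integrable_real_affine integrable_strip) auto
    have "(\<integral>u. \<phi> (c + (s/2) *\<^sub>R v u) * indicator {-1..<1} u - \<phi> c * indicator {-1..<1} u \<partial>lborel) =
       (\<integral>u. ?f (t0 + (s/2) * u) \<partial>lborel) - 2 * \<phi> c"
      unfolding cv using i1 by (subst Bochner_Integration.integral_diff) auto
    moreover have "(\<integral>t. ?f t \<partial>lborel) = (s/2) * (\<integral>u. ?f (t0 + (s/2) * u) \<partial>lborel)"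
      using s lborel_integral_real_affine[of "s/2" ?f t0] by simp
    moreover have "edge i s p = (1 / s) * (\<integral>t. ?f t \<partial>lborel)" by (rule edge_def)
    ultimately have a: "edge i s p = (1 / s) * ((s/2) * (\<integral>u. ?f (t0 + (s/2) * u) \<partial>lborel))"
      and b: "(\<integral>u. \<phi> (c + (s/2) *\<^sub>R v u) * indicator {-1..<1} u - \<phi> c * indicator {-1..<1} u \<partial>lborel) =
       (\<integral>u. ?f (t0 + (s/2) * u) \<partial>lborel) - 2 * \<phi> c" by simp_all
    have "edge i s p = (\<integral>u. ?f (t0 + (s/2) * u) \<partial>lborel) / 2" unfolding a using s by simp
    with b show ?thesis unfolding p_def[symmetric] by linarith
  qed
  finally show ?thesis by simp
qed

end

section \<open>Lattice fields\<close>

definition corner :: "real \<Rightarrow> int^2 \<Rightarrow> R2" where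
  "corner s e = (\<chi> k. s * of_int (e $ k))"

definition center :: "real \<Rightarrow> int^2 \<Rightarrow> R2" where
  "center s e = (\<chi> k. s * (of_int (e $ k) + 1/2))"

definition index :: "real \<Rightarrow> R2 \<Rightarrow> int^2" where
  "index s x = (\<chi> k. \<lfloor>x $ k / s\<rfloor>)"

definition box_index :: "int \<Rightarrow> (int^2) set" where
  "box_index K = {e. \<forall>k. \<bar>e $ k\<bar> \<le> K}"

lemma finite_box_index: "finite (box_index K)" and card_box_index: "K \<ge> 0 \<Longrightarrow> real (card (box_index K)) \<le> (2 * of_int K + 1)\<^sup>2"
proof -
  have inj: "inj_on (\<lambda>e. (e $ 1, e $ 2)) (box_index K)"
    by (auto simp: inj_on_def vec_eq_iff forall_2)
  have sub: "(\<lambda>e. (e $ 1, e $ 2)) ` box_index K \<subseteq> {-K..K} \<times> {-K..K}"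
    by (auto simp: box_index_def abs_le_iff minus_le_iff)
  show fin: "finite (box_index K)"
    using finite_imageD[OF finite_subset[OF sub] inj] by simp
  assume K: "K \<ge> 0"
  have "card (box_index K) \<le> card ({-K..K} \<times> {-K..K})"
    by (rule card_inj_on_le[OF inj sub]) simp
  also have "\<dots> = nat (2 * K + 1) * nat (2 * K + 1)" by (simp add: card_cartesian_product)
  finally have "real (card (box_index K)) \<le> real (nat (2 * K + 1) * nat (2 * K + 1))" by (rule of_nat_mono)
  also have "\<dots> = (2 * of_int K + 1)\<^sup>2" using K by (simp add: power2_eq_square)
  finally show "real (card (box_index K)) \<le> (2 * of_int K + 1)\<^sup>2" .
qed

lemma center_dist:
  assumes "s > 0" "e \<noteq> e'" shows "norm (center s e - center s e') \<ge> s"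
proof -
  obtain k where k: "e $ k \<noteq> e' $ k" using assms by (auto simp: vec_eq_iff)
  have "\<bar>(center s e - center s e') $ k\<bar> = s * \<bar>of_int (e $ k - e' $ k)\<bar>"
  proof -
    have "(center s e - center s e') $ k = s * of_int (e $ k - e' $ k)"
      by (simp add: center_def algebra_simps)
    then show ?thesis using assms by (simp add: abs_mult)
  qed
  also have "\<dots> \<ge> s * 1"
  proof (intro mult_left_mono)
    have "1 \<le> \<bar>e $ k - e' $ k\<bar>" using k by linarith
    then show "1 \<le> \<bar>real_of_int (e $ k - e' $ k)\<bar>" by (metis of_int_1_le_iff of_int_abs)
  qed (use assms in simp)
  finally show ?thesis using component_le_norm_cart[of "center s e - center s e'" k] by simp
qed

lemma corner_shift: "corner s (e + axis i 1) = corner s e + s *\<^sub>R axis i 1"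
  by (simp add: corner_def vec_eq_iff axis_def algebra_simps)

text \<open>The fan issuing from the centre of a cell ends on the edge shared with the next cell in
  direction \<open>i\<close>, and this edge starts at the corner of that next cell.\<close>

lemma center_edge: "center s e + mk i (s / 2) (- s / 2) = corner s (e + axis i 1)"
  by (simp add: corner_def center_def vec_eq_other[of _ _ i] axis_def other algebra_simps)

lemma center_shift: "norm (center s (e + axis i 1) - center s e) = \<bar>s\<bar>"
proof -
  have "center s (e + axis i 1) - center s e = s *\<^sub>R axis i 1"
    by (simp add: center_def vec_eq_iff axis_def algebra_simps)
  then show ?thesis by simp
qed

lemma cell_corner_iff:
  assumes "s > 0" shows "x \<in> cell i s (corner s e) \<longleftrightarrow> e = index s x"
proof -
  have "s * of_int m \<le> y \<and> y < s * of_int m + s \<longleftrightarrow> m = \<lfloor>y / s\<rfloor>" for m :: int and y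
  proof -
    have "\<lfloor>y / s\<rfloor> = m \<longleftrightarrow> of_int m \<le> y / s \<and> y / s < of_int m + 1" by (rule floor_eq_iff)
    then show ?thesis using assms by (auto simp: field_simps)
  qed
  then show ?thesis
    by (auto simp: cell_def corner_def index_def vec_eq_other[of _ _ i])
qed

lemma index_center_dist:
  assumes "s > 0" shows "norm (x - center s (index s x)) \<le> s"
proof -
  have c: "\<bar>(x - center s (index s x)) $ k\<bar> \<le> s / 2" for k
  proof -
    have "x $ k / s < of_int \<lfloor>x $ k / s\<rfloor> + 1" by linarith
    then have "x $ k < s * of_int \<lfloor>x $ k / s\<rfloor> + s"
      using assms by (simp add: field_simps)
    moreover have "s * of_int \<lfloor>x $ k / s\<rfloor> \<le> x $ k"
      using pos_le_divide_eq[OF assms, THEN iffD1, OF of_int_floor_le] by (simp only: mult.commute)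
    moreover have "(x - center s (index s x)) $ k = x $ k - (s * of_int \<lfloor>x $ k / s\<rfloor> + s / 2)"
      by (simp add: center_def index_def algebra_simps)
    ultimately show ?thesis by linarith
  qed
  have "norm (x - center s (index s x)) \<le> (\<Sum>k\<in>UNIV. \<bar>(x - center s (index s x)) $ k\<bar>)" by (rule norm_le_l1_cart)
  also have "\<dots> \<le> (\<Sum>k\<in>(UNIV::2 set). s / 2)" by (rule sum_mono) (rule c)
  finally show ?thesis by simp
qed

definition near :: "real \<Rightarrow> R2 \<Rightarrow> (int^2) set" where
  "near s x = {e. \<forall>k. \<bar>x $ k - center s e $ k\<bar> < s}"

text \<open>Within distance \<open>s\<close> of a given coordinate there is room for at most three
  lattice positions, and 9 is the count for two coordinates. The potentials of fans centred
  elsewhere vanish at \<open>x\<close>.\<close>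

lemma card_near:
  assumes "s > 0" shows "finite (near s x)" "card (near s x) \<le> 9"
proof -
  define a where "a k = \<lfloor>x $ k / s\<rfloor>" for k
  have inj: "inj_on (\<lambda>e. (e $ 1, e $ 2)) (near s x)"
    by (auto simp: inj_on_def vec_eq_iff forall_2)
  have r: "a k - 1 \<le> e $ k \<and> e $ k \<le> a k + 1" if "e \<in> near s x" for e k
  proof -
    have *: "\<bar>x $ k - s * (of_int (e $ k) + 1/2)\<bar> < s" using that by (auto simp: near_def center_def)
    then have "x $ k / s < of_int (e $ k) + 3/2" "of_int (e $ k) - 1/2 < x $ k / s"
      using assms by (auto simp: abs_less_iff field_simps)
    then show ?thesis unfolding a_def by linarith
  qed
  have sub: "(\<lambda>e. (e $ 1, e $ 2)) ` near s x \<subseteq> {a 1 - 1..a 1 + 1} \<times> {a 2 - 1..a 2 + 1}"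
    using r by auto
  show "finite (near s x)" using finite_imageD[OF finite_subset[OF sub] inj] by simp
  have "card (near s x) \<le> card ({a 1 - 1..a 1 + 1} \<times> {a 2 - 1..a 2 + 1})"
    by (rule card_inj_on_le[OF inj sub]) simp
  also have "\<dots> = 9" by (simp add: card_cartesian_product)
  finally show "card (near s x) \<le> 9" .
qed

text \<open>The integer \<open>n e\<close> is the flux through the cell \<open>e\<close> in
  direction \<open>i\<close>. The box has to contain also the predecessors of the support, because a
  jump sits in the cell before the one whose flux it feeds.\<close>

locale lattice_field =
  fixes s :: real and n :: "int^2 \<Rightarrow> int" and i :: 2 and K :: int
  assumes s: "0 < s" and n_support: "\<And>e. n e \<noteq> 0 \<or> n (e + axis i 1) \<noteq> 0 \<Longrightarrow> e \<in> box_index K"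
begin

abbreviation "I \<equiv> box_index K"

definition jump :: "int^2 \<Rightarrow> int" where "jump e = n (e + axis i 1) - n e"

text \<open>A flux \<open>n e\<close> spread over an edge of length \<open>s\<close> has density
  \<open>n e / s\<close>.\<close>

definition bulk :: "R2 \<Rightarrow> real" where
  "bulk x = (\<Sum>e\<in>I. (of_int (n e) / s) * indicator (cell i s (corner s e)) x)"

definition core :: "R2 \<Rightarrow> R2" where
  "core x = (\<Sum>e\<in>I. of_int (jump e) *\<^sub>R fan i s (x - center s e))"

definition field :: "R2 \<Rightarrow> R2" where
  "field x = bulk x *\<^sub>R axis i 1 + core x"

lemma fin: "finite I" by (rule finite_box_index)

lemma jump_support: "jump e \<noteq> 0 \<Longrightarrow> e \<in> I"
  using n_support[of e] by (auto simp: jump_def)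

lemma bulk_eq: "bulk x = of_int (n (index s x)) / s"
proof -
  have "bulk x = (\<Sum>e\<in>I. if e = index s x then of_int (n e) / s else 0)"
    unfolding bulk_def by (intro sum.cong) (auto simp: indicator_def cell_corner_iff[OF s])
  then show ?thesis using fin n_support[of "index s x"] by (auto simp: sum.delta)
qed

lemma integrable_bulk: "integrable lborel bulk"
  unfolding bulk_def by (intro Bochner_Integration.integrable_sum integrable_mult_right integrable_cell)

lemma integrable_fan_shift: "integrable lborel (\<lambda>x. fan i s (x - c))"
proof -
  have "integrable (distr lborel borel ((+) (- c))) (fan i s)"
    by (subst lborel_distr_plus) (rule integrable_fan)
  then show ?thesis by (subst (asm) integrable_distr_eq) auto
qed

lemma integrable_core: "integrable lborel core"
  unfolding core_def by (intro Bochner_Integration.integrable_sum integrable_scaleR_right integrable_fan_shift)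

lemma integrable_field: "integrable lborel field"
  unfolding field_def[abs_def]
  by (intro Bochner_Integration.integrable_add integrable_scaleR_left integrable_bulk integrable_core)

text \<open>Summation by parts. The edge mean at the far side of a cell gets the weight
  \<open>n e\<close> from the bulk and the weight \<open>jump e\<close> from the fan, together the
  flux of the next cell; this cancels the contribution of the near side of that cell. Only the
  apices of the fans remain.\<close>

lemma divergence:
  assumes "test_function \<phi> U"
  shows "(\<integral>x. (\<Sum>k\<in>UNIV. field x $ k * partial_at k \<phi> x) \<partial>lborel) = - (\<Sum>e\<in>I. of_int (jump e) * \<phi> (center s e))"
proof -
  interpret test_function \<phi> U by fact
  define E where "E e = edge i s (corner s e)" for e
  have comp: "integrable lborel (\<lambda>x. fan i s (x - c) $ k)" for k c
    by (rule integrable_bounded_linear[OF bounded_linear_vec_nth integrable_fan_shift])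
  have cint: "integrable lborel (\<lambda>x. of_int (n e) / s * (indicator (cell i s (corner s e)) x * D i x))" for e
    by (intro integrable_mult_right D_mult_integrable integrable_cell)
  have fint: "integrable lborel (\<lambda>x. of_int (jump e) * (\<Sum>k\<in>UNIV. fan i s (x - c) $ k * D k x))" for e c
    by (intro integrable_mult_right Bochner_Integration.integrable_sum D_mult_integrable comp)
  define A where "A e x = of_int (n e) / s * (indicator (cell i s (corner s e)) x * D i x)" for e x
  define B where "B e x = of_int (jump e) * (\<Sum>k\<in>UNIV. fan i s (x - center s e) $ k * D k x)" for e x
  have split: "(\<Sum>k\<in>UNIV. field x $ k * D k x) = (\<Sum>e\<in>I. A e x) + (\<Sum>e\<in>I. B e x)" for x
    by (simp add: A_def B_def field_def bulk_def core_def sum_other[of _ i] axis_def other sum_distrib_right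
        sum_component sum_distrib_left sum.distrib algebra_simps)
  have "(\<integral>x. (\<Sum>k\<in>UNIV. field x $ k * D k x) \<partial>lborel) = (\<integral>x. (\<Sum>e\<in>I. A e x) \<partial>lborel) + (\<integral>x. (\<Sum>e\<in>I. B e x) \<partial>lborel)"
    unfolding split A_def B_def
    by (intro Bochner_Integration.integral_add Bochner_Integration.integrable_sum cint fint)
  also have "(\<integral>x. (\<Sum>e\<in>I. A e x) \<partial>lborel) = (\<Sum>e\<in>I. \<integral>x. A e x \<partial>lborel)"
    unfolding A_def by (intro Bochner_Integration.integral_sum cint)
  also have "(\<integral>x. (\<Sum>e\<in>I. B e x) \<partial>lborel) = (\<Sum>e\<in>I. \<integral>x. B e x \<partial>lborel)"
    unfolding B_def by (intro Bochner_Integration.integral_sum fint)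
  also have "(\<Sum>e\<in>I. \<integral>x. A e x \<partial>lborel) = (\<Sum>e\<in>I. of_int (n e) / s * (\<integral>x. indicator (cell i s (corner s e)) x * D i x \<partial>lborel))"
    unfolding A_def by (intro sum.cong refl integral_mult_right_zero)
  also have "(\<Sum>e\<in>I. \<integral>x. B e x \<partial>lborel) =
      (\<Sum>e\<in>I. of_int (jump e) * (\<integral>x. (\<Sum>k\<in>UNIV. fan i s (x - center s e) $ k * D k x) \<partial>lborel))"
    unfolding B_def by (intro sum.cong refl integral_mult_right_zero)
  also have "(\<Sum>e\<in>I. of_int (n e) / s * (\<integral>x. indicator (cell i s (corner s e)) x * D i x \<partial>lborel)) +
      (\<Sum>e\<in>I. of_int (jump e) * (\<integral>x. (\<Sum>k\<in>UNIV. fan i s (x - center s e) $ k * D k x) \<partial>lborel)) =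
      (\<Sum>e\<in>I. of_int (n e) * (E (e + axis i 1) - E e)) +
      (\<Sum>e\<in>I. of_int (jump e) * (E (e + axis i 1) - \<phi> (center s e)))"
  proof -
    have 1: "(\<integral>x. indicator (cell i s (corner s e)) x * D i x \<partial>lborel) = s * (E (e + axis i 1) - E e)" for e
      using cell_flux[OF s] by (simp add: E_def corner_shift)
    have 2: "(\<integral>x. (\<Sum>k\<in>UNIV. fan i s (x - c) $ k * D k x) \<partial>lborel) = (\<integral>z. (\<Sum>k\<in>UNIV. fan i s z $ k * D k (c + z)) \<partial>lborel)" for c
    proof -
      have "(\<integral>x. (\<Sum>k\<in>UNIV. fan i s (x - c) $ k * D k x) \<partial>lborel) =
          (\<integral>x. (\<Sum>k\<in>UNIV. fan i s (x - c) $ k * D k x) \<partial>distr lborel borel ((+) c))"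
        by (subst lborel_distr_plus) simp
      also have "\<dots> = (\<integral>z. (\<Sum>k\<in>UNIV. fan i s z $ k * D k (c + z)) \<partial>lborel)"
      proof (subst integral_distr)
        have "(\<lambda>x. fan i s (x - c) $ k) \<in> borel_measurable borel" for k
          using borel_measurable_integrable[OF comp] by simp
        then show "(\<lambda>x. \<Sum>k\<in>UNIV. fan i s (x - c) $ k * D k x) \<in> borel_measurable borel"
          by (intro borel_measurable_sum borel_measurable_times D_measurable)
      qed auto
      finally show ?thesis .
    qed
    have 3: "(\<integral>x. (\<Sum>k\<in>UNIV. fan i s (x - center s e) $ k * D k x) \<partial>lborel) = E (e + axis i 1) - \<phi> (center s e)" for e
      unfolding 2 using fan_flux[OF s] center_edge by (simp add: E_def)
    show ?thesis unfolding 1 3 using s by simp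
  qed
  also have "\<dots> = (\<Sum>e\<in>I. of_int (n (e + axis i 1)) * E (e + axis i 1)) - (\<Sum>e\<in>I. of_int (n e) * E e)
      - (\<Sum>e\<in>I. of_int (jump e) * \<phi> (center s e))"
    by (simp add: jump_def algebra_simps sum.distrib sum_subtractf)
  \<comment> \<open>A shift of the summation index, allowed because the support of \<open>n\<close>
    and its shifted copy both lie in the box.\<close>
  also have "(\<Sum>e\<in>I. of_int (n (e + axis i 1)) * E (e + axis i 1)) = (\<Sum>e\<in>I. of_int (n e) * E e)"
  proof -
    have "(\<Sum>e\<in>I. of_int (n (e + axis i 1)) * E (e + axis i 1)) =
        (\<Sum>e\<in>{e. n (e + axis i 1) \<noteq> 0}. of_int (n (e + axis i 1)) * E (e + axis i 1))"
      using fin n_support by (intro sum.mono_neutral_right) auto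
    also have "\<dots> = (\<Sum>e\<in>{e. n e \<noteq> 0}. of_int (n e) * E e)"
      by (rule sum.reindex_bij_witness[of _ "\<lambda>e. e - axis i 1" "\<lambda>e. e + axis i 1"]) auto
    also have "\<dots> = (\<Sum>e\<in>I. of_int (n e) * E e)"
      using fin n_support by (intro sum.mono_neutral_left) auto
    finally show ?thesis .
  qed
  finally show ?thesis by simp
qed

end

section \<open>Potentials of the fans\<close>

locale lattice_kernel = kernel Q \<rho> + lattice_field s n i K
  for Q \<rho> s n i K +
  fixes \<alpha> :: real
  assumes \<alpha>: "0 < \<alpha>" "\<alpha> \<le> 1/2" and Q_le: "\<And>z. z \<noteq> 0 \<Longrightarrow> Q z \<le> \<alpha> * norm z powr (\<alpha> - 2)"
    and \<rho>_s: "\<rho> \<le> s / 2" and s_le: "s \<le> 1/2"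
begin

text \<open>The fan is dominated by 1/|y-c|, which reduces both claims to the Riesz convolution
  bound.\<close>

lemma fan_conv:
  assumes x: "x \<noteq> c"
  shows "integrable lebesgue (\<lambda>y. Q (x - y) *\<^sub>R fan i s (y - c))"
    and "norm (conv Q (\<lambda>y. fan i s (y - c)) x) \<le> 16 * pi * norm (x - c) powr (\<alpha> - 1)"
proof -
  let ?f = "\<lambda>z. ennreal (\<alpha> * norm ((x - c) - z) powr (\<alpha> - 2) / norm z)"
  have "(\<integral>\<^sup>+y. ennreal (norm (Q (x - y) *\<^sub>R fan i s (y - c))) \<partial>lborel) \<le> (\<integral>\<^sup>+y. ?f (y - c) \<partial>lborel)"
  proof (rule nn_integral_mono_AE, use AE_lborel_singleton[of x] in eventually_elim)
    fix y assume "y \<noteq> x"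
    then have "Q (x - y) \<le> \<alpha> * norm (x - y) powr (\<alpha> - 2)" by (intro Q_le) simp
    moreover have "norm (fan i s (y - c)) \<le> 1 / norm (y - c)"
      using norm_fan_le[of i s "y - c"] by (auto simp: indicator_def split: if_splits intro: order_trans)
    ultimately have "Q (x - y) * norm (fan i s (y - c)) \<le> (\<alpha> * norm (x - y) powr (\<alpha> - 2)) * (1 / norm (y - c))"
      using \<alpha> by (intro mult_mono) auto
    then show "ennreal (norm (Q (x - y) *\<^sub>R fan i s (y - c))) \<le> ?f (y - c)"
      by (intro ennreal_leI) (simp add: Q_nonneg)
  qed
  also have "\<dots> = (\<integral>\<^sup>+z. ?f z \<partial>lborel)"
    by (rule nn_integral_lborel_translate) measurable
  also have "\<dots> \<le> ennreal (16 * pi * norm (x - c) powr (\<alpha> - 1))"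
    using x \<alpha> by (intro riesz_convolution_bound) auto
  finally have b: "(\<integral>\<^sup>+y. ennreal (norm (Q (x - y) *\<^sub>R fan i s (y - c))) \<partial>lborel) \<le> ennreal (16 * pi * norm (x - c) powr (\<alpha> - 1))" .
  have m: "(\<lambda>y. Q (x - y) *\<^sub>R fan i s (y - c)) \<in> borel_measurable lborel" by measurable
  have i: "integrable lborel (\<lambda>y. Q (x - y) *\<^sub>R fan i s (y - c))"
    using b by (intro integrableI_bounded[OF m]) (auto intro: le_less_trans)
  then show "integrable lebesgue (\<lambda>y. Q (x - y) *\<^sub>R fan i s (y - c))"
    using integrable_completion[OF m] by simp
  have "ennreal (norm (conv Q (\<lambda>y. fan i s (y - c)) x)) \<le> ennreal (16 * pi * norm (x - c) powr (\<alpha> - 1))"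
    unfolding conv_def integral_completion[OF m] using integral_norm_bound_ennreal[OF i] b by (rule order_trans)
  then show "norm (conv Q (\<lambda>y. fan i s (y - c)) x) \<le> 16 * pi * norm (x - c) powr (\<alpha> - 1)"
    by (subst (asm) ennreal_le_iff) auto
qed

text \<open>In each coordinate the fan reaches less than s/2 from its centre and the kernel adds
  less than \<rho> \<le> s/2.\<close>

lemma fan_conv_support:
  assumes "conv Q (\<lambda>y. fan i s (y - c)) x \<noteq> 0" shows "\<bar>x $ k - c $ k\<bar> < s"
proof (rule ccontr)
  assume far: "\<not> \<bar>x $ k - c $ k\<bar> < s"
  have "Q (x - y) *\<^sub>R fan i s (y - c) = 0" for y
  proof (rule ccontr)
    assume "Q (x - y) *\<^sub>R fan i s (y - c) \<noteq> 0"
    then have "\<bar>(y - c) $ k\<bar> < s / 2" "norm (x - y) < \<rho>"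
      using fan_cell[of i s "y - c" k] Q_supp[of "x - y"] by (auto simp: not_le[symmetric])
    moreover have "\<bar>(x - y) $ k\<bar> \<le> norm (x - y)" by (rule component_le_norm_cart)
    ultimately show False using far \<rho>_s unfolding vector_minus_component by linarith
  qed
  then have "conv Q (\<lambda>y. fan i s (y - c)) x = (\<integral>y. (0::R2) \<partial>(lebesgue :: R2 measure))"
    unfolding conv_def by (simp only:)
  then show False using assms by simp
qed

abbreviation "off_center x \<equiv> \<forall>e\<in>I. x \<noteq> center s e"

lemma AE_off_center: "AE x in lborel. off_center x"
  by (intro AE_finite_allI fin AE_lborel_singleton)

lemma core_conv_integrable: "off_center x \<Longrightarrow> integrable lebesgue (\<lambda>y. Q (x - y) *\<^sub>R core y)"
  unfolding core_def scaleR_sum_right scaleR_left_commute[of "Q _"]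
  by (intro Bochner_Integration.integrable_sum integrable_scaleR_right fan_conv) auto

text \<open>At any point at most nine fan potentials are nonzero, so Cauchy-Schwarz costs the factor
  9 instead of the number of cells. Coordinate distances below \<open>s\<close> give a Euclidean
  distance of at most \<open>2 * s\<close>, which is the cut-off kept for the integration.\<close>

lemma core_conv_sq_le:
  assumes x: "off_center x"
  shows "(norm (conv Q core x))\<^sup>2 \<le> 9 * (\<Sum>e\<in>I. (of_int (jump e))\<^sup>2 *
    ((16 * pi)\<^sup>2 * (norm (x - center s e) powr (2 * \<alpha> - 2) * indicator (cball 0 (2 * s)) (x - center s e))))"
proof -
  define c where "c e = conv Q (\<lambda>y. fan i s (y - center s e)) x" for e
  define b where "b e = norm (x - center s e) powr (2 * \<alpha> - 2) * indicator (cball 0 (2 * s)) (x - center s e)" for e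
  have "conv Q core x = (\<Sum>e\<in>I. of_int (jump e) *\<^sub>R c e)"
  proof -
    have "conv Q core x = (\<integral>y. (\<Sum>e\<in>I. of_int (jump e) *\<^sub>R (Q (x - y) *\<^sub>R fan i s (y - center s e))) \<partial>lebesgue)"
      by (simp only: conv_def core_def scaleR_sum_right scaleR_left_commute[of "Q _"])
    also have "\<dots> = (\<Sum>e\<in>I. (\<integral>y. of_int (jump e) *\<^sub>R (Q (x - y) *\<^sub>R fan i s (y - center s e)) \<partial>lebesgue))"
      using x by (intro Bochner_Integration.integral_sum integrable_scaleR_right fan_conv) auto
    also have "\<dots> = (\<Sum>e\<in>I. of_int (jump e) *\<^sub>R c e)"
      unfolding c_def conv_def by (intro sum.cong refl integral_scaleR_right)
    finally show ?thesis .
  qed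
  also have "\<dots> = (\<Sum>e\<in>I \<inter> near s x. of_int (jump e) *\<^sub>R c e)"
    using fin fan_conv_support by (intro sum.mono_neutral_right) (auto simp: near_def c_def)
  finally have "norm (conv Q core x) \<le> (\<Sum>e\<in>I \<inter> near s x. norm (of_int (jump e) *\<^sub>R c e))"
    by (simp only: norm_sum)
  then have "(norm (conv Q core x))\<^sup>2 \<le> (\<Sum>e\<in>I \<inter> near s x. norm (of_int (jump e) *\<^sub>R c e))\<^sup>2"
    by (intro power_mono) auto
  also have "\<dots> \<le> (\<Sum>e\<in>I \<inter> near s x. (norm (of_int (jump e) *\<^sub>R c e))\<^sup>2) * card (I \<inter> near s x)"
    by (rule sum_squared_le_sum_of_squares)
  also have "\<dots> \<le> (\<Sum>e\<in>I \<inter> near s x. (norm (of_int (jump e) *\<^sub>R c e))\<^sup>2) * 9"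
  proof (intro mult_left_mono sum_nonneg)
    have "card (I \<inter> near s x) \<le> card (near s x)" using card_near(1)[OF s] by (intro card_mono) auto
    then show "real (card (I \<inter> near s x)) \<le> 9" using card_near(2)[OF s, of x] by linarith
  qed auto
  also have "(\<Sum>e\<in>I \<inter> near s x. (norm (of_int (jump e) *\<^sub>R c e))\<^sup>2) \<le>
      (\<Sum>e\<in>I \<inter> near s x. (of_int (jump e))\<^sup>2 * ((16 * pi)\<^sup>2 * b e))"
  proof (rule sum_mono)
    fix e assume e: "e \<in> I \<inter> near s x"
    define z where "z = x - center s e"
    have z: "norm z > 0" using x e by (auto simp: z_def)
    have "norm z \<le> (\<Sum>k\<in>UNIV. \<bar>z $ k\<bar>)" by (rule norm_le_l1_cart)
    also have "\<dots> \<le> (\<Sum>k\<in>(UNIV::2 set). s)" using e by (intro sum_mono) (auto simp: near_def z_def less_imp_le)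
    finally have zs: "norm z \<le> 2 * s" by simp
    have "norm (c e) \<le> 16 * pi * norm z powr (\<alpha> - 1)"
      unfolding c_def z_def using x e by (intro fan_conv) auto
    then have "(norm (c e))\<^sup>2 \<le> (16 * pi * norm z powr (\<alpha> - 1))\<^sup>2" by (intro power_mono) auto
    also have "\<dots> = (16 * pi)\<^sup>2 * norm z powr (2 * \<alpha> - 2)"
    proof -
      have "(norm z powr (\<alpha> - 1))\<^sup>2 = norm z powr (2 * \<alpha> - 2)"
        using z by (simp add: power2_eq_square powr_add[symmetric])
      then show ?thesis by (simp add: power_mult_distrib)
    qed
    also have "\<dots> = (16 * pi)\<^sup>2 * b e" using zs by (simp add: b_def z_def)
    finally show "(norm (of_int (jump e) *\<^sub>R c e))\<^sup>2 \<le> (of_int (jump e))\<^sup>2 * ((16 * pi)\<^sup>2 * b e)"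
      by (simp add: power_mult_distrib mult_left_mono)
  qed
  also have "\<dots> \<le> (\<Sum>e\<in>I. (of_int (jump e))\<^sup>2 * ((16 * pi)\<^sup>2 * b e))"
    using fin by (intro sum_mono2) (auto simp: b_def)
  finally show ?thesis by (simp add: b_def mult.commute)
qed

text \<open>The self-energy of a single fan: the integral of |z|^(2\<alpha>-2) over the disc of
  radius 2s is (pi/\<alpha>) (2s)^(2\<alpha>), at most pi/\<alpha> because 2s \<le> 1.\<close>

lemma nn_core_conv:
  "(\<integral>\<^sup>+x. ennreal ((norm (conv Q core x))\<^sup>2) \<partial>lborel) \<le> ennreal (9 * (16 * pi)\<^sup>2 * (pi / \<alpha>) * (\<Sum>e\<in>I. (of_int (jump e))\<^sup>2))"
proof -
  define b where "b z = norm (z::R2) powr (2 * \<alpha> - 2) * indicator (cball 0 (2 * s)) z" for z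
  have [measurable]: "cball (0::R2) (2 * s) \<in> sets borel" by (intro borel_closed) simp
  have bm [measurable]: "b \<in> borel_measurable borel" unfolding b_def by measurable
  have b0: "0 \<le> b z" for z by (simp add: b_def)
  define C :: real where "C = (16 * pi)\<^sup>2"
  have C: "C \<ge> 0" by (simp add: C_def)
  have nb: "(\<integral>\<^sup>+x. ennreal (b (x - c)) \<partial>lborel) \<le> ennreal (pi / \<alpha>)" for c
  proof -
    have "(\<integral>\<^sup>+x. ennreal (b (x - c)) \<partial>lborel) = (\<integral>\<^sup>+x. ennreal (b x) \<partial>lborel)"
      by (rule nn_integral_lborel_translate) measurable
    also have "\<dots> = (\<integral>\<^sup>+z. ennreal (norm (z::R2) powr (2 * \<alpha> - 2)) * indicator (cball 0 (2 * s)) z \<partial>lborel)"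
      by (intro nn_integral_cong) (auto simp: b_def indicator_def)
    also have "\<dots> = ennreal (2 * pi * (2 * s) powr (2 * \<alpha>) / (2 * \<alpha>))"
      using nn_integral_norm_powr_cball[of "2 * \<alpha> - 2" "2 * s"] \<alpha> s by simp
    also have "\<dots> \<le> ennreal (pi / \<alpha>)"
    proof (rule ennreal_leI)
      have "(2 * s) powr (2 * \<alpha>) \<le> 1" using s s_le \<alpha> by (intro powr_le1) auto
      then have "pi / \<alpha> * (2 * s) powr (2 * \<alpha>) \<le> pi / \<alpha> * 1" using \<alpha> by (intro mult_left_mono) auto
      then show "2 * pi * (2 * s) powr (2 * \<alpha>) / (2 * \<alpha>) \<le> pi / \<alpha>" by simp
    qed
    finally show ?thesis .
  qed
  have "(\<integral>\<^sup>+x. ennreal ((norm (conv Q core x))\<^sup>2) \<partial>lborel) \<le>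
      (\<integral>\<^sup>+x. (\<Sum>e\<in>I. ennreal (9 * (of_int (jump e))\<^sup>2 * C) * ennreal (b (x - center s e))) \<partial>lborel)"
  proof (rule nn_integral_mono_AE, use AE_off_center in eventually_elim)
    fix x assume "off_center x"
    from core_conv_sq_le[OF this]
    have "(norm (conv Q core x))\<^sup>2 \<le> (\<Sum>e\<in>I. 9 * (of_int (jump e))\<^sup>2 * C * b (x - center s e))"
      by (simp add: sum_distrib_left b_def C_def mult.assoc)
    then have "ennreal ((norm (conv Q core x))\<^sup>2) \<le> ennreal (\<Sum>e\<in>I. 9 * (of_int (jump e))\<^sup>2 * C * b (x - center s e))"
      by (rule ennreal_leI)
    also have "\<dots> = (\<Sum>e\<in>I. ennreal (9 * (of_int (jump e))\<^sup>2 * C * b (x - center s e)))"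
      by (rule sum_ennreal[symmetric]) (auto simp: C b0)
    also have "\<dots> = (\<Sum>e\<in>I. ennreal (9 * (of_int (jump e))\<^sup>2 * C) * ennreal (b (x - center s e)))"
      by (intro sum.cong refl ennreal_mult) (auto simp: C b0)
    finally show "ennreal ((norm (conv Q core x))\<^sup>2) \<le> (\<Sum>e\<in>I. ennreal (9 * (of_int (jump e))\<^sup>2 * C) * ennreal (b (x - center s e)))" .
  qed
  also have "\<dots> = (\<Sum>e\<in>I. ennreal (9 * (of_int (jump e))\<^sup>2 * C) * (\<integral>\<^sup>+x. ennreal (b (x - center s e)) \<partial>lborel))"
    by (subst nn_integral_sum, measurable, intro sum.cong refl nn_integral_cmult) measurable
  also have "\<dots> \<le> (\<Sum>e\<in>I. ennreal (9 * (of_int (jump e))\<^sup>2 * C) * ennreal (pi / \<alpha>))"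
    by (intro sum_mono mult_left_mono nb) auto
  also have "\<dots> = (\<Sum>e\<in>I. ennreal (9 * (of_int (jump e))\<^sup>2 * C * (pi / \<alpha>)))"
    using \<alpha> C by (intro sum.cong refl ennreal_mult[symmetric]) auto
  also have "\<dots> = ennreal (\<Sum>e\<in>I. 9 * (of_int (jump e))\<^sup>2 * C * (pi / \<alpha>))"
    using \<alpha> C by (intro sum_ennreal) auto
  also have "(\<Sum>e\<in>I. 9 * (of_int (jump e))\<^sup>2 * C * (pi / \<alpha>)) = 9 * C * (pi / \<alpha>) * (\<Sum>e\<in>I. (of_int (jump e))\<^sup>2)"
    by (simp add: sum_distrib_left mult_ac)
  finally show ?thesis by (simp add: C_def)
qed

end

section \<open>Lattice approximation of a Lipschitz density\<close>

locale recovery = lattice_kernel Q \<rho> s n i K \<alpha>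
  for Q \<rho> s n i K \<alpha> +
  fixes N L G :: real and g :: "R2 \<Rightarrow> real"
  assumes N: "0 < N" and L: "0 \<le> L" "\<And>x y. \<bar>g x - g y\<bar> \<le> L * norm (x - y)" and G: "\<And>x. \<bar>g x\<bar> \<le> G"
    and n_def: "\<And>e. n e = \<lfloor>N * s * g (center s e)\<rfloor>"
begin

text \<open>Rounding costs at most 1 in the flux and so 1/s in the density, and the centre of the
  cell of \<open>y\<close> is within \<open>s\<close> of \<open>y\<close>. The second point is kept
  free because the convolution at \<open>x\<close> compares the bulk near \<open>x\<close> with
  g(x).\<close>

lemma bulk_close: "\<bar>bulk y - N * g x\<bar> \<le> 1 / s + N * L * s + N * L * norm (y - x)"
proof -
  define e where "e = index s y"
  have "\<bar>of_int (n e) - N * s * g (center s e)\<bar> \<le> 1" unfolding n_def by linarith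
  then have "\<bar>(of_int (n e) - N * s * g (center s e)) / s\<bar> \<le> 1 / s"
    using s by (simp add: divide_right_mono)
  then have 1: "\<bar>of_int (n e) / s - N * g (center s e)\<bar> \<le> 1 / s" using s by (simp add: field_simps)
  have "norm (center s e - x) \<le> norm (center s e - y) + norm (y - x)"
    using norm_triangle_ineq[of "center s e - y" "y - x"] by simp
  also have "\<dots> \<le> s + norm (y - x)"
    using index_center_dist[OF s, of y] by (simp add: e_def norm_minus_commute)
  finally have "\<bar>g (center s e) - g x\<bar> \<le> L * (s + norm (y - x))"
    by (intro order_trans[OF L(2)] mult_left_mono L)
  then have "N * \<bar>g (center s e) - g x\<bar> \<le> N * (L * (s + norm (y - x)))" using N by (intro mult_left_mono) auto
  then have 2: "\<bar>N * g (center s e) - N * g x\<bar> \<le> N * L * s + N * L * norm (y - x)"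
  proof -
    have "N * g (center s e) - N * g x = N * (g (center s e) - g x)" by (simp add: right_diff_distrib)
    then have "\<bar>N * g (center s e) - N * g x\<bar> = N * \<bar>g (center s e) - g x\<bar>" using N by (simp add: abs_mult)
    moreover have "N * (L * (s + norm (y - x))) = N * L * s + N * L * norm (y - x)" by (simp add: distrib_left)
    ultimately show ?thesis
      using \<open>N * \<bar>g (center s e) - g x\<bar> \<le> N * (L * (s + norm (y - x)))\<close> by linarith
  qed
  show ?thesis using 1 2 unfolding bulk_eq e_def[symmetric] by linarith
qed

lemma bulk_conv_integrable: "integrable lebesgue (\<lambda>y. Q (x - y) *\<^sub>R bulk y)"
proof (rule Bochner_Integration.integrable_bound)
  let ?B = "1 / s + N * L * s + N * G"
  show "integrable lebesgue (\<lambda>y. ?B * Q (x - y))" using Q_shift_integrable by simp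
  have "bulk \<in> borel_measurable lborel" using integrable_bulk by auto
  then have "(\<lambda>y. Q (x - y) *\<^sub>R bulk y) \<in> borel_measurable lborel" by measurable
  then show "(\<lambda>y. Q (x - y) *\<^sub>R bulk y) \<in> borel_measurable lebesgue" by (rule measurable_completion)
  show "AE y in lebesgue. norm (Q (x - y) *\<^sub>R bulk y) \<le> norm (?B * Q (x - y))"
  proof (rule AE_I2)
    fix y
    have "\<bar>N * g y\<bar> \<le> N * G" using N G[of y] by (simp add: abs_mult mult_left_mono)
    moreover have "\<bar>bulk y - N * g y\<bar> \<le> 1 / s + N * L * s" using bulk_close[of y y] by simp
    ultimately have "\<bar>bulk y\<bar> \<le> ?B" by linarith
    then have "Q (x - y) * \<bar>bulk y\<bar> \<le> Q (x - y) * \<bar>?B\<bar>" by (intro mult_left_mono) (auto simp: Q_nonneg)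
    then show "norm (Q (x - y) *\<^sub>R bulk y) \<le> norm (?B * Q (x - y))"
      by (simp add: abs_mult Q_nonneg mult.commute)
  qed
qed

text \<open>The relative error of the bulk, from four sources: rounding, the width of the cells, the
  radius of the kernel, and the deviation of its mass from 1.\<close>

definition err :: real where
  "err = q * (1 / (N * s) + L * s + L * \<rho>) + \<bar>q - 1\<bar> * G"

lemma bulk_conv: "\<bar>conv Q bulk x - N * g x\<bar> \<le> N * err"
proof -
  let ?B = "1 / s + N * L * s + N * L * \<rho>"
  have c: "integrable lebesgue (\<lambda>y. Q (x - y) *\<^sub>R (N * g x))" "(\<integral>y. Q (x - y) *\<^sub>R (N * g x) \<partial>lebesgue) = q * (N * g x)"
    using Q_shift_integrable[of x] by auto
  have d: "integrable lebesgue (\<lambda>y. Q (x - y) *\<^sub>R (bulk y - N * g x))"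
    using Bochner_Integration.integrable_diff[OF bulk_conv_integrable c(1)] by (simp add: algebra_simps)
  \<comment> \<open>The comparison is with \<open>q\<close> times the density, since the kernel has
    mass \<open>q\<close>; the deviation of \<open>q\<close> from 1 is paid for separately.\<close>
  have "conv Q bulk x - q * (N * g x) = (\<integral>y. Q (x - y) *\<^sub>R (bulk y - N * g x) \<partial>lebesgue)"
    unfolding conv_def c(2)[symmetric]
    by (subst Bochner_Integration.integral_diff[OF bulk_conv_integrable c(1), symmetric]) (simp add: algebra_simps)
  also have "\<bar>\<dots>\<bar> \<le> (\<integral>y. ?B * Q (x - y) \<partial>lebesgue)"
  proof (rule integral_abs_bound_integral[OF d])
    show "integrable lebesgue (\<lambda>y. ?B * Q (x - y))" using Q_shift_integrable by simp
    fix y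
    show "\<bar>Q (x - y) *\<^sub>R (bulk y - N * g x)\<bar> \<le> ?B * Q (x - y)"
    proof (cases "norm (x - y) \<ge> \<rho>")
      case False
      then have "N * L * norm (y - x) \<le> N * L * \<rho>"
        using N L(1) by (intro mult_left_mono) (auto simp: norm_minus_commute)
      then have "\<bar>bulk y - N * g x\<bar> \<le> ?B" using bulk_close[of y x] by linarith
      then have "Q (x - y) * \<bar>bulk y - N * g x\<bar> \<le> Q (x - y) * ?B" by (intro mult_left_mono) (auto simp: Q_nonneg)
      then show ?thesis by (simp add: abs_mult Q_nonneg mult.commute)
    qed (simp add: Q_supp)
  qed
  also have "\<dots> = q * ?B" using Q_shift_integrable(2)[of x] by simp
  also have "\<dots> = N * (q * (1 / (N * s) + L * s + L * \<rho>))" using N by (simp add: field_simps)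
  finally have 1: "\<bar>conv Q bulk x - q * (N * g x)\<bar> \<le> N * (q * (1 / (N * s) + L * s + L * \<rho>))" .
  have "\<bar>q * (N * g x) - N * g x\<bar> = N * (\<bar>q - 1\<bar> * \<bar>g x\<bar>)"
  proof -
    have "q * (N * g x) - N * g x = N * ((q - 1) * g x)" by (simp add: algebra_simps)
    then show ?thesis using N by (simp add: abs_mult)
  qed
  also have "\<dots> \<le> N * (\<bar>q - 1\<bar> * G)" using N G by (intro mult_left_mono) auto
  finally have 2: "\<bar>q * (N * g x) - N * g x\<bar> \<le> N * (\<bar>q - 1\<bar> * G)" .
  show ?thesis using 1 2 by (simp add: err_def distrib_left)
qed

lemma field_conv: "off_center x \<Longrightarrow> conv Q field x = conv Q bulk x *\<^sub>R axis i 1 + conv Q core x"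
proof -
  assume x: "off_center x"
  have "conv Q field x = (\<integral>y. (Q (x - y) *\<^sub>R bulk y) *\<^sub>R axis i 1 + Q (x - y) *\<^sub>R core y \<partial>lebesgue)"
    by (simp add: conv_def field_def scaleR_add_right)
  also have "\<dots> = conv Q bulk x *\<^sub>R axis i 1 + conv Q core x"
    using x bulk_conv_integrable[of x] unfolding conv_def
    by (subst Bochner_Integration.integral_add) (auto simp: core_conv_integrable)
  finally show ?thesis .
qed

text \<open>The bulk error is uniform and is integrated over the domain; the core is small only in
  L2 and is integrated over the plane. Splitting the square costs the factors 2.\<close>

lemma field_conv_error:
  assumes \<Omega>: "\<Omega> \<in> sets lborel" "emeasure lborel \<Omega> \<le> ennreal m" "0 \<le> m"
  shows "(\<integral>\<^sup>+x\<in>\<Omega>. ennreal ((norm ((1 / N) *\<^sub>R conv Q field x - g x *\<^sub>R axis i 1))\<^sup>2) \<partial>lebesgue)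
    \<le> ennreal (2 * err\<^sup>2 * m + 2 * (9 * (16 * pi)\<^sup>2 * (pi / \<alpha>) * (\<Sum>e\<in>I. (of_int (jump e))\<^sup>2)) / N\<^sup>2)"
proof -
  define J :: real where "J = 9 * (16 * pi)\<^sup>2 * (pi / \<alpha>) * (\<Sum>e\<in>I. (of_int (jump e))\<^sup>2)"
  have J: "J \<ge> 0" unfolding J_def using \<alpha> by (intro mult_nonneg_nonneg sum_nonneg) auto
  have cm: "(\<lambda>x. ennreal ((norm (conv Q core x))\<^sup>2)) \<in> borel_measurable lborel"
  proof -
    have [measurable]: "core \<in> borel_measurable borel" using integrable_core by auto
    have "conv Q core x = (\<integral>y. Q (x - y) *\<^sub>R core y \<partial>lborel)" for x
      unfolding conv_def by (rule integral_completion) measurable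
    then show ?thesis by simp
  qed
  have "(\<integral>\<^sup>+x\<in>\<Omega>. ennreal ((norm ((1 / N) *\<^sub>R conv Q field x - g x *\<^sub>R axis i 1))\<^sup>2) \<partial>lebesgue) =
      (\<integral>\<^sup>+x\<in>\<Omega>. ennreal ((norm ((1 / N) *\<^sub>R conv Q field x - g x *\<^sub>R axis i 1))\<^sup>2) \<partial>lborel)"
    by (simp add: nn_integral_completion)
  also have "\<dots> \<le> (\<integral>\<^sup>+x. ennreal (2 * err\<^sup>2) * indicator \<Omega> x + ennreal (2 / N\<^sup>2) * ennreal ((norm (conv Q core x))\<^sup>2) \<partial>lborel)"
  proof (rule nn_integral_mono_AE, use AE_off_center in eventually_elim)
    fix x assume x: "off_center x"
    have "(1 / N) *\<^sub>R conv Q field x - g x *\<^sub>R axis i 1 =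
        ((conv Q bulk x - N * g x) / N) *\<^sub>R axis i 1 + (1 / N) *\<^sub>R conv Q core x"
      using N by (simp add: field_conv[OF x] scaleR_add_right diff_divide_distrib scaleR_diff_left)
    then have "(norm ((1 / N) *\<^sub>R conv Q field x - g x *\<^sub>R axis i 1))\<^sup>2 \<le>
        2 * (norm (((conv Q bulk x - N * g x) / N) *\<^sub>R axis i 1 :: R2))\<^sup>2 + 2 * (norm ((1 / N) *\<^sub>R conv Q core x))\<^sup>2"
      by (simp only: norm_add_sq_le)
    also have "\<dots> \<le> 2 * err\<^sup>2 + 2 / N\<^sup>2 * (norm (conv Q core x))\<^sup>2"
    proof (rule add_mono)
      have "\<bar>(conv Q bulk x - N * g x) / N\<bar> \<le> err" using bulk_conv[of x] N by (simp add: field_simps)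
      then have "\<bar>(conv Q bulk x - N * g x) / N\<bar>\<^sup>2 \<le> err\<^sup>2" by (intro power_mono) auto
      then show "2 * (norm (((conv Q bulk x - N * g x) / N) *\<^sub>R axis i 1 :: R2))\<^sup>2 \<le> 2 * err\<^sup>2" by simp
    qed (simp add: power_divide)
    finally have "ennreal ((norm ((1 / N) *\<^sub>R conv Q field x - g x *\<^sub>R axis i 1))\<^sup>2) \<le> ennreal (2 * err\<^sup>2 + 2 / N\<^sup>2 * (norm (conv Q core x))\<^sup>2)"
      by (rule ennreal_leI)
    also have "\<dots> = ennreal (2 * err\<^sup>2) + ennreal (2 / N\<^sup>2) * ennreal ((norm (conv Q core x))\<^sup>2)"
      by (subst ennreal_plus) (auto simp: ennreal_mult[symmetric])
    finally show "ennreal ((norm ((1 / N) *\<^sub>R conv Q field x - g x *\<^sub>R axis i 1))\<^sup>2) * indicator \<Omega> x \<le>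
       ennreal (2 * err\<^sup>2) * indicator \<Omega> x + ennreal (2 / N\<^sup>2) * ennreal ((norm (conv Q core x))\<^sup>2)"
      by (auto simp: indicator_def)
  qed
  also have "\<dots> = ennreal (2 * err\<^sup>2) * emeasure lborel \<Omega> + ennreal (2 / N\<^sup>2) * (\<integral>\<^sup>+x. ennreal ((norm (conv Q core x))\<^sup>2) \<partial>lborel)"
    using \<Omega>(1) cm by (simp add: nn_integral_add nn_integral_cmult)
  also have "\<dots> \<le> ennreal (2 * err\<^sup>2) * ennreal m + ennreal (2 / N\<^sup>2) * ennreal J"
    unfolding J_def by (intro add_mono mult_left_mono nn_core_conv \<Omega>) auto
  also have "\<dots> = ennreal (2 * err\<^sup>2 * m + 2 * J / N\<^sup>2)"
    using J \<Omega>(3) by (subst ennreal_plus) (auto simp: ennreal_mult[symmetric])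
  finally show ?thesis by (simp only: J_def)
qed

text \<open>Neighbouring centres are \<open>s\<close> apart, so N s g changes by at most L N s^2,
  and taking integer parts adds at most 1. The bound does not grow with N.\<close>

lemma jump_sq_le: "N * s\<^sup>2 \<le> 1 \<Longrightarrow> (of_int (jump e))\<^sup>2 \<le> (L + 1)\<^sup>2"
proof -
  assume Ns: "N * s\<^sup>2 \<le> 1"
  have "\<bar>g (center s (e + axis i 1)) - g (center s e)\<bar> \<le> L * s"
    using L(2)[of "center s (e + axis i 1)" "center s e"] s by (simp add: center_shift)
  then have "N * s * \<bar>g (center s (e + axis i 1)) - g (center s e)\<bar> \<le> N * s * (L * s)"
    using N s by (intro mult_left_mono) auto
  also have "\<dots> = L * (N * s\<^sup>2)" by (simp add: power2_eq_square)
  also have "\<dots> \<le> L * 1" using Ns L by (intro mult_left_mono) auto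
  finally have "\<bar>N * s * g (center s (e + axis i 1)) - N * s * g (center s e)\<bar> \<le> L"
    using N s by (simp add: right_diff_distrib[symmetric] abs_mult)
  then have "\<bar>real_of_int (jump e)\<bar> \<le> L + 1" unfolding jump_def n_def of_int_diff by linarith
  then have "\<bar>real_of_int (jump e)\<bar>\<^sup>2 \<le> (L + 1)\<^sup>2" by (intro power_mono) auto
  then show ?thesis by simp
qed

end

section \<open>The recovery sequence\<close>

text \<open>Valued in \<open>ennreal\<close>, so that an error can be estimated before it is known
  to be in L2.\<close>

definition nsq :: "'a measure \<Rightarrow> ('a \<Rightarrow> 'b::euclidean_space) \<Rightarrow> ennreal" where
  "nsq M f = (\<integral>\<^sup>+x. ennreal ((norm (f x))\<^sup>2) \<partial>M)"

lemma nsq_add_le: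
  assumes "f \<in> borel_measurable M" "g \<in> borel_measurable M" "AE x in M. norm (h x) \<le> norm (f x) + norm (g x)"
  shows "nsq M h \<le> 2 * nsq M f + 2 * nsq M g"
proof -
  have "nsq M h \<le> (\<integral>\<^sup>+x. 2 * ennreal ((norm (f x))\<^sup>2) + 2 * ennreal ((norm (g x))\<^sup>2) \<partial>M)"
    unfolding nsq_def
  proof (rule nn_integral_mono_AE, use assms(3) in eventually_elim)
    case (elim x)
    have "(norm (h x))\<^sup>2 \<le> (norm (f x) + norm (g x))\<^sup>2" using elim by (intro power_mono) auto
    also have "\<dots> \<le> 2 * (norm (f x))\<^sup>2 + 2 * (norm (g x))\<^sup>2"
      using norm_add_sq_le[of "norm (f x)" "norm (g x)"] by simp
    finally have "ennreal ((norm (h x))\<^sup>2) \<le> ennreal (2 * (norm (f x))\<^sup>2 + 2 * (norm (g x))\<^sup>2)" by (rule ennreal_leI)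
    also have "\<dots> = 2 * ennreal ((norm (f x))\<^sup>2) + 2 * ennreal ((norm (g x))\<^sup>2)"
      by (simp add: ennreal_plus ennreal_mult)
    finally show ?case .
  qed
  also have "\<dots> = 2 * nsq M f + 2 * nsq M g"
    using assms(1,2) by (simp add: nsq_def nn_integral_add nn_integral_cmult)
  finally show ?thesis .
qed

lemma nsq_eq_ip: "f \<in> L2 M \<Longrightarrow> nsq M f = ennreal (ip M f f)"
  unfolding nsq_def ip_self by (rule nn_integral_eq_integral) (auto simp: L2_def)

lemma L2_iff_nsq: "f \<in> L2 M \<longleftrightarrow> f \<in> borel_measurable M \<and> nsq M f < \<infinity>"
proof -
  have "f \<in> borel_measurable M \<Longrightarrow> integrable M (\<lambda>x. (norm (f x))\<^sup>2) \<longleftrightarrow> nsq M f < \<infinity>"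
    by (subst integrable_iff_bounded) (simp add: nsq_def)
  then show ?thesis by (auto simp: L2_def)
qed

text \<open>Keeps from a lattice field what the curl condition will use: integer weights at the
  centres and room for the balls. As the lattice is prescribed, sums stay in the class: two atoms
  either coincide or are at least \<open>s\<close> apart.\<close>

definition lattice_flux :: "R2 set \<Rightarrow> real \<Rightarrow> real \<Rightarrow> (R2 \<Rightarrow> R2) \<Rightarrow> (int^2 \<Rightarrow> int) \<Rightarrow> bool" where
  "lattice_flux \<Omega> s \<rho> v \<xi> \<longleftrightarrow> integrable lborel v \<and> finite {e. \<xi> e \<noteq> 0} \<and>
    (\<forall>e. \<xi> e \<noteq> 0 \<longrightarrow> ball (center s e) \<rho> \<subseteq> \<Omega>) \<and>
    (\<forall>\<phi> U. \<phi> \<in> test_functions U \<longrightarrow>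
      (\<integral>x. (\<Sum>k\<in>UNIV. v x $ k * partial_at k \<phi> x) \<partial>lborel) = - (\<Sum>e\<in>{e. \<xi> e \<noteq> 0}. of_int (\<xi> e) * \<phi> (center s e)))"

text \<open>Weights may cancel, so all sums are compared on the union of the two supports.\<close>

lemma lattice_flux_add:
  assumes v: "lattice_flux \<Omega> s \<rho> v \<xi>" and u: "lattice_flux \<Omega> s \<rho> u \<eta>"
  shows "lattice_flux \<Omega> s \<rho> (\<lambda>x. v x + u x) (\<lambda>e. \<xi> e + \<eta> e)"
  unfolding lattice_flux_def
proof (intro conjI allI impI)
  let ?S = "{e. \<xi> e \<noteq> 0} \<union> {e. \<eta> e \<noteq> 0}"
  have fin: "finite ?S" using u v by (simp add: lattice_flux_def)
  have sub: "{e. \<xi> e + \<eta> e \<noteq> 0} \<subseteq> ?S" by auto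
  show "integrable lborel (\<lambda>x. v x + u x)" using u v by (simp add: lattice_flux_def)
  show "finite {e. \<xi> e + \<eta> e \<noteq> 0}" by (rule finite_subset[OF sub fin])
  show "ball (center s e) \<rho> \<subseteq> \<Omega>" if "\<xi> e + \<eta> e \<noteq> 0" for e
  proof -
    have "\<xi> e \<noteq> 0 \<or> \<eta> e \<noteq> 0" using that by auto
    then show ?thesis using u v unfolding lattice_flux_def by blast
  qed
  fix \<phi> U assume \<phi>: "\<phi> \<in> test_functions U"
  then interpret test_function \<phi> U by unfold_locales
  have comp: "integrable lborel (\<lambda>x. w x $ k)" if "integrable lborel w" for w :: "R2 \<Rightarrow> R2" and k
    by (rule integrable_bounded_linear[OF bounded_linear_vec_nth that])
  have int: "integrable lborel (\<lambda>x. \<Sum>k\<in>UNIV. w x $ k * D k x)" if "integrable lborel w" for w :: "R2 \<Rightarrow> R2"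
    by (intro Bochner_Integration.integrable_sum D_mult_integrable comp that)
  have *: "(\<Sum>e\<in>{e. \<zeta> e \<noteq> 0}. of_int (\<zeta> e) * \<phi> (center s e)) = (\<Sum>e\<in>?S. of_int (\<zeta> e) * \<phi> (center s e))"
    if "{e. \<zeta> e \<noteq> 0} \<subseteq> ?S" for \<zeta> :: "int^2 \<Rightarrow> int"
    using that fin by (intro sum.mono_neutral_left) auto
  have "(\<integral>x. (\<Sum>k\<in>UNIV. (v x + u x) $ k * D k x) \<partial>lborel) =
      (\<integral>x. (\<Sum>k\<in>UNIV. v x $ k * D k x) + (\<Sum>k\<in>UNIV. u x $ k * D k x) \<partial>lborel)"
    by (simp add: distrib_right sum.distrib)
  also have "\<dots> = (\<integral>x. (\<Sum>k\<in>UNIV. v x $ k * D k x) \<partial>lborel) + (\<integral>x. (\<Sum>k\<in>UNIV. u x $ k * D k x) \<partial>lborel)"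
    using u v by (intro Bochner_Integration.integral_add int) (auto simp: lattice_flux_def)
  also have "(\<integral>x. (\<Sum>k\<in>UNIV. v x $ k * D k x) \<partial>lborel) = - (\<Sum>e\<in>{e. \<xi> e \<noteq> 0}. of_int (\<xi> e) * \<phi> (center s e))"
    using v \<phi> unfolding lattice_flux_def by blast
  also have "(\<integral>x. (\<Sum>k\<in>UNIV. u x $ k * D k x) \<partial>lborel) = - (\<Sum>e\<in>{e. \<eta> e \<noteq> 0}. of_int (\<eta> e) * \<phi> (center s e))"
    using u \<phi> unfolding lattice_flux_def by blast
  also have "- (\<Sum>e\<in>{e. \<xi> e \<noteq> 0}. of_int (\<xi> e) * \<phi> (center s e)) + - (\<Sum>e\<in>{e. \<eta> e \<noteq> 0}. of_int (\<eta> e) * \<phi> (center s e)) =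
      - (\<Sum>e\<in>?S. of_int (\<xi> e) * \<phi> (center s e)) - (\<Sum>e\<in>?S. of_int (\<eta> e) * \<phi> (center s e))"
    using *[of \<xi>] *[of \<eta>] by simp
  also have "\<dots> = - (\<Sum>e\<in>{e. \<xi> e + \<eta> e \<noteq> 0}. of_int (\<xi> e + \<eta> e) * \<phi> (center s e))"
    using *[OF sub] by (simp add: distrib_right sum.distrib)
  finally show "(\<integral>x. (\<Sum>k\<in>UNIV. (v x + u x) $ k * D k x) \<partial>lborel) = - (\<Sum>e\<in>{e. \<xi> e + \<eta> e \<noteq> 0}. of_int (\<xi> e + \<eta> e) * \<phi> (center s e))" .
qed

locale regime = elastic \<Omega> C w for \<Omega> C w +
  fixes \<alpha> \<rho> :: "nat \<Rightarrow> real" and N :: "nat \<Rightarrow> nat"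
  assumes \<alpha>: "\<And>j. 0 < \<alpha> j \<and> \<alpha> j < 1" and \<rho>: "\<And>j. 0 < \<rho> j \<and> \<rho> j < 1" and N: "\<And>j. 0 < N j"
    and \<alpha>_lim: "\<alpha> \<longlonglongrightarrow> 0" and \<rho>_lim: "\<rho> \<longlonglongrightarrow> 0" and N_lim: "filterlim N at_top sequentially"
    and \<alpha>_ln_\<rho>: "(\<lambda>j. \<alpha> j * ln (\<rho> j)) \<longlonglongrightarrow> 0"
    and N_\<rho>: "(\<lambda>j. real (N j) * (\<rho> j)\<^sup>2) \<longlonglongrightarrow> 0"
    and N_\<alpha>: "filterlim (\<lambda>j. real (N j) * \<alpha> j) at_top sequentially"
begin

definition s :: "nat \<Rightarrow> real" where "s j = 1 / sqrt (real (N j))"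
definition Q :: "nat \<Rightarrow> R2 \<Rightarrow> real" where "Q j = riesz_kernel w (\<alpha> j) (\<rho> j)"
definition q :: "nat \<Rightarrow> real" where "q j = (\<integral>z. Q j z \<partial>lborel)"

lemma kernel_Q: "kernel (Q j) (\<rho> j)"
  unfolding Q_def using \<alpha> \<rho> by (intro kernel_riesz[OF hp]) auto

lemma s_pos: "0 < s j" using N by (simp add: s_def)

lemma N_s: "real (N j) * (s j)\<^sup>2 = 1" using N[of j] by (simp add: s_def power_divide)

lemma s_lim: "s \<longlonglongrightarrow> 0"
proof -
  have "filterlim (\<lambda>j. sqrt (real (N j))) at_top sequentially"
    by (intro filterlim_compose[OF sqrt_at_top] filterlim_compose[OF filterlim_real_sequentially] N_lim)
  then show ?thesis unfolding s_def[abs_def]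
    by (rule real_tendsto_divide_at_top[OF tendsto_const])
qed

text \<open>Because N s^2 = 1, the hypothesis N \<rho>^2 -> 0 says that \<rho>/s tends to 0.\<close>

lemma \<rho>_s: "\<forall>\<^sub>F j in sequentially. 2 * \<rho> j \<le> s j"
proof -
  have "\<forall>\<^sub>F j in sequentially. real (N j) * (\<rho> j)\<^sup>2 < 1/4"
    using order_tendstoD(2)[OF N_\<rho>, of "1/4"] by simp
  then show ?thesis
  proof eventually_elim
    case (elim j)
    have "(2 * \<rho> j)\<^sup>2 * real (N j) \<le> (s j)\<^sup>2 * real (N j)"
      using elim N_s[of j] by (simp add: power_mult_distrib mult.commute)
    then have "(2 * \<rho> j)\<^sup>2 \<le> (s j)\<^sup>2" using N[of j] by simp
    then show ?case by (rule power2_le_imp_le) (use s_pos[of j] in simp)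
  qed
qed

lemma \<alpha>_right: "filterlim \<alpha> (at_right 0) sequentially"
proof -
  have "\<alpha> j \<in> {0<..}" "\<alpha> j \<noteq> 0" for j using \<alpha>[of j] by auto
  then show ?thesis using \<alpha>_lim by (auto simp: filterlim_at intro!: always_eventually)
qed

lemma kap_lim: "(\<lambda>j. kap (\<alpha> j)) \<longlonglongrightarrow> 1"
  by (rule filterlim_compose[OF kap_tendsto \<alpha>_right])

text \<open>\<rho>^\<alpha> = exp(\<alpha> log \<rho>) tends to 1 by hypothesis, and
  (\<rho>/2)^\<alpha> does too; the mass is squeezed between their products with
  \<open>kap\<close>.\<close>

lemma q_lim: "q \<longlonglongrightarrow> 1"
proof (rule tendsto_sandwich)
  have e: "x powr \<alpha> j = exp (\<alpha> j * ln x)" if "x > 0" for x j using that by (simp add: powr_def)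
  have "(\<lambda>j. kap (\<alpha> j) * exp (\<alpha> j * ln (\<rho> j) - \<alpha> j * ln 2)) \<longlonglongrightarrow> 1 * exp (0 - 0 * ln 2)"
    by (intro tendsto_intros kap_lim \<alpha>_ln_\<rho> \<alpha>_lim)
  then show "(\<lambda>j. kap (\<alpha> j) * (\<rho> j / 2) powr \<alpha> j) \<longlonglongrightarrow> 1"
  proof -
    have "ln (\<rho> j / 2) = ln (\<rho> j) - ln 2" "\<rho> j / 2 > 0" for j using \<rho>[of j] by (simp_all add: ln_div)
    then show ?thesis
      using \<open>(\<lambda>j. kap (\<alpha> j) * exp (\<alpha> j * ln (\<rho> j) - \<alpha> j * ln 2)) \<longlonglongrightarrow> 1 * exp (0 - 0 * ln 2)\<close>
      by (simp add: e right_diff_distrib)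
  qed
  have "(\<lambda>j. kap (\<alpha> j) * exp (\<alpha> j * ln (\<rho> j))) \<longlonglongrightarrow> 1 * exp 0"
    by (intro tendsto_intros kap_lim \<alpha>_ln_\<rho>)
  then show "(\<lambda>j. kap (\<alpha> j) * \<rho> j powr \<alpha> j) \<longlonglongrightarrow> 1" using \<rho> by (simp add: e)
  show "\<forall>\<^sub>F j in sequentially. kap (\<alpha> j) * (\<rho> j / 2) powr \<alpha> j \<le> q j"
    unfolding q_def Q_def using \<alpha> \<rho> by (intro always_eventually allI riesz_kernel_mass(3)[OF hp]) auto
  show "\<forall>\<^sub>F j in sequentially. q j \<le> kap (\<alpha> j) * \<rho> j powr \<alpha> j"
    unfolding q_def Q_def using \<alpha> \<rho> by (intro always_eventually allI riesz_kernel_mass(2)[OF hp]) auto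
qed

text \<open>Since \<open>kap\<close> tends to 1, the product of \<alpha> and
  \<open>gamma_const \<alpha>\<close> tends to 2 pi, so that the constant
  1/\<open>gamma_const \<alpha>\<close> of the Riesz kernel is eventually at most \<alpha>. This
  supplies the factor \<alpha> in the convolution bound.\<close>

lemma Q_le: "\<forall>\<^sub>F j in sequentially. \<alpha> j \<le> 1/2 \<and> (\<forall>z. z \<noteq> 0 \<longrightarrow> Q j z \<le> \<alpha> j * norm z powr (\<alpha> j - 2))"
proof -
  have "\<forall>\<^sub>F j in sequentially. kap (\<alpha> j) < 2" "\<forall>\<^sub>F j in sequentially. \<alpha> j < 1/2"
    using order_tendstoD(2)[OF kap_lim, of 2] order_tendstoD(2)[OF \<alpha>_lim, of "1/2"] by simp_all
  then show ?thesis
  proof eventually_elim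
    case (elim j)
    have a: "0 < \<alpha> j" "\<alpha> j < 1" using \<alpha> by auto
    note \<gamma> = gamma_const_pos[OF a]
    have "(2 - \<alpha> j) * pi < 2 * (\<alpha> j * gamma_const (\<alpha> j))"
      using elim(1) a \<gamma> by (simp add: kap_def field_simps)
    moreover have "2 \<le> (2 - \<alpha> j) * pi"
      using mult_mono[of 1 "2 - \<alpha> j" 2 pi] elim(2) pi_gt3 by simp
    ultimately have "1 \<le> \<alpha> j * gamma_const (\<alpha> j)" by simp
    then have b: "1 / gamma_const (\<alpha> j) \<le> \<alpha> j" using \<gamma> by (simp add: field_simps)
    have "Q j z \<le> \<alpha> j * norm z powr (\<alpha> j - 2)" if "z \<noteq> 0" for z
    proof -
      have "Q j z \<le> norm z powr (\<alpha> j - 2) * (1 / gamma_const (\<alpha> j))"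
        using riesz_kernel_le[OF hp a _ that, of "\<rho> j"] \<rho>[of j] by (simp add: Q_def)
      also have "\<dots> \<le> norm z powr (\<alpha> j - 2) * \<alpha> j" using b by (intro mult_left_mono) auto
      finally show ?thesis by (simp add: mult.commute)
    qed
    then show ?case using elim by simp
  qed
qed

text \<open>Stated with an error \<epsilon> and all large j, so that closure under sums and limits
  amounts to distributing \<epsilon>/4. All fluxes at stage j live on the same lattice of width
  \<open>s j\<close>.\<close>

definition approximable :: "(R2 \<Rightarrow> R2) \<Rightarrow> bool" where
  "approximable G \<longleftrightarrow> G \<in> borel_measurable M \<and> (\<forall>\<epsilon>>0. \<forall>\<^sub>F j in sequentially. \<exists>v \<xi>. lattice_flux \<Omega> (s j) (\<rho> j) v \<xi> \<and>
    nsq M (\<lambda>x. (1 / real (N j)) *\<^sub>R conv (Q j) v x - G x) \<le> ennreal \<epsilon>)"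

text \<open>The support of \<open>g\<close> keeps a distance \<delta> from the boundary; once s +
  \<rho> < \<delta>, every centre that carries a nonzero jump has its ball inside the
  domain.\<close>

lemma lipschitz_approximable:
  fixes g :: "R2 \<Rightarrow> real"
  assumes L: "0 \<le> L" "\<And>x y. \<bar>g x - g y\<bar> \<le> L * norm (x - y)"
    and S: "compact S" "S \<subseteq> \<Omega>" "\<And>x. x \<notin> S \<Longrightarrow> g x = 0"
  shows "approximable (\<lambda>x. g x *\<^sub>R axis i 1)"
  unfolding approximable_def
proof (intro conjI allI impI)
  have "continuous_on UNIV g"
  proof (rule continuous_on_iff[THEN iffD2, rule_format])
    fix x :: R2 and e :: real assume e: "e > 0"
    have "dist (g y) (g x) < e" if "dist y x < e / (L + 1)" for y
    proof -
      have "\<bar>g y - g x\<bar> \<le> L * norm (y - x)" by (rule L)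
      also have "\<dots> \<le> (L + 1) * norm (y - x)" by (intro mult_right_mono) auto
      also have "\<dots> < e" using that L(1) by (simp add: dist_norm field_simps)
      finally show ?thesis by (simp add: dist_real_def)
    qed
    then show "\<exists>d>0. \<forall>y\<in>UNIV. dist y x < d \<longrightarrow> dist (g y) (g x) < e"
      using e L(1) by (intro exI[of _ "e / (L + 1)"]) auto
  qed
  then have gc: "g \<in> borel_measurable borel" by (rule borel_measurable_continuous_onI)
  have "(\<lambda>x. g x *\<^sub>R axis i 1 :: R2) \<in> borel_measurable lborel" using gc by measurable
  then show gm: "(\<lambda>x. g x *\<^sub>R axis i 1 :: R2) \<in> borel_measurable M"
    by (intro measurable_restrict_space1 measurable_completion)
  fix \<epsilon> :: real assume \<epsilon>: "\<epsilon> > 0"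
  obtain R where R: "\<Omega> \<subseteq> cball 0 R" "0 < R" using bounded_Omega by blast
  obtain \<delta> where \<delta>0: "0 < \<delta>" "(\<Union>x\<in>S. ball x \<delta>) \<subseteq> \<Omega>"
    using compact_subset_open_imp_ball_epsilon_subset[OF S(1) op S(2)] by blast
  have \<delta>: "y \<in> \<Omega>" if "x \<in> S" "norm (y - x) < \<delta>" for x y
  proof -
    have "y \<in> ball x \<delta>" using that by (simp add: dist_norm norm_minus_commute)
    then show ?thesis using \<delta>0(2) that(1) by blast
  qed
  have "bounded (g ` S)"
    using S(1) \<open>continuous_on UNIV g\<close>
    by (intro compact_imp_bounded compact_continuous_image) (auto intro: continuous_on_subset)
  then obtain G where G0: "0 < G" "\<forall>y\<in>g ` S. norm y \<le> G" unfolding bounded_pos by blast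
  then have G: "\<bar>g x\<bar> \<le> G" for x using S(3)[of x] by (cases "x \<in> S") auto
  define m where "m = measure lborel \<Omega>"
  have m: "emeasure lborel \<Omega> = ennreal m" "0 \<le> m"
    unfolding m_def using emeasure_bounded_finite[OF bd] by (auto simp: emeasure_eq_ennreal_measure)
  \<comment> \<open>At most (2R+5)^2 N cells, squared jumps at most (L+1)^2, and the constants of
    \<open>nn_core_conv\<close> and \<open>field_conv_error\<close>; division by N^2 leaves A/(N
    \<alpha>).\<close>
  define A where "A = 2 * (9 * (16 * pi)\<^sup>2 * pi) * ((2 * R + 5)\<^sup>2 * (L + 1)\<^sup>2)"
  define err where "err j = q j * (s j + L * s j + L * \<rho> j) + \<bar>q j - 1\<bar> * G" for j
  have "(\<lambda>j. 2 * (err j)\<^sup>2 * m + A / (real (N j) * \<alpha> j)) \<longlonglongrightarrow>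
      2 * (1 * (0 + L * 0 + L * 0) + \<bar>1 - 1\<bar> * G)\<^sup>2 * m + 0"
    unfolding err_def
    by (intro tendsto_intros q_lim s_lim \<rho>_lim real_tendsto_divide_at_top[OF tendsto_const N_\<alpha>])
  then have "(\<lambda>j. 2 * (err j)\<^sup>2 * m + A / (real (N j) * \<alpha> j)) \<longlonglongrightarrow> 0" by simp
  then have ev1: "\<forall>\<^sub>F j in sequentially. 2 * (err j)\<^sup>2 * m + A / (real (N j) * \<alpha> j) < \<epsilon>"
    using \<epsilon> by (rule order_tendstoD(2))
  have "(\<lambda>j. s j + \<rho> j) \<longlonglongrightarrow> 0 + 0" by (intro tendsto_intros s_lim \<rho>_lim)
  then have ev2: "\<forall>\<^sub>F j in sequentially. s j + \<rho> j < \<delta>" using \<delta>0(1) by (intro order_tendstoD(2)) auto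
  have ev3: "\<forall>\<^sub>F j in sequentially. s j < 1/2" using s_lim by (rule order_tendstoD(2)) simp
  show "\<forall>\<^sub>F j in sequentially. \<exists>v \<xi>. lattice_flux \<Omega> (s j) (\<rho> j) v \<xi> \<and>
      nsq M (\<lambda>x. (1 / real (N j)) *\<^sub>R conv (Q j) v x - g x *\<^sub>R axis i 1) \<le> ennreal \<epsilon>"
    using ev1 ev2 ev3 \<rho>_s Q_le
  proof eventually_elim
    case (elim j)
    define n where "n e = \<lfloor>real (N j) * s j * g (center (s j) e)\<rfloor>" for e
    \<comment> \<open>One unit for the offset 1/2 of the centres, one for the neighbour in direction
      \<open>i\<close>.\<close>
    define K where "K = \<lfloor>R / s j\<rfloor> + 2"
    have nS: "center (s j) e \<in> S" if "n e \<noteq> 0" for e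
      using that S(3)[of "center (s j) e"] by (cases "center (s j) e \<in> S") (auto simp: n_def)
    have n_le: "\<bar>e $ k\<bar> \<le> \<lfloor>R / s j\<rfloor> + 1" if "n e \<noteq> 0" for e k
    proof -
      have "norm (center (s j) e) \<le> R" using nS[OF that] S(2) R(1) by auto
      then have "\<bar>s j * (of_int (e $ k) + 1/2)\<bar> \<le> R"
        using component_le_norm_cart[of "center (s j) e" k] by (simp add: center_def)
      then have "\<bar>of_int (e $ k) + 1/2\<bar> * s j \<le> R"
        using s_pos[of j] by (simp only: abs_mult abs_of_pos mult.commute)
      then have "\<bar>of_int (e $ k) + 1/2\<bar> \<le> R / s j"
        using s_pos[of j] by (simp only: pos_le_divide_eq)
      then show ?thesis by linarith
    qed
    have supp: "e \<in> box_index K" if "n e \<noteq> 0 \<or> n (e + axis i 1) \<noteq> 0" for e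
      unfolding box_index_def
    proof (intro CollectI allI)
      fix k
      have "\<bar>(axis i 1 :: int^2) $ k\<bar> \<le> 1" by (simp add: axis_def)
      then show "\<bar>e $ k\<bar> \<le> K" using that n_le[of e k] n_le[of "e + axis i 1" k] unfolding K_def by auto
    qed
    interpret ker: kernel "Q j" "\<rho> j" by (rule kernel_Q)
    interpret R: recovery "Q j" "\<rho> j" "s j" n i K "\<alpha> j" "real (N j)" L G g
    proof unfold_locales
      show "0 < s j" by (rule s_pos)
      show "\<And>e. n e \<noteq> 0 \<or> n (e + axis i 1) \<noteq> 0 \<Longrightarrow> e \<in> box_index K" by (rule supp)
      show "0 < \<alpha> j" using \<alpha> by blast
      show "\<alpha> j \<le> 1 / 2" "\<And>z. z \<noteq> 0 \<Longrightarrow> Q j z \<le> \<alpha> j * norm z powr (\<alpha> j - 2)" using elim by auto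
      show "\<rho> j \<le> s j / 2" "s j \<le> 1 / 2" using elim by auto
      show "0 < real (N j)" using N[of j] by simp
      show "0 \<le> L" "\<And>x y. \<bar>g x - g y\<bar> \<le> L * norm (x - y)" "\<And>x. \<bar>g x\<bar> \<le> G" using L G by auto
      show "\<And>e. n e = \<lfloor>real (N j) * s j * g (center (s j) e)\<rfloor>" by (rule n_def)
    qed
    have flux: "lattice_flux \<Omega> (s j) (\<rho> j) R.field R.jump"
      unfolding lattice_flux_def
    proof (intro conjI allI impI)
      show "integrable lborel R.field" by (rule R.integrable_field)
      have sub: "{e. R.jump e \<noteq> 0} \<subseteq> box_index K" using R.jump_support by auto
      show "finite {e. R.jump e \<noteq> 0}" by (rule finite_subset[OF sub R.fin])
      show "ball (center (s j) e) (\<rho> j) \<subseteq> \<Omega>" if "R.jump e \<noteq> 0" for e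
      proof
        fix x assume "x \<in> ball (center (s j) e) (\<rho> j)"
        then have x: "norm (x - center (s j) e) < \<rho> j" by (simp add: dist_norm norm_minus_commute)
        have "n e \<noteq> 0 \<or> n (e + axis i 1) \<noteq> 0" using that by (auto simp: R.jump_def)
        then show "x \<in> \<Omega>"
        proof
          assume "n e \<noteq> 0"
          then show ?thesis using x elim s_pos[of j] by (intro \<delta>[OF nS]) auto
        next
          \<comment> \<open>The jump may be due to the next cell, whose centre is \<open>s\<close>
            away; hence the sum s + \<rho> in the choice of j.\<close>
          assume n: "n (e + axis i 1) \<noteq> 0"
          have "norm (x - center (s j) (e + axis i 1)) \<le>
              norm (x - center (s j) e) + norm (center (s j) e - center (s j) (e + axis i 1))"
            by (metis diff_add_cancel diff_diff_eq2 add_diff_eq norm_triangle_ineq)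
          also have "\<dots> < \<rho> j + s j"
            using x center_shift[of "s j" e i] s_pos[of j] by (simp add: norm_minus_commute)
          finally show ?thesis using elim by (intro \<delta>[OF nS[OF n]]) auto
        qed
      qed
      fix \<phi> U assume "\<phi> \<in> test_functions U"
      then have "test_function \<phi> U" by unfold_locales
      from R.divergence[OF this]
      show "(\<integral>x. (\<Sum>k\<in>UNIV. R.field x $ k * partial_at k \<phi> x) \<partial>lborel) =
          - (\<Sum>e\<in>{e. R.jump e \<noteq> 0}. of_int (R.jump e) * \<phi> (center (s j) e))"
        using sub R.fin by (simp add: sum.mono_neutral_left[of "box_index K" "{e. R.jump e \<noteq> 0}"])
    qed
    have err: "R.err = err j"
    proof -
      have "1 / (real (N j) * s j) = s j"
        using N_s[of j] s_pos[of j] N[of j] by (simp add: power2_eq_square divide_eq_eq mult_ac)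
      then show ?thesis by (simp add: R.err_def err_def ker.q_def q_def)
    qed
    have J: "(\<Sum>e\<in>box_index K. (real_of_int (R.jump e))\<^sup>2) \<le> (2 * R + 5)\<^sup>2 * real (N j) * (L + 1)\<^sup>2"
    proof -
      have K0: "K \<ge> 0" using R(2) s_pos[of j] by (simp add: K_def)
      have "real_of_int K \<le> R / s j + 2" by (simp add: K_def)
      then have "2 * real_of_int K + 1 \<le> 2 * (R / s j) + 5" by simp
      \<comment> \<open>As s < 1 the additive constant is absorbed, and the number of cells becomes
        a multiple of 1/s^2 = N.\<close>
      also have "\<dots> \<le> 2 * (R / s j) + 5 / s j" using elim s_pos[of j] by (simp add: field_simps)
      also have "\<dots> = (2 * R + 5) / s j" by (simp add: add_divide_distrib)
      finally have "(2 * real_of_int K + 1)\<^sup>2 \<le> ((2 * R + 5) / s j)\<^sup>2" using K0 by (intro power_mono) auto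
      also have "\<dots> = (2 * R + 5)\<^sup>2 * real (N j)"
        using N_s[of j] s_pos[of j] by (simp add: power_divide field_simps)
      finally have card: "real (card (box_index K)) \<le> (2 * R + 5)\<^sup>2 * real (N j)"
        using card_box_index[OF K0] by linarith
      have "(\<Sum>e\<in>box_index K. (real_of_int (R.jump e))\<^sup>2) \<le> (\<Sum>e\<in>box_index K. (L + 1)\<^sup>2)"
        using N_s[of j] by (intro sum_mono R.jump_sq_le) simp
      also have "\<dots> = real (card (box_index K)) * (L + 1)\<^sup>2" by simp
      also have "\<dots> \<le> (2 * R + 5)\<^sup>2 * real (N j) * (L + 1)\<^sup>2" by (intro mult_right_mono card) simp
      finally show ?thesis .
    qed
    have "nsq M (\<lambda>x. (1 / real (N j)) *\<^sub>R conv (Q j) R.field x - g x *\<^sub>R axis i 1) =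
        (\<integral>\<^sup>+x\<in>\<Omega>. ennreal ((norm ((1 / real (N j)) *\<^sub>R conv (Q j) R.field x - g x *\<^sub>R axis i 1))\<^sup>2) \<partial>lebesgue)"
      unfolding nsq_def using op by (subst nn_integral_restrict_space) auto
    also have "\<dots> \<le> ennreal (2 * R.err\<^sup>2 * m +
        2 * (9 * (16 * pi)\<^sup>2 * (pi / \<alpha> j) * (\<Sum>e\<in>box_index K. (real_of_int (R.jump e))\<^sup>2)) / (real (N j))\<^sup>2)"
      using op m by (intro R.field_conv_error) auto
    also have "\<dots> \<le> ennreal \<epsilon>"
    proof (rule ennreal_leI)
      have a: "0 < \<alpha> j" "0 < real (N j)" using \<alpha> N by auto
      have "2 * (9 * (16 * pi)\<^sup>2 * (pi / \<alpha> j) * (\<Sum>e\<in>box_index K. (real_of_int (R.jump e))\<^sup>2)) / (real (N j))\<^sup>2 \<le>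
          2 * (9 * (16 * pi)\<^sup>2 * (pi / \<alpha> j) * ((2 * R + 5)\<^sup>2 * real (N j) * (L + 1)\<^sup>2)) / (real (N j))\<^sup>2"
        using a by (intro divide_right_mono mult_left_mono J) auto
      also have "\<dots> = A / (real (N j) * \<alpha> j)"
        using a by (simp add: A_def power2_eq_square mult_ac)
      finally show "2 * R.err\<^sup>2 * m + 2 * (9 * (16 * pi)\<^sup>2 * (pi / \<alpha> j) *
          (\<Sum>e\<in>box_index K. (real_of_int (R.jump e))\<^sup>2)) / (real (N j))\<^sup>2 \<le> \<epsilon>"
        using elim(1) unfolding err by linarith
    qed
    finally show ?case using flux by blast
  qed
qed

end

section \<open>Density: from Lipschitz functions to all of L2\<close>

lemma four_quarters: "\<epsilon> > 0 \<Longrightarrow> 2 * ennreal (\<epsilon> / 4) + 2 * ennreal (\<epsilon> / 4) = ennreal \<epsilon>"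
  by (simp add: ennreal_mult[symmetric] ennreal_plus[symmetric] ennreal_numeral[symmetric]
      del: ennreal_plus ennreal_numeral)

context regime
begin

lemma absolutely_integrable_cball:
  fixes v :: "R2 \<Rightarrow> 'b::euclidean_space"
  assumes "integrable lborel v" shows "v absolutely_integrable_on cball 0 R"
proof -
  have "v \<in> borel_measurable lborel" using assms by auto
  then have "integrable lebesgue v" using assms by (simp add: integrable_completion)
  then show ?thesis unfolding set_integrable_def by (intro integrable_mult_indicator) auto
qed

lemma conv_Q_measurable:
  fixes v :: "R2 \<Rightarrow> 'b::euclidean_space"
  assumes "integrable lborel v" shows "conv (Q j) v \<in> borel_measurable M"
proof -
  obtain R where "\<Omega> \<subseteq> cball 0 R" using bounded_Omega by blast
  then show ?thesis
    using kernel.conv_measurable[OF kernel_Q absolutely_integrable_cball[OF assms]] op by auto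
qed

lemma conv_Q_AE_integrable:
  fixes v :: "R2 \<Rightarrow> 'b::euclidean_space"
  assumes "integrable lborel v" shows "AE x in M. integrable lebesgue (\<lambda>y. Q j (x - y) *\<^sub>R v y)"
proof -
  obtain R where R: "\<Omega> \<subseteq> cball 0 R" using bounded_Omega by blast
  have "AE x in lebesgue. x \<in> \<Omega> \<longrightarrow> integrable lebesgue (\<lambda>y. Q j (x - y) *\<^sub>R v y)"
    using kernel.conv_AE_integrable[OF kernel_Q absolutely_integrable_cball[OF assms], where R = R]
    by eventually_elim (use R in auto)
  then show ?thesis using op by (subst AE_restrict_space_iff) auto
qed

lemma approximable_measurable: "approximable G \<Longrightarrow> G \<in> borel_measurable M"
  by (simp add: approximable_def)

lemma approximable_zero: "approximable (\<lambda>x. 0)"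
proof -
  have "lattice_flux \<Omega> (s j) (\<rho> j) (\<lambda>x. 0) (\<lambda>e. 0)" for j by (simp add: lattice_flux_def)
  moreover have "nsq M (\<lambda>x. (1 / real (N j)) *\<^sub>R conv (Q j) (\<lambda>x. 0 :: R2) x - 0) = 0" for j
    by (simp add: nsq_def conv_def)
  ultimately show ?thesis unfolding approximable_def
    by (auto intro!: always_eventually exI[of _ "\<lambda>x. 0"] exI[of _ "\<lambda>e. 0"])
qed

text \<open>The two flux fields share a lattice, so their sum is again one of them; their potentials
  add at almost every point.\<close>

lemma approximable_add:
  assumes "approximable G" "approximable H" shows "approximable (\<lambda>x. G x + H x)"
  unfolding approximable_def
proof (intro conjI allI impI)
  note [measurable] = assms[THEN approximable_measurable]
  show "(\<lambda>x. G x + H x) \<in> borel_measurable M" by measurable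
  fix \<epsilon> :: real assume "\<epsilon> > 0"
  then have e: "\<epsilon> / 4 > 0" by simp
  have "\<forall>\<^sub>F j in sequentially. \<exists>v \<xi>. lattice_flux \<Omega> (s j) (\<rho> j) v \<xi> \<and>
      nsq M (\<lambda>x. (1 / real (N j)) *\<^sub>R conv (Q j) v x - G x) \<le> ennreal (\<epsilon> / 4)"
    "\<forall>\<^sub>F j in sequentially. \<exists>v \<xi>. lattice_flux \<Omega> (s j) (\<rho> j) v \<xi> \<and>
      nsq M (\<lambda>x. (1 / real (N j)) *\<^sub>R conv (Q j) v x - H x) \<le> ennreal (\<epsilon> / 4)"
    using assms e unfolding approximable_def by blast+
  then show "\<forall>\<^sub>F j in sequentially. \<exists>v \<xi>. lattice_flux \<Omega> (s j) (\<rho> j) v \<xi> \<and>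
      nsq M (\<lambda>x. (1 / real (N j)) *\<^sub>R conv (Q j) v x - (G x + H x)) \<le> ennreal \<epsilon>"
  proof eventually_elim
    case (elim j)
    then obtain v \<xi> u \<eta> where v: "lattice_flux \<Omega> (s j) (\<rho> j) v \<xi>" and u: "lattice_flux \<Omega> (s j) (\<rho> j) u \<eta>"
      and nv: "nsq M (\<lambda>x. (1 / real (N j)) *\<^sub>R conv (Q j) v x - G x) \<le> ennreal (\<epsilon> / 4)"
      and nu: "nsq M (\<lambda>x. (1 / real (N j)) *\<^sub>R conv (Q j) u x - H x) \<le> ennreal (\<epsilon> / 4)" by blast
    have iv: "integrable lborel v" and iu: "integrable lborel u" using u v by (simp_all add: lattice_flux_def)
    note [measurable] = conv_Q_measurable[OF iv, of j] conv_Q_measurable[OF iu, of j]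
    have "nsq M (\<lambda>x. (1 / real (N j)) *\<^sub>R conv (Q j) (\<lambda>x. v x + u x) x - (G x + H x)) \<le>
        2 * nsq M (\<lambda>x. (1 / real (N j)) *\<^sub>R conv (Q j) v x - G x) + 2 * nsq M (\<lambda>x. (1 / real (N j)) *\<^sub>R conv (Q j) u x - H x)"
    proof (rule nsq_add_le)
      show "AE x in M. norm ((1 / real (N j)) *\<^sub>R conv (Q j) (\<lambda>x. v x + u x) x - (G x + H x)) \<le>
         norm ((1 / real (N j)) *\<^sub>R conv (Q j) v x - G x) + norm ((1 / real (N j)) *\<^sub>R conv (Q j) u x - H x)"
        using conv_Q_AE_integrable[OF iv, of j] conv_Q_AE_integrable[OF iu, of j]
      proof eventually_elim
        case (elim x)
        have "conv (Q j) (\<lambda>x. v x + u x) x = conv (Q j) v x + conv (Q j) u x"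
          unfolding conv_def scaleR_add_right by (rule Bochner_Integration.integral_add[OF elim])
        then have "(1 / real (N j)) *\<^sub>R conv (Q j) (\<lambda>x. v x + u x) x - (G x + H x) =
           ((1 / real (N j)) *\<^sub>R conv (Q j) v x - G x) + ((1 / real (N j)) *\<^sub>R conv (Q j) u x - H x)"
          by (simp add: scaleR_add_right)
        then show ?case by (simp only: norm_triangle_ineq)
      qed
    qed measurable
    also have "\<dots> \<le> 2 * ennreal (\<epsilon> / 4) + 2 * ennreal (\<epsilon> / 4)"
      by (intro add_mono mult_left_mono nv nu) auto
    also have "\<dots> = ennreal \<epsilon>" by (rule four_quarters[OF \<open>\<epsilon> > 0\<close>])
    finally show ?case using lattice_flux_add[OF v u] by blast
  qed
qed

lemma approximable_closed:
  assumes "G \<in> borel_measurable M"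
    and "\<And>\<delta>. \<delta> > 0 \<Longrightarrow> \<exists>H. approximable H \<and> nsq M (\<lambda>x. H x - G x) \<le> ennreal \<delta>"
  shows "approximable G"
  unfolding approximable_def
proof (intro conjI allI impI)
  show "G \<in> borel_measurable M" by fact
  fix \<epsilon> :: real assume "\<epsilon> > 0"
  then have e: "\<epsilon> / 4 > 0" by simp
  obtain H where H: "approximable H" and HG: "nsq M (\<lambda>x. H x - G x) \<le> ennreal (\<epsilon> / 4)"
    using assms(2)[OF e] by blast
  note [measurable] = assms(1) approximable_measurable[OF H]
  have "\<forall>\<^sub>F j in sequentially. \<exists>v \<xi>. lattice_flux \<Omega> (s j) (\<rho> j) v \<xi> \<and>
      nsq M (\<lambda>x. (1 / real (N j)) *\<^sub>R conv (Q j) v x - H x) \<le> ennreal (\<epsilon> / 4)"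
    using H e unfolding approximable_def by blast
  then show "\<forall>\<^sub>F j in sequentially. \<exists>v \<xi>. lattice_flux \<Omega> (s j) (\<rho> j) v \<xi> \<and>
      nsq M (\<lambda>x. (1 / real (N j)) *\<^sub>R conv (Q j) v x - G x) \<le> ennreal \<epsilon>"
  proof eventually_elim
    case (elim j)
    then obtain v \<xi> where v: "lattice_flux \<Omega> (s j) (\<rho> j) v \<xi>"
      and nv: "nsq M (\<lambda>x. (1 / real (N j)) *\<^sub>R conv (Q j) v x - H x) \<le> ennreal (\<epsilon> / 4)" by blast
    have iv: "integrable lborel v" using v by (simp add: lattice_flux_def)
    note [measurable] = conv_Q_measurable[OF iv, of j]
    have "nsq M (\<lambda>x. (1 / real (N j)) *\<^sub>R conv (Q j) v x - G x) \<le>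
        2 * nsq M (\<lambda>x. (1 / real (N j)) *\<^sub>R conv (Q j) v x - H x) + 2 * nsq M (\<lambda>x. H x - G x)"
    proof (rule nsq_add_le)
      show "AE x in M. norm ((1 / real (N j)) *\<^sub>R conv (Q j) v x - G x) \<le>
          norm ((1 / real (N j)) *\<^sub>R conv (Q j) v x - H x) + norm (H x - G x)"
      proof (rule AE_I2)
        fix x
        show "norm ((1 / real (N j)) *\<^sub>R conv (Q j) v x - G x) \<le>
          norm ((1 / real (N j)) *\<^sub>R conv (Q j) v x - H x) + norm (H x - G x)"
          using norm_triangle_ineq[of "(1 / real (N j)) *\<^sub>R conv (Q j) v x - H x" "H x - G x"] by simp
      qed
    qed measurable
    also have "\<dots> \<le> 2 * ennreal (\<epsilon> / 4) + 2 * ennreal (\<epsilon> / 4)"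
      by (intro add_mono mult_left_mono nv HG) auto
    also have "\<dots> = ennreal \<epsilon>" by (rule four_quarters[OF \<open>\<epsilon> > 0\<close>])
    finally show ?case using v by blast
  qed
qed

lemma approximable_dominated:
  assumes g: "\<And>n. approximable (g n)" and G: "G \<in> borel_measurable M"
    and lim: "\<And>x. x \<in> \<Omega> \<Longrightarrow> (\<lambda>n. g n x) \<longlonglongrightarrow> G x"
    and bound: "\<And>n x. x \<in> \<Omega> \<Longrightarrow> norm (g n x - G x) \<le> b x" and b: "b \<in> L2 M"
  shows "approximable G"
proof (rule approximable_closed[OF G])
  fix \<delta> :: real assume \<delta>: "\<delta> > 0"
  note [measurable] = G approximable_measurable[OF g] L2_measurable[OF b]
  have sp: "space M = \<Omega>" by (simp add: space_restrict_space)
  have "(\<lambda>n. \<integral>\<^sup>+x. ennreal ((norm (g n x - G x))\<^sup>2) \<partial>M) \<longlonglongrightarrow> (\<integral>\<^sup>+x. 0 \<partial>M)"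
  proof (rule nn_integral_dominated_convergence[where w = "\<lambda>x. ennreal ((norm (b x))\<^sup>2)"])
    show "AE x in M. ennreal ((norm (g n x - G x))\<^sup>2) \<le> ennreal ((norm (b x))\<^sup>2)" for n
      using bound by (intro AE_I2 ennreal_leI power_mono) (auto simp: sp intro: order_trans[OF _ abs_ge_self])
    show "(\<integral>\<^sup>+x. ennreal ((norm (b x))\<^sup>2) \<partial>M) < \<infinity>"
      using b unfolding L2_iff_nsq nsq_def by blast
    show "AE x in M. (\<lambda>n. ennreal ((norm (g n x - G x))\<^sup>2)) \<longlonglongrightarrow> 0"
    proof (rule AE_I2)
      fix x assume "x \<in> space M"
      then have "(\<lambda>n. g n x) \<longlonglongrightarrow> G x" using lim by (simp add: sp)
      then have "(\<lambda>n. (norm (g n x - G x))\<^sup>2) \<longlonglongrightarrow> (norm (G x - G x))\<^sup>2" by (intro tendsto_intros)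
      then have "(\<lambda>n. ennreal ((norm (g n x - G x))\<^sup>2)) \<longlonglongrightarrow> ennreal ((norm (G x - G x))\<^sup>2)" by (rule tendsto_ennrealI)
      then show "(\<lambda>n. ennreal ((norm (g n x - G x))\<^sup>2)) \<longlonglongrightarrow> 0" by simp
    qed
  qed measurable
  then have "(\<lambda>n. nsq M (\<lambda>x. g n x - G x)) \<longlonglongrightarrow> 0" by (simp add: nsq_def)
  then have "\<forall>\<^sub>F n in sequentially. nsq M (\<lambda>x. g n x - G x) < ennreal \<delta>"
    using \<delta> by (intro order_tendstoD(2)) (auto simp: ennreal_less_zero_iff)
  then obtain n where "nsq M (\<lambda>x. g n x - G x) < ennreal \<delta>" by (auto simp: eventually_sequentially)
  then show "\<exists>H. approximable H \<and> nsq M (\<lambda>x. H x - G x) \<le> ennreal \<delta>" using g less_imp_le by blast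
qed

lemma const_L2: "(\<lambda>x. c) \<in> L2 M" by (rule L2_const[OF fin])

text \<open>The approximants are Lipschitz cut-offs of the distance to \<open>S\<close>. Their
  slopes are large from the start, so that all supports lie in the domain.\<close>

lemma compact_indicator_approximable:
  assumes S: "compact S" "S \<subseteq> \<Omega>"
  shows "approximable (\<lambda>x. (c * indicator S x) *\<^sub>R axis i 1)"
\<comment> \<open>As \<open>infdist x {} = 0\<close>, the cut-offs below would be constant for the
  empty set.\<close>
proof (cases "S = {}")
  case True
  then show ?thesis using approximable_zero by simp
next
  case False
  obtain \<delta> where \<delta>: "0 < \<delta>" "(\<Union>x\<in>S. ball x \<delta>) \<subseteq> \<Omega>"
    using compact_subset_open_imp_ball_epsilon_subset[OF S(1) op S(2)] by blast
  obtain k :: nat where k: "1 / real (Suc k) < \<delta>"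
    using reals_Archimedean[OF \<delta>(1)] by (auto simp: inverse_eq_divide)
  define r where "r n = real (Suc (k + n))" for n
  have r: "r n > 0" "1 / r n < \<delta>" for n
  proof -
    have "1 / r n \<le> 1 / real (Suc k)" by (intro divide_left_mono) (auto simp: r_def)
    then show "1 / r n < \<delta>" using k by simp
  qed (simp add: r_def)
  define g where "g n x = c * max 0 (1 - r n * infdist x S)" for n x
  have g0: "infdist x S = 0 \<longleftrightarrow> x \<in> S" for x
    using in_closed_iff_infdist_zero[OF compact_imp_closed[OF S(1)] False] by simp
  show ?thesis
  proof (rule approximable_dominated[where g = "\<lambda>n x. g n x *\<^sub>R axis i 1" and b = "\<lambda>x. \<bar>c\<bar>"])
    fix n
    show "approximable (\<lambda>x. g n x *\<^sub>R axis i 1)"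
    proof (rule lipschitz_approximable[where L = "\<bar>c\<bar> * r n" and S = "{x. infdist x S \<le> 1 / r n}"])
      show "0 \<le> \<bar>c\<bar> * r n" using r by (simp add: less_imp_le)
      show "compact {x. infdist x S \<le> 1 / r n}" using r by (intro compact_infdist_le S False) auto
      show "{x. infdist x S \<le> 1 / r n} \<subseteq> \<Omega>"
      proof
        fix x assume "x \<in> {x. infdist x S \<le> 1 / r n}"
        moreover obtain y where "y \<in> S" "infdist x S = dist x y"
          using infdist_attains_inf[OF compact_imp_closed[OF S(1)] False] by blast
        ultimately have "y \<in> S" "x \<in> ball y \<delta>" using r(2)[of n] by (auto simp: dist_commute)
        then show "x \<in> \<Omega>" using \<delta>(2) by blast
      qed
      show "g n x = 0" if "x \<notin> {x. infdist x S \<le> 1 / r n}" for x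
        using that r(1)[of n] by (simp add: g_def field_simps)
      fix x y
      have "\<bar>infdist x S - infdist y S\<bar> \<le> norm (x - y)"
        using infdist_triangle[of x S y] infdist_triangle[of y S x] by (simp add: dist_norm norm_minus_commute)
      then have "\<bar>c\<bar> * (r n * \<bar>infdist x S - infdist y S\<bar>) \<le> \<bar>c\<bar> * (r n * norm (x - y))"
        using r(1)[of n] by (intro mult_left_mono) auto
      moreover have "\<bar>g n x - g n y\<bar> \<le> \<bar>c\<bar> * (r n * \<bar>infdist x S - infdist y S\<bar>)"
      proof -
        have "\<bar>max 0 (1 - r n * infdist x S) - max 0 (1 - r n * infdist y S)\<bar> \<le> \<bar>r n * infdist x S - r n * infdist y S\<bar>"
          by linarith
        also have "\<dots> = r n * \<bar>infdist x S - infdist y S\<bar>"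
          using r(1)[of n] by (simp add: abs_mult right_diff_distrib[symmetric])
        finally show ?thesis unfolding g_def right_diff_distrib[symmetric] abs_mult by (intro mult_left_mono) auto
      qed
      ultimately show "\<bar>g n x - g n y\<bar> \<le> \<bar>c\<bar> * r n * norm (x - y)" by (simp add: mult.assoc)
    qed
    fix x
    have "\<bar>max 0 (1 - r n * infdist x S) - indicator S x\<bar> \<le> 1"
      using r(1)[of n] infdist_nonneg[of x S] g0[of x] by (auto simp: indicator_def max_def mult_nonneg_nonneg)
    then have "\<bar>c\<bar> * \<bar>max 0 (1 - r n * infdist x S) - indicator S x\<bar> \<le> \<bar>c\<bar> * 1" by (rule mult_left_mono) simp
    then show "norm (g n x *\<^sub>R axis i 1 - (c * indicator S x) *\<^sub>R (axis i 1 :: R2)) \<le> \<bar>c\<bar>"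
      by (simp add: g_def scaleR_diff_left[symmetric] right_diff_distrib[symmetric] abs_mult)
  next
    fix x
    show "(\<lambda>n. g n x *\<^sub>R axis i 1) \<longlonglongrightarrow> (c * indicator S x) *\<^sub>R (axis i 1 :: R2)"
    proof (intro tendsto_scaleR tendsto_const)
      show "(\<lambda>n. g n x) \<longlonglongrightarrow> c * indicator S x"
      proof (cases "x \<in> S")
        case True
        then show ?thesis using g0[of x] by (simp add: g_def)
      next
        case False
        then have d: "infdist x S > 0" using g0[of x] infdist_nonneg[of x S] by linarith
        then obtain m :: nat where m: "1 < real m * infdist x S" using reals_Archimedean3 by blast
        have "g n x = 0" if "n \<ge> m" for n
        proof -
          have "real m * infdist x S \<le> r n * infdist x S" using that d by (intro mult_right_mono) (auto simp: r_def)
          then show ?thesis using m by (simp add: g_def)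
        qed
        then have "\<forall>\<^sub>F n in sequentially. g n x = c * indicator S x"
          using False by (auto simp: eventually_sequentially)
        then show ?thesis by (rule tendsto_eventually)
      qed
    qed
  next
    have [measurable]: "S \<in> sets borel" using S(1) compact_imp_closed borel_closed by blast
    have "(\<lambda>x. (c * indicator S x) *\<^sub>R axis i 1 :: R2) \<in> borel_measurable lborel" by measurable
    then show "(\<lambda>x. (c * indicator S x) *\<^sub>R axis i 1 :: R2) \<in> borel_measurable M"
      by (intro measurable_restrict_space1 measurable_completion)
  qed (rule const_L2)
qed

text \<open>Inner regularity by closed sets, which are compact because the domain is
  bounded.\<close>

lemma indicator_approximable:
  assumes A: "A \<in> sets M"
  shows "approximable (\<lambda>x. (c * indicator A x) *\<^sub>R axis i 1)"
proof (rule approximable_closed)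
  show "(\<lambda>x. (c * indicator A x) *\<^sub>R axis i 1 :: R2) \<in> borel_measurable M"
    using A by measurable
  fix \<delta> :: real assume \<delta>: "\<delta> > 0"
  have A': "A \<in> sets lebesgue" "A \<subseteq> \<Omega>" using A op by (auto simp: sets_restrict_space_iff)
  \<comment> \<open>The 1 in the denominator covers c = 0.\<close>
  define e where "e = \<delta> / (c\<^sup>2 + 1)"
  have e: "e > 0" using \<delta> by (simp add: e_def add_nonneg_pos)
  obtain T where T: "closed T" "T \<subseteq> A" "A - T \<in> lmeasurable" "emeasure lebesgue (A - T) < ennreal e"
    by (rule sets_lebesgue_inner_closed[OF A'(1) e])
  have "bounded T" using bd T(2) A'(2) bounded_subset by blast
  then have K: "compact T" "T \<subseteq> \<Omega>" using T A' by (auto simp: compact_eq_bounded_closed)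
  have "nsq M (\<lambda>x. (c * indicator T x) *\<^sub>R axis i 1 - (c * indicator A x) *\<^sub>R (axis i 1 :: R2)) =
      (\<integral>\<^sup>+x. ennreal (c\<^sup>2) * indicator (A - T) x \<partial>M)"
    unfolding nsq_def using T(2)
    by (intro nn_integral_cong) (auto simp: indicator_def)
  also have "\<dots> = ennreal (c\<^sup>2) * emeasure M (A - T)"
    using A T(1) K op by (intro nn_integral_cmult_indicator) (auto simp: sets_restrict_space_iff)
  also have "emeasure M (A - T) = emeasure lebesgue (A - T)"
    using A' op by (intro emeasure_restrict_space) auto
  also have "ennreal (c\<^sup>2) * emeasure lebesgue (A - T) \<le> ennreal (c\<^sup>2) * ennreal e"
    using T(4) by (intro mult_left_mono) auto
  also have "\<dots> = ennreal (c\<^sup>2 * e)" using e by (simp add: ennreal_mult)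
  also have "\<dots> \<le> ennreal \<delta>"
  proof (rule ennreal_leI)
    have "c\<^sup>2 * e \<le> (c\<^sup>2 + 1) * e" using e by (intro mult_right_mono) auto
    also have "\<dots> = \<delta>" by (simp add: e_def add_nonneg_eq_0_iff)
    finally show "c\<^sup>2 * e \<le> \<delta>" .
  qed
  finally show "\<exists>H. approximable H \<and> nsq M (\<lambda>x. H x - (c * indicator A x) *\<^sub>R axis i 1) \<le> ennreal \<delta>"
    using compact_indicator_approximable[OF K, of c i] by blast
qed

lemma sum_approximable:
  assumes "finite A" "\<And>a. a \<in> A \<Longrightarrow> approximable (F a)"
  shows "approximable (\<lambda>x. \<Sum>a\<in>A. F a x)"
  using assms by (induction A rule: finite_induct) (auto intro: approximable_zero approximable_add)

lemma cong_approximable: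
  assumes "approximable F" "\<And>x. x \<in> \<Omega> \<Longrightarrow> F x = G x" shows "approximable G"
proof (rule approximable_closed)
  have sp: "space M = \<Omega>" by (simp add: space_restrict_space)
  show "G \<in> borel_measurable M"
    using approximable_measurable[OF assms(1)] assms(2) by (subst measurable_cong[of M G F]) (auto simp: sp)
  have "nsq M (\<lambda>x. F x - G x) = (\<integral>\<^sup>+x. 0 \<partial>M)"
    unfolding nsq_def using assms(2) by (intro nn_integral_cong) (auto simp: sp)
  then show "\<exists>H. approximable H \<and> nsq M (\<lambda>x. H x - G x) \<le> ennreal \<delta>" for \<delta>
    using assms(1) by (intro exI[of _ F]) auto
qed

lemma scalar_approximable:
  fixes f :: "R2 \<Rightarrow> real"
  assumes f: "f \<in> L2 M"
  shows "approximable (\<lambda>x. f x *\<^sub>R axis i 1)"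
proof -
  have sp: "space M = \<Omega>" by (simp add: space_restrict_space)
  from borel_measurable_implies_sequence_metric[OF L2_measurable[OF f], of 0]
  obtain F where "(\<forall>n. simple_function M (F n)) \<and> (\<forall>x\<in>space M. (\<lambda>n. F n x) \<longlonglongrightarrow> f x) \<and>
    (\<forall>n. \<forall>x\<in>space M. dist (F n x) 0 \<le> 2 * dist (f x) 0)" ..
  then have F': "\<forall>n. simple_function M (F n)" "\<forall>x\<in>space M. (\<lambda>n. F n x) \<longlonglongrightarrow> f x"
    "\<forall>n. \<forall>x\<in>space M. dist (F n x) 0 \<le> 2 * dist (f x) 0" by simp_all
  then have F: "\<And>n. simple_function M (F n)" by simp
  show ?thesis
  \<comment> \<open>The simple functions are bounded by 2|f|, so the error is at most 3|f|.\<close>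
  proof (rule approximable_dominated[where g = "\<lambda>n x. F n x *\<^sub>R axis i 1" and b = "\<lambda>x. 3 *\<^sub>R \<bar>f x\<bar>"])
    show "(\<lambda>x. 3 *\<^sub>R \<bar>f x\<bar>) \<in> L2 M" using f L2_measurable[OF f] by (intro L2_scale) (auto simp: L2_def)
    show "(\<lambda>x. f x *\<^sub>R axis i 1 :: R2) \<in> borel_measurable M" using L2_measurable[OF f] by measurable
    show "(\<lambda>n. F n x *\<^sub>R axis i 1) \<longlonglongrightarrow> f x *\<^sub>R (axis i 1 :: R2)" if "x \<in> \<Omega>" for x
      using F'(2) that by (intro tendsto_scaleR tendsto_const) (auto simp: sp)
    show "norm (F n x *\<^sub>R axis i 1 - f x *\<^sub>R (axis i 1 :: R2)) \<le> 3 *\<^sub>R \<bar>f x\<bar>" if "x \<in> \<Omega>" for n x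
      using F'(3)[rule_format, of x n] that by (simp add: sp scaleR_diff_left[symmetric])
    fix n
    have "approximable (\<lambda>x. \<Sum>y\<in>F n ` space M. (y * indicator (F n -` {y} \<inter> space M) x) *\<^sub>R axis i 1)"
      using simple_functionD[OF F] by (intro sum_approximable indicator_approximable) auto
    then show "approximable (\<lambda>x. F n x *\<^sub>R axis i 1)"
    proof (rule cong_approximable)
      fix x assume "x \<in> \<Omega>"
      then have "F n x = (\<Sum>y\<in>F n ` space M. indicator (F n -` {y} \<inter> space M) x *\<^sub>R y)"
        by (intro simple_function_indicator_representation_banach[OF F]) (simp add: sp)
      also have "\<dots> = (\<Sum>y\<in>F n ` space M. y * indicator (F n -` {y} \<inter> space M) x)"
        by (intro sum.cong refl) simp
      finally show "(\<Sum>y\<in>F n ` space M. (y * indicator (F n -` {y} \<inter> space M) x) *\<^sub>R axis i 1) = F n x *\<^sub>R (axis i 1 :: R2)"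
        by (simp only: scaleR_sum_left[symmetric])
    qed
  qed
qed

text \<open>Here the fluxes along the two coordinate directions are superposed on the common
  lattice.\<close>

lemma L2_approximable:
  assumes G: "G \<in> L2 M" shows "approximable G"
proof (rule cong_approximable)
  show "approximable (\<lambda>x. \<Sum>i\<in>UNIV. (G x $ i) *\<^sub>R axis i 1)"
    by (intro sum_approximable scalar_approximable L2_bounded_linear[OF G bounded_linear_vec_nth]) auto
  show "(\<Sum>i\<in>UNIV. (G x $ i) *\<^sub>R axis i 1) = G x" for x
    using basis_expansion[of "G x"] by (simp only: scalar_mult_eq_scaleR)
qed

end

section \<open>From fluxes to strains\<close>

text \<open>The flux \<^term>\<open>v\<close> is rotated so that the curl of \<^term>\<open>\<lambda>x. tensor_rot b (v x)\<close> is \<^term>\<open>b\<close> times the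
  divergence of \<^term>\<open>v\<close>.\<close>

definition tensor_rot :: "R2 \<Rightarrow> R2 \<Rightarrow> M22" where
  "tensor_rot b v = (\<chi> a c. b $ a * (if c = 1 then - (v $ 2) else v $ 1))"

lemma tensor_rot_nth [simp]: "tensor_rot b v $ a $ 1 = - (b $ a * v $ 2)" "tensor_rot b v $ a $ 2 = b $ a * v $ 1"
  by (simp_all add: tensor_rot_def)

lemma M22_eq_iff: "F = G \<longleftrightarrow> (\<forall>a. F $ a $ 1 = G $ a $ 1 \<and> F $ a $ 2 = (G :: M22) $ a $ 2)"
  by (auto simp: vec_eq_iff forall_2)

lemma linear_tensor_rot: "linear (tensor_rot b)"
  by (auto simp: linear_iff M22_eq_iff algebra_simps)

lemma bounded_linear_tensor_rot: "bounded_linear (tensor_rot b)"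
  using linear_tensor_rot linear_conv_bounded_linear by blast

lemma norm_tensor_rot: "norm (tensor_rot b v) = norm b * norm v"
proof -
  have "tensor_rot b v \<bullet> tensor_rot b v = (b \<bullet> b) * (v \<bullet> v)"
    unfolding inner_vec_def by (simp add: UNIV_2 algebra_simps)
  then show ?thesis by (simp add: norm_eq_sqrt_inner real_sqrt_mult)
qed

text \<open>Supplies the linear coordinates in which the columns of a matrix are expanded along the
  Burgers vectors.\<close>

lemma dual_basis:
  fixes b1 b2 :: R2
  assumes "b1 \<noteq> b2" "independent {b1, b2}"
  shows "\<exists>p1 p2. linear p1 \<and> linear p2 \<and> (\<forall>x. x = p1 x *\<^sub>R b1 + p2 x *\<^sub>R b2)"
proof -
  have "UNIV \<subseteq> span {b1, b2}"
    using assms by (intro card_ge_dim_independent) (auto simp: dim_UNIV)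
  then have sp: "x \<in> span {b1, b2}" for x by blast
  define p where "p b x = representation {b1, b2} x b" for b x
  have "linear (p b)" for b
    unfolding p_def using assms(2) sp by (auto simp: linear_iff representation_add representation_scale)
  moreover have "x = p b1 x *\<^sub>R b1 + p b2 x *\<^sub>R b2" for x
    using sum_representation_eq[OF assms(2) sp, of "{b1, b2}" x] assms(1) by (simp add: p_def)
  ultimately show ?thesis by blast
qed

context regime
begin

text \<open>Each of the two rotated fluxes contributes integer multiples of its own Burgers vector
  at the common centres, so that the curl has weights in the integer span. Centres at which the
  combination vanishes are dropped, and the spacing \<sigma> \<ge> 2 r of the lattice gives the
  separation.\<close>

lemma admissible_pair:
  fixes b1 b2 :: R2
  assumes v: "lattice_flux \<Omega> \<sigma> r v \<xi>" and u: "lattice_flux \<Omega> \<sigma> r u \<eta>" and \<sigma>: "0 < \<sigma>" "2 * r \<le> \<sigma>"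
  shows "\<exists>\<mu>. \<mu> \<in> vector_measures \<and> \<mu> \<in> admissible_measures \<Omega> b1 b2 r \<and>
    (\<lambda>y. tensor_rot b1 (v y) + tensor_rot b2 (u y)) \<in> L1_loc \<and>
    (\<lambda>y. tensor_rot b1 (v y) + tensor_rot b2 (u y)) \<in> admissible_strains \<Omega> r \<mu>"
proof -
  define \<beta> where "\<beta> y = tensor_rot b1 (v y) + tensor_rot b2 (u y)" for y
  have iv: "integrable lborel v" and iu: "integrable lborel u" using u v by (simp_all add: lattice_flux_def)
  have i\<beta>: "integrable lborel \<beta>"
    unfolding \<beta>_def using iv iu
    by (intro Bochner_Integration.integrable_add integrable_bounded_linear[OF bounded_linear_tensor_rot])
  then have m\<beta>: "\<beta> \<in> borel_measurable lborel" by auto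
  then have i\<beta>': "integrable lebesgue \<beta>" using i\<beta> by (simp add: integrable_completion)
  have abs: "\<beta> absolutely_integrable_on A" if "A \<in> sets lebesgue" for A
    unfolding set_integrable_def using i\<beta>' that by (intro integrable_mult_indicator) auto
  have "\<beta> \<in> L1_loc"
    unfolding L1_loc_def by (auto intro!: abs fmeasurableD[OF lmeasurable_compact])
  define \<zeta> where "\<zeta> e = of_int (\<xi> e) *\<^sub>R b1 + of_int (\<eta> e) *\<^sub>R b2" for e
  define S where "S = {e. \<zeta> e \<noteq> 0}"
  let ?S = "{e. \<xi> e \<noteq> 0} \<union> {e. \<eta> e \<noteq> 0}"
  have fin': "finite ?S" using u v by (simp add: lattice_flux_def)
  have sub: "S \<subseteq> ?S" by (auto simp: S_def \<zeta>_def)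
  have finS: "finite S" by (rule finite_subset[OF sub fin'])
  obtain f where f: "bij_betw f {0..<card S} S" using ex_bij_betw_nat_finite[OF finS] by blast
  define n where "n = card S"
  define x where "x i = center \<sigma> (f i)" for i
  have fb: "bij_betw f {..<n} S" using f by (simp add: n_def atLeast0LessThan)
  have dist: "norm (x i - x k) \<ge> 2 * r" "x i \<noteq> x k" if "i < n" "k < n" "i \<noteq> k" for i k
  proof -
    have "f i \<noteq> f k" using fb that by (auto simp: bij_betw_def inj_on_def)
    from center_dist[OF \<sigma>(1) this] show "norm (x i - x k) \<ge> 2 * r" "x i \<noteq> x k"
      using \<sigma> by (auto simp: x_def)
  qed
  have inj: "inj_on x {..<n}" using dist(2) by (auto simp: inj_on_def)
  define \<mu> where "\<mu> = (\<lambda>A. \<Sum>i<n. dirac (\<zeta> (f i)) (x i) A)"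
  have \<mu>1: "\<mu> \<in> vector_measures" unfolding \<mu>_def by (rule dirac_sum_vector_measure)
  have fS: "f i \<in> S" if "i < n" for i using fb that by (auto simp: bij_betw_def)
  have "\<mu> \<in> admissible_measures \<Omega> b1 b2 r"
    unfolding admissible_measures_def
  proof (intro CollectI conjI \<mu>1, rule exI[of _ n], rule exI[of _ "\<lambda>i. \<zeta> (f i)"], rule exI[of _ x], intro conjI allI impI)
    show "\<mu> = (\<lambda>A. \<Sum>i<n. dirac (\<zeta> (f i)) (x i) A)" by (rule \<mu>_def)
    fix i assume i: "i < n"
    show "\<zeta> (f i) \<in> int_span b1 b2 - {0}"
      using fS[OF i] by (auto simp: S_def \<zeta>_def int_span_def)
    have "\<xi> (f i) \<noteq> 0 \<or> \<eta> (f i) \<noteq> 0" using fS[OF i] sub by auto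
    then show "ball (x i) r \<subseteq> \<Omega>" using u v unfolding lattice_flux_def x_def by blast
  next
    fix i k assume "i < n" "k < n" "i \<noteq> k"
    then show "2 * r \<le> norm (x i - x k)" by (rule dist(1))
  qed
  moreover have "\<beta> \<in> admissible_strains \<Omega> r \<mu>"
    unfolding admissible_strains_def
  proof (intro CollectI conjI ballI)
    let ?U = "enlarge \<Omega> r"
    have "enlarge \<Omega> r = (if \<Omega> = {} then {} else {x. infdist x \<Omega> < r})" by (auto simp: enlarge_def)
    moreover have "open {x. infdist x \<Omega> < r}" by (intro open_Collect_less continuous_intros)
    ultimately have "open ?U" by simp
    then show "\<beta> absolutely_integrable_on ?U" by (intro abs) auto
    fix \<phi> assume \<phi>: "\<phi> \<in> test_functions ?U"
    then interpret test_function \<phi> ?U by unfold_locales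
    have comp: "integrable lborel (\<lambda>x. w x $ k)" if "integrable lborel w" for w :: "R2 \<Rightarrow> R2" and k
      by (rule integrable_bounded_linear[OF bounded_linear_vec_nth that])
    have int: "integrable lborel (\<lambda>x. \<Sum>k\<in>UNIV. w x $ k * D k x)" if "integrable lborel w" for w :: "R2 \<Rightarrow> R2"
      by (intro Bochner_Integration.integrable_sum D_mult_integrable comp that)
    have div: "(\<integral>x. (\<Sum>k\<in>UNIV. w x $ k * D k x) \<partial>lborel) = - (\<Sum>e\<in>?S. of_int (\<omega> e) * \<phi> (center \<sigma> e))"
      if "lattice_flux \<Omega> \<sigma> r w \<omega>" "{e. \<omega> e \<noteq> 0} \<subseteq> ?S" for w \<omega>
    proof -
      have "(\<integral>x. (\<Sum>k\<in>UNIV. w x $ k * D k x) \<partial>lborel) = - (\<Sum>e\<in>{e. \<omega> e \<noteq> 0}. of_int (\<omega> e) * \<phi> (center \<sigma> e))"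
        using that(1) \<phi> unfolding lattice_flux_def by blast
      also have "(\<Sum>e\<in>{e. \<omega> e \<noteq> 0}. of_int (\<omega> e) * \<phi> (center \<sigma> e)) = (\<Sum>e\<in>?S. of_int (\<omega> e) * \<phi> (center \<sigma> e))"
        using that(2) fin' by (intro sum.mono_neutral_left) auto
      finally show ?thesis .
    qed
    have "curl_distr ?U \<beta> \<phi> $ a = (\<Sum>i<n. \<phi> (x i) *\<^sub>R \<zeta> (f i)) $ a" for a
    proof -
      define h where "h y = b1 $ a * (\<Sum>k\<in>UNIV. v y $ k * D k y) + b2 $ a * (\<Sum>k\<in>UNIV. u y $ k * D k y)" for y
      have ih: "integrable lborel h" unfolding h_def by (intro Bochner_Integration.integrable_add integrable_mult_right int iv iu)
      \<comment> \<open>Outside \<open>?U\<close> the derivatives of \<phi> vanish, so the integral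
        is one over the plane; the rotation turns the curl expression into the pairing of the fluxes
        with the gradient of \<phi>.\<close>
      have "indicator ?U y *\<^sub>R (\<beta> y $ a $ 2 * D 1 y - \<beta> y $ a $ 1 * D 2 y) = h y" for y
        using D_eq_0'[of y] by (cases "y \<in> ?U") (auto simp: h_def \<beta>_def UNIV_2 algebra_simps)
      then have "curl_distr ?U \<beta> \<phi> $ a = - (\<integral>y. h y \<partial>lebesgue)"
        by (simp add: curl_distr_def set_lebesgue_integral_def)
      also have "(\<integral>y. h y \<partial>lebesgue) = (\<integral>y. h y \<partial>lborel)" using ih by (intro integral_completion) auto
      also have "\<dots> = b1 $ a * (\<integral>y. (\<Sum>k\<in>UNIV. v y $ k * D k y) \<partial>lborel) + b2 $ a * (\<integral>y. (\<Sum>k\<in>UNIV. u y $ k * D k y) \<partial>lborel)"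
        unfolding h_def using int[OF iv] int[OF iu] by (subst Bochner_Integration.integral_add) auto
      also have "- \<dots> = b1 $ a * (\<Sum>e\<in>?S. of_int (\<xi> e) * \<phi> (center \<sigma> e)) + b2 $ a * (\<Sum>e\<in>?S. of_int (\<eta> e) * \<phi> (center \<sigma> e))"
        using div[OF v] div[OF u] by simp
      also have "\<dots> = (\<Sum>e\<in>?S. \<phi> (center \<sigma> e) * (\<zeta> e $ a))"
        unfolding sum_distrib_left sum.distrib[symmetric] by (intro sum.cong) (auto simp: \<zeta>_def algebra_simps)
      also have "\<dots> = (\<Sum>e\<in>S. \<phi> (center \<sigma> e) * (\<zeta> e $ a))"
        using sub fin' by (intro sum.mono_neutral_right) (auto simp: S_def)
      also have "\<dots> = (\<Sum>i<n. \<phi> (x i) * (\<zeta> (f i) $ a))"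
        unfolding x_def by (rule sum.reindex_bij_betw[OF fb, symmetric])
      also have "\<dots> = (\<Sum>i<n. \<phi> (x i) *\<^sub>R \<zeta> (f i)) $ a" by simp
      finally show ?thesis .
    qed
    then have "curl_distr ?U \<beta> \<phi> = (\<Sum>i<n. \<phi> (x i) *\<^sub>R \<zeta> (f i))" by (simp add: vec_eq_iff)
    also have "\<dots> = measure_distr \<mu> \<phi>"
      unfolding \<mu>_def by (rule measure_distr_diracs[OF inj \<phi>_measurable, symmetric])
    finally show "curl_distr ?U \<beta> \<phi> = measure_distr \<mu> \<phi>" .
  qed
  ultimately show ?thesis using \<open>\<beta> \<in> L1_loc\<close> \<mu>1 unfolding \<beta>_def[abs_def] by blast
qed

lemma approximate_recovery:
  fixes b1 b2 :: R2
  assumes b: "norm b1 = 1" "norm b2 = 1" "b1 \<noteq> b2" "independent {b1, b2}"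
    and \<beta>: "\<beta> \<in> L2_sym \<Omega>" and \<epsilon>: "0 < \<epsilon>"
  shows "\<forall>\<^sub>F j in sequentially. \<exists>\<mu> \<beta>'. \<mu> \<in> vector_measures \<and> \<mu> \<in> admissible_measures \<Omega> b1 b2 (\<rho> j) \<and>
    \<beta>' \<in> L1_loc \<and> \<beta>' \<in> admissible_strains \<Omega> (\<rho> j) \<mu> \<and>
    nsq M (\<lambda>x. rescaled_strain w (\<alpha> j) (\<rho> j) (N j) \<beta>' x - \<beta> x) \<le> ennreal \<epsilon>"
proof -
  have \<beta>L: "\<beta> \<in> L2 M" and \<beta>s: "AE x in M. transpose (\<beta> x) = \<beta> x" using \<beta> by (auto simp: L2_sym_iff[OF op])
  obtain p1 p2 where p: "linear p1" "linear p2" and p_sum: "\<forall>x. x = p1 x *\<^sub>R b1 + p2 x *\<^sub>R b2"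
    using dual_basis[OF b(3,4)] by blast
  \<comment> \<open>Undoes the rotation in \<open>tensor_rot\<close>, whose second column carries
    the first component of the flux and whose first column carries minus the second
    component.\<close>
  define P :: "(R2 \<Rightarrow> real) \<Rightarrow> M22 \<Rightarrow> R2"
    where "P p F = (\<chi> c. if c = 1 then p (column 2 F) else - p (column 1 F))" for p F
  have lin: "bounded_linear (P p)" if "linear p" for p
  proof -
    have col: "column c (F + G) = column c F + column c G" "column c (r *\<^sub>R F) = r *\<^sub>R column c F" for c r and F G :: M22
      by (auto simp: column_def vec_eq_iff)
    have "linear (P p)"
    proof (rule linearI)
      show "P p (F + G) = P p F + P p G" for F G
        unfolding vec_eq_iff P_def col linear_add[OF that] by simp
      show "P p (r *\<^sub>R F) = r *\<^sub>R P p F" for r F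
        unfolding vec_eq_iff P_def col linear_scale[OF that] by simp
    qed
    then show ?thesis using linear_conv_bounded_linear by blast
  qed
  have split: "F = tensor_rot b1 (P p1 F) + tensor_rot b2 (P p2 F)" for F
    unfolding M22_eq_iff
  proof (intro allI conjI)
    fix a
    have "F $ a $ c = b1 $ a * p1 (column c F) + b2 $ a * p2 (column c F)" for c
      using arg_cong[OF p_sum[rule_format, of "column c F"], of "\<lambda>x. x $ a"] by (simp add: column_def mult.commute)
    then show "F $ a $ 1 = (tensor_rot b1 (P p1 F) + tensor_rot b2 (P p2 F)) $ a $ 1"
      "F $ a $ 2 = (tensor_rot b1 (P p1 F) + tensor_rot b2 (P p2 F)) $ a $ 2"
      by (simp_all add: P_def)
  qed
  have G: "(\<lambda>x. P p1 (\<beta> x)) \<in> L2 M" "(\<lambda>x. P p2 (\<beta> x)) \<in> L2 M"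
    using p(1,2) by (auto intro!: L2_bounded_linear[OF \<beta>L] lin)
  have e: "\<epsilon> / 4 > 0" using \<epsilon> by simp
  have "\<forall>\<^sub>F j in sequentially. \<exists>v \<xi>. lattice_flux \<Omega> (s j) (\<rho> j) v \<xi> \<and>
      nsq M (\<lambda>x. (1 / real (N j)) *\<^sub>R conv (Q j) v x - P p1 (\<beta> x)) \<le> ennreal (\<epsilon> / 4)"
    "\<forall>\<^sub>F j in sequentially. \<exists>v \<xi>. lattice_flux \<Omega> (s j) (\<rho> j) v \<xi> \<and>
      nsq M (\<lambda>x. (1 / real (N j)) *\<^sub>R conv (Q j) v x - P p2 (\<beta> x)) \<le> ennreal (\<epsilon> / 4)"
    using L2_approximable[OF G(1)] L2_approximable[OF G(2)] e unfolding approximable_def by blast+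
  then show ?thesis using \<rho>_s
  proof eventually_elim
    case (elim j)
    then obtain v \<xi> u \<eta> where v: "lattice_flux \<Omega> (s j) (\<rho> j) v \<xi>" and u: "lattice_flux \<Omega> (s j) (\<rho> j) u \<eta>"
      and nv: "nsq M (\<lambda>x. (1 / real (N j)) *\<^sub>R conv (Q j) v x - P p1 (\<beta> x)) \<le> ennreal (\<epsilon> / 4)"
      and nu: "nsq M (\<lambda>x. (1 / real (N j)) *\<^sub>R conv (Q j) u x - P p2 (\<beta> x)) \<le> ennreal (\<epsilon> / 4)" by blast
    have iv: "integrable lborel v" and iu: "integrable lborel u" using u v by (simp_all add: lattice_flux_def)
    define \<beta>' where "\<beta>' = (\<lambda>y. tensor_rot b1 (v y) + tensor_rot b2 (u y))"
    obtain \<mu> where \<mu>: "\<mu> \<in> vector_measures" "\<mu> \<in> admissible_measures \<Omega> b1 b2 (\<rho> j)"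
      "\<beta>' \<in> L1_loc" "\<beta>' \<in> admissible_strains \<Omega> (\<rho> j) \<mu>"
      using admissible_pair[OF v u s_pos elim(3), of b1 b2] unfolding \<beta>'_def by blast
    define d1 where "d1 x = (1 / real (N j)) *\<^sub>R conv (Q j) v x - P p1 (\<beta> x)" for x
    define d2 where "d2 x = (1 / real (N j)) *\<^sub>R conv (Q j) u x - P p2 (\<beta> x)" for x
    note [measurable] = conv_Q_measurable[OF iv, of j] conv_Q_measurable[OF iu, of j] G[THEN L2_measurable]
    \<comment> \<open>\<open>sym_part\<close> fixes \<beta> x and is a contraction, and
      \<open>tensor_rot b\<close> is an isometry for a unit vector \<open>b\<close>; so the error of
      the strain is at most the sum of the errors of the two fluxes.\<close>
    have "AE x in M. norm (rescaled_strain w (\<alpha> j) (\<rho> j) (N j) \<beta>' x - \<beta> x) \<le> norm (d1 x) + norm (d2 x)"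
      using rescaled_AE[OF conjunct1[OF \<alpha>[of j]] conjunct2[OF \<alpha>[of j]] conjunct1[OF \<rho>[of j]] conjunct2[OF \<rho>[of j]] N[of j] \<mu>(3)]
        \<beta>s conv_Q_AE_integrable[OF iv, of j] conv_Q_AE_integrable[OF iu, of j]
    proof eventually_elim
      case (elim x)
      have "conv (Q j) \<beta>' x = (\<integral>y. tensor_rot b1 (Q j (x - y) *\<^sub>R v y) + tensor_rot b2 (Q j (x - y) *\<^sub>R u y) \<partial>lebesgue)"
        by (simp add: conv_def \<beta>'_def scaleR_add_right linear_scale[OF linear_tensor_rot])
      also have "\<dots> = tensor_rot b1 (conv (Q j) v x) + tensor_rot b2 (conv (Q j) u x)"
        using elim(3,4) integral_bounded_linear[OF bounded_linear_tensor_rot elim(3)]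
          integral_bounded_linear[OF bounded_linear_tensor_rot elim(4)]
        by (subst Bochner_Integration.integral_add)
          (auto intro: integrable_bounded_linear[OF bounded_linear_tensor_rot] simp: conv_def)
      finally have c: "conv (Q j) \<beta>' x = tensor_rot b1 (conv (Q j) v x) + tensor_rot b2 (conv (Q j) u x)" .
      have "rescaled_strain w (\<alpha> j) (\<rho> j) (N j) \<beta>' x - \<beta> x = sym_part ((1 / real (N j)) *\<^sub>R conv (Q j) \<beta>' x - \<beta> x)"
        using elim(1) sym_part_of_sym[OF elim(2)]
        by (simp add: Q_def[symmetric] linear_diff[OF linear_sym_part] linear_scale[OF linear_sym_part])
      then have "norm (rescaled_strain w (\<alpha> j) (\<rho> j) (N j) \<beta>' x - \<beta> x) \<le> norm ((1 / real (N j)) *\<^sub>R conv (Q j) \<beta>' x - \<beta> x)"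
        by (simp add: norm_sym_part_le)
      also have "(1 / real (N j)) *\<^sub>R conv (Q j) \<beta>' x - \<beta> x = tensor_rot b1 (d1 x) + tensor_rot b2 (d2 x)"
      proof -
        have "tensor_rot b1 (d1 x) + tensor_rot b2 (d2 x) = (1 / real (N j)) *\<^sub>R conv (Q j) \<beta>' x
            - (tensor_rot b1 (P p1 (\<beta> x)) + tensor_rot b2 (P p2 (\<beta> x)))"
          unfolding d1_def d2_def c linear_diff[OF linear_tensor_rot] linear_scale[OF linear_tensor_rot]
          by (simp add: scaleR_add_right)
        then show ?thesis by (simp only: split[symmetric])
      qed
      also have "norm \<dots> \<le> norm (tensor_rot b1 (d1 x)) + norm (tensor_rot b2 (d2 x))" by (rule norm_triangle_ineq)
      also have "\<dots> = norm (d1 x) + norm (d2 x)" using b by (simp add: norm_tensor_rot)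
      finally show ?case .
    qed
    moreover have "d1 \<in> borel_measurable M" "d2 \<in> borel_measurable M" unfolding d1_def d2_def by measurable
    ultimately have "nsq M (\<lambda>x. rescaled_strain w (\<alpha> j) (\<rho> j) (N j) \<beta>' x - \<beta> x) \<le> 2 * nsq M d1 + 2 * nsq M d2"
      by (intro nsq_add_le)
    also have "\<dots> \<le> 2 * ennreal (\<epsilon> / 4) + 2 * ennreal (\<epsilon> / 4)"
      using nv nu unfolding d1_def d2_def by (intro add_mono mult_left_mono) auto
    also have "\<dots> = ennreal \<epsilon>" by (rule four_quarters[OF \<epsilon>])
    finally show ?case using \<mu> by blast
  qed
qed

text \<open>Supplies an admissible pair for every j, in particular for the small j about which the
  approximation says nothing.\<close>

lemma zero_admissible:
  "(\<lambda>A. 0) \<in> vector_measures" "(\<lambda>A. 0) \<in> admissible_measures \<Omega> b1 b2 r"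
  "(\<lambda>x. 0) \<in> L1_loc" "(\<lambda>x. 0) \<in> admissible_strains \<Omega> r (\<lambda>A. 0)"
  "rescaled_strain w a r' n (\<lambda>x. 0) \<in> L2_sym \<Omega>"
proof -
  show v: "(\<lambda>A. 0) \<in> vector_measures" using dirac_sum_vector_measure[where n = 0] by simp
  show "(\<lambda>A. 0) \<in> admissible_measures \<Omega> b1 b2 r"
    unfolding admissible_measures_def using v by (auto intro!: exI[of _ 0])
  show "(\<lambda>x. 0) \<in> L1_loc" by (simp add: L1_loc_def)
  show "(\<lambda>x. 0) \<in> admissible_strains \<Omega> r (\<lambda>A. 0)"
    unfolding admissible_strains_def
  proof (intro CollectI conjI ballI)
    fix \<phi> assume "\<phi> \<in> test_functions (enlarge \<Omega> r)"
    then interpret test_function \<phi> "enlarge \<Omega> r" by unfold_locales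
    have "measure_distr (\<lambda>A. 0) \<phi> = 0" using measure_distr_diracs[where n = 0, OF _ \<phi>_measurable] by simp
    then show "curl_distr (enlarge \<Omega> r) (\<lambda>x. 0) \<phi> = measure_distr (\<lambda>A. 0) \<phi>"
      by (simp add: curl_distr_def vec_eq_iff)
  qed simp
  have "sym_part 0 = 0" by (rule linear_0[OF linear_sym_part])
  then have "rescaled_strain w a r' n (\<lambda>x. 0) = (\<lambda>x. 0)"
    by (simp add: rescaled_strain_def riesz_potential_def)
  moreover have "transpose (0::M22) = 0" by (simp add: transpose_def vec_eq_iff)
  ultimately show "rescaled_strain w a r' n (\<lambda>x. 0) \<in> L2_sym \<Omega>"
    by (simp add: L2_sym_iff[OF op] L2_zero)
qed

text \<open>Each j takes a pair whose squared distance to \<beta> exceeds the infimum over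
  admissible pairs by at most 1/(j+1). The infima tend to 0 by \<open>approximate_recovery\<close>,
  so the rescaled strains converge strongly; this gives the weak convergence and, through
  \<open>quad_diff\<close>, the bound on the energies.\<close>

lemma limsup_inequality:
  fixes b1 b2 :: R2
  assumes b: "norm b1 = 1" "norm b2 = 1" "b1 \<noteq> b2" "independent {b1, b2}" and \<beta>: "\<beta> \<in> L2_sym \<Omega>"
  shows "\<exists>\<mu> \<beta>j. (\<forall>j. \<mu> j \<in> vector_measures \<and> \<beta>j j \<in> L1_loc \<and> \<mu> j \<in> admissible_measures \<Omega> b1 b2 (\<rho> j) \<and>
      \<beta>j j \<in> admissible_strains \<Omega> (\<rho> j) (\<mu> j)) \<and>
    weakly_L2_sym \<Omega> (\<lambda>j. rescaled_strain w (\<alpha> j) (\<rho> j) (N j) (\<beta>j j)) \<beta> \<and>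
    limsup (\<lambda>j. F_super_approx C w \<Omega> b1 b2 (\<alpha> j) (\<rho> j) (N j) (\<mu> j) (\<beta>j j)) \<le> F_super C \<Omega> \<beta>"
proof -
  have \<beta>L: "\<beta> \<in> L2 M" using \<beta> by (simp add: L2_sym_iff[OF op])
  define f where "f j p = rescaled_strain w (\<alpha> j) (\<rho> j) (N j) (snd p)" for j and p :: "(R2 set \<Rightarrow> R2) \<times> (R2 \<Rightarrow> M22)"
  \<comment> \<open>Membership in \<open>L2_sym \<Omega>\<close> is demanded because
    \<open>weakly_L2_sym\<close> asks for it at every j.\<close>
  define A where "A j = {p. fst p \<in> vector_measures \<and> snd p \<in> L1_loc \<and> fst p \<in> admissible_measures \<Omega> b1 b2 (\<rho> j) \<and>
      snd p \<in> admissible_strains \<Omega> (\<rho> j) (fst p) \<and> f j p \<in> L2_sym \<Omega>}" for j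
  define d where "d j p = nsq M (\<lambda>x. f j p x - \<beta> x)" for j p
  define D where "D j = (INF p\<in>A j. d j p)" for j
  have "\<exists>p\<in>A j. d j p \<le> D j + ennreal (1 / real (Suc j))" for j
  proof (cases "D j = \<infinity>")
    case True
    \<comment> \<open>With an infinite infimum any admissible pair will do.\<close>
    have "((\<lambda>A. 0), (\<lambda>x. 0)) \<in> A j" using zero_admissible by (simp add: A_def f_def)
    then show ?thesis using True by (intro bexI) auto
  next
    case False
    then have "D j < D j + ennreal (1 / real (Suc j))"
      by (cases "D j") (auto simp: ennreal_plus[symmetric] ennreal_less_iff simp del: ennreal_plus)
    then have "\<exists>p\<in>A j. d j p < D j + ennreal (1 / real (Suc j))"
      unfolding D_def by (simp add: INF_less_iff)
    then show ?thesis using less_imp_le by blast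
  qed
  then obtain p where p: "\<And>j. p j \<in> A j" "\<And>j. d j (p j) \<le> D j + ennreal (1 / real (Suc j))" by metis
  define g where "g j = f j (p j)" for j
  have gs: "g j \<in> L2_sym \<Omega>" for j using p(1)[of j] by (simp add: A_def g_def)
  then have gL: "g j \<in> L2 M" for j by (simp add: L2_sym_iff[OF op])
  define r where "r j = ip M (\<lambda>x. g j x - \<beta> x) (\<lambda>x. g j x - \<beta> x)" for j
  have dr: "d j (p j) = ennreal (r j)" for j
    unfolding d_def g_def[symmetric] r_def by (rule nsq_eq_ip[OF L2_diff[OF gL \<beta>L]])
  have r0: "0 \<le> r j" for j by (simp add: r_def ip_nonneg)
  have D: "\<forall>\<^sub>F j in sequentially. D j \<le> ennreal \<epsilon>" if \<epsilon>: "\<epsilon> > 0" for \<epsilon>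
    using approximate_recovery[OF b \<beta> \<epsilon>]
  proof eventually_elim
    case (elim j)
    then obtain \<mu> \<beta>' where m: "\<mu> \<in> vector_measures" "\<mu> \<in> admissible_measures \<Omega> b1 b2 (\<rho> j)"
      "\<beta>' \<in> L1_loc" "\<beta>' \<in> admissible_strains \<Omega> (\<rho> j) \<mu>"
      and n: "nsq M (\<lambda>x. rescaled_strain w (\<alpha> j) (\<rho> j) (N j) \<beta>' x - \<beta> x) \<le> ennreal \<epsilon>" by blast
    have "rescaled_strain w (\<alpha> j) (\<rho> j) (N j) \<beta>' \<in> borel_measurable M"
      using \<alpha>[of j] \<rho>[of j] N[of j] m(3) by (intro rescaled_measurable) auto
    moreover have "nsq M (\<lambda>x. rescaled_strain w (\<alpha> j) (\<rho> j) (N j) \<beta>' x - \<beta> x) < \<infinity>"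
      by (rule le_less_trans[OF n]) simp
    ultimately have "(\<lambda>x. rescaled_strain w (\<alpha> j) (\<rho> j) (N j) \<beta>' x - \<beta> x) \<in> L2 M"
      using L2_measurable[OF \<beta>L] by (simp add: L2_iff_nsq)
    from L2_add[OF this \<beta>L] have "rescaled_strain w (\<alpha> j) (\<rho> j) (N j) \<beta>' \<in> L2 M" by simp
    then have "(\<mu>, \<beta>') \<in> A j"
      using m by (simp add: A_def f_def L2_sym_iff[OF op] transpose_rescaled)
    then have "D j \<le> d j (\<mu>, \<beta>')" unfolding D_def by (rule INF_lower)
    also have "\<dots> \<le> ennreal \<epsilon>" using n by (simp add: d_def f_def)
    finally show ?case .
  qed
  have r_lim: "r \<longlonglongrightarrow> 0"
  proof (rule LIMSEQ_I)
    fix \<epsilon> :: real assume \<epsilon>: "\<epsilon> > 0"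
    then have e: "\<epsilon> / 2 > 0" by simp
    have "(\<lambda>j. 1 / real (Suc j)) \<longlonglongrightarrow> 0" using LIMSEQ_inverse_real_of_nat by (simp add: inverse_eq_divide)
    then have "\<forall>\<^sub>F j in sequentially. 1 / real (Suc j) < \<epsilon> / 2" using e by (rule order_tendstoD)
    with D[OF e] have "\<forall>\<^sub>F j in sequentially. r j < \<epsilon>"
    proof eventually_elim
      case (elim j)
      have "ennreal (r j) \<le> D j + ennreal (1 / real (Suc j))" using p(2)[of j] by (simp add: dr)
      also have "\<dots> \<le> ennreal (\<epsilon> / 2) + ennreal (1 / real (Suc j))" using elim by (intro add_mono) auto
      also have "\<dots> = ennreal (\<epsilon> / 2 + 1 / real (Suc j))" using e by (subst ennreal_plus) auto
      finally have "r j \<le> \<epsilon> / 2 + 1 / real (Suc j)" using e by (subst (asm) ennreal_le_iff) auto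
      then show ?case using elim by simp
    qed
    then show "\<exists>n0. \<forall>j\<ge>n0. norm (r j - 0) < \<epsilon>" using r0 by (auto simp: eventually_sequentially)
  qed
  have weak: "(\<lambda>j. ip M (g j) h) \<longlonglongrightarrow> ip M \<beta> h" if h: "h \<in> L2 M" for h
  proof (rule LIM_zero_cancel, rule Lim_null_comparison)
    show "\<forall>\<^sub>F j in sequentially. norm (ip M (g j) h - ip M \<beta> h) \<le> sqrt (r j) * sqrt (ip M h h)"
      using ip_Cauchy_Schwarz[OF L2_diff[OF gL \<beta>L] h] ip_diff[OF gL \<beta>L h] by (simp add: r_def)
    show "(\<lambda>j. sqrt (r j) * sqrt (ip M h h)) \<longlonglongrightarrow> 0"
      using tendsto_mult_left_zero[OF tendsto_real_sqrt[OF r_lim, simplified]] by simp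
  qed
  have W: "weakly_L2_sym \<Omega> g \<beta>"
    unfolding weakly_L2_sym_def set_integral_eq_ip[OF op]
    using gs \<beta> weak by (auto simp: L2_sym_iff[OF op])
  obtain \<nu> where \<nu>: "0 < \<nu>" "\<And>F. C F \<bullet> F \<le> \<nu> * (norm F)\<^sup>2" using C_upper by blast
  \<comment> \<open>In the expansion about \<beta> the remainder is the form of the error, at most
    \<nu> times its squared norm; the other terms are affine in \<open>g j\<close> and
    converge.\<close>
  have q_le: "quad C \<Omega> (g j) \<le> 2 * ip M (g j) (\<lambda>x. C (\<beta> x)) - quad C \<Omega> \<beta> + \<nu> * r j" for j
  proof -
    define e where "e = (\<lambda>x. g j x - \<beta> x)"
    have eL: "e \<in> L2 M" unfolding e_def by (rule L2_diff[OF gL \<beta>L])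
    have "quad C \<Omega> e \<le> (\<integral>x. \<nu> * (norm (e x))\<^sup>2 \<partial>M)"
      unfolding quad_def ip_def
    proof (rule integral_mono)
      show "integrable M (\<lambda>x. C (e x) \<bullet> e x)" by (rule L2_integrable_inner[OF C_comp_L2[OF eL] eL])
      show "integrable M (\<lambda>x. \<nu> * (norm (e x))\<^sup>2)" using L2_integrable_sq[OF eL] by simp
    qed (rule \<nu>)
    also have "\<dots> = \<nu> * r j" by (simp add: r_def ip_self e_def)
    finally show ?thesis using quad_diff[OF gL \<beta>L, of j] by (simp add: e_def ip_sym)
  qed
  have "(\<lambda>j. ennreal ((2 * ip M (g j) (\<lambda>x. C (\<beta> x)) - quad C \<Omega> \<beta> + \<nu> * r j) / 2)) \<longlonglongrightarrow>
      ennreal ((2 * ip M \<beta> (\<lambda>x. C (\<beta> x)) - quad C \<Omega> \<beta> + \<nu> * 0) / 2)"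
    by (intro tendsto_ennrealI tendsto_intros weak C_comp_L2 \<beta>L r_lim) simp
  also have "(2 * ip M \<beta> (\<lambda>x. C (\<beta> x)) - quad C \<Omega> \<beta> + \<nu> * 0) / 2 = quad C \<Omega> \<beta> / 2"
    by (simp add: quad_def ip_sym)
  finally have lim: "limsup (\<lambda>j. ennreal ((2 * ip M (g j) (\<lambda>x. C (\<beta> x)) - quad C \<Omega> \<beta> + \<nu> * r j) / 2)) = F_super C \<Omega> \<beta>"
    unfolding F_super_eq[OF \<beta>L] by (rule lim_imp_Limsup[OF sequentially_bot])
  have "limsup (\<lambda>j. F_super_approx C w \<Omega> b1 b2 (\<alpha> j) (\<rho> j) (N j) (fst (p j)) (snd (p j))) \<le> F_super C \<Omega> \<beta>"
    unfolding lim[symmetric]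
  proof (intro Limsup_mono always_eventually allI)
    fix j
    have pA: "fst (p j) \<in> admissible_measures \<Omega> b1 b2 (\<rho> j)" "snd (p j) \<in> admissible_strains \<Omega> (\<rho> j) (fst (p j))"
      "snd (p j) \<in> L1_loc" using p(1)[of j] by (auto simp: A_def)
    have "F_super_approx C w \<Omega> b1 b2 (\<alpha> j) (\<rho> j) (N j) (fst (p j)) (snd (p j)) =
        ennreal (1 / (real (N j))\<^sup>2) * elastic_energy C \<Omega> (riesz_potential w (\<alpha> j) (\<rho> j) (snd (p j)))"
      using pA by (simp add: F_super_approx_def)
    also have "\<dots> = F_super C \<Omega> (g j)"
      unfolding g_def f_def using \<alpha>[of j] \<rho>[of j] N[of j] pA(3) by (intro energy_rescaled) auto
    also have "\<dots> = ennreal (quad C \<Omega> (g j) / 2)" by (rule F_super_eq[OF gL])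
    also have "\<dots> \<le> ennreal ((2 * ip M (g j) (\<lambda>x. C (\<beta> x)) - quad C \<Omega> \<beta> + \<nu> * r j) / 2)"
      using q_le[of j] by (intro ennreal_leI) simp
    finally show "F_super_approx C w \<Omega> b1 b2 (\<alpha> j) (\<rho> j) (N j) (fst (p j)) (snd (p j)) \<le>
        ennreal ((2 * ip M (g j) (\<lambda>x. C (\<beta> x)) - quad C \<Omega> \<beta> + \<nu> * r j) / 2)" .
  qed
  then show ?thesis
    using W p(1) unfolding g_def f_def A_def
    by (intro exI[of _ "\<lambda>j. fst (p j)"] exI[of _ "\<lambda>j. snd (p j)"]) auto
qed

end

theorem theorem3p6:
  fixes \<Omega> :: "(real^2) set" and C :: "real^2^2 \<Rightarrow> real^2^2" and w :: "real \<Rightarrow> real"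
    and b1 b2 :: "real^2" and \<alpha> \<rho> :: "nat \<Rightarrow> real" and N :: "nat \<Rightarrow> nat"
  assumes "open \<Omega>" "bounded \<Omega>" "simply_connected \<Omega>" "lipschitz_boundary \<Omega>"
    and "elasticity_tensor C" and "horizon_profile w"
    and "norm b1 = 1" "norm b2 = 1" "b1 \<noteq> b2" "independent {b1, b2}"
    and "\<And>j. 0 < \<alpha> j \<and> \<alpha> j < 1" "\<And>j. 0 < \<rho> j \<and> \<rho> j < 1" "\<And>j. 0 < N j"
    and "\<alpha> \<longlonglongrightarrow> 0" "\<rho> \<longlonglongrightarrow> 0" "filterlim N at_top sequentially"
    and "(\<lambda>j. \<alpha> j * ln (\<rho> j)) \<longlonglongrightarrow> 0"
    and "(\<lambda>j. real (N j) * (\<rho> j)\<^sup>2) \<longlonglongrightarrow> 0"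
    and "filterlim (\<lambda>j. real (N j) * \<alpha> j) at_top sequentially"
  shows
    "(\<forall>\<mu> \<beta>j. (\<forall>j. \<mu> j \<in> vector_measures \<and> \<beta>j j \<in> L1_loc) \<and>
        (SUP j. F_super_approx C w \<Omega> b1 b2 (\<alpha> j) (\<rho> j) (N j) (\<mu> j) (\<beta>j j)) < \<infinity> \<longrightarrow>
        (\<exists>r :: nat \<Rightarrow> nat. \<exists>\<beta>\<in>L2_sym \<Omega>. strict_mono r \<and>
           weakly_L2_sym \<Omega>
             (\<lambda>k. rescaled_strain w (\<alpha> (r k)) (\<rho> (r k)) (N (r k)) (\<beta>j (r k))) \<beta>)) \<and>
     (\<forall>\<mu> \<beta>j. \<forall>\<beta>\<in>L2_sym \<Omega>. (\<forall>j. \<mu> j \<in> vector_measures \<and> \<beta>j j \<in> L1_loc) \<and>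
        weakly_L2_sym \<Omega> (\<lambda>j. rescaled_strain w (\<alpha> j) (\<rho> j) (N j) (\<beta>j j)) \<beta> \<longrightarrow>
        F_super C \<Omega> \<beta> \<le>
          liminf (\<lambda>j. F_super_approx C w \<Omega> b1 b2 (\<alpha> j) (\<rho> j) (N j) (\<mu> j) (\<beta>j j))) \<and>
     (\<forall>\<beta>\<in>L2_sym \<Omega>. \<exists>\<mu> \<beta>j.
        (\<forall>j. \<mu> j \<in> vector_measures \<and> \<beta>j j \<in> L1_loc \<and>
             \<mu> j \<in> admissible_measures \<Omega> b1 b2 (\<rho> j) \<and>
             \<beta>j j \<in> admissible_strains \<Omega> (\<rho> j) (\<mu> j)) \<and>
        weakly_L2_sym \<Omega> (\<lambda>j. rescaled_strain w (\<alpha> j) (\<rho> j) (N j) (\<beta>j j)) \<beta> \<and>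
        limsup (\<lambda>j. F_super_approx C w \<Omega> b1 b2 (\<alpha> j) (\<rho> j) (N j) (\<mu> j) (\<beta>j j))
          \<le> F_super C \<Omega> \<beta>)"
proof -
  interpret elastic \<Omega> C w by unfold_locales (use assms in auto)
  interpret regime \<Omega> C w \<alpha> \<rho> N by unfold_locales (use assms in auto)
  show ?thesis
  proof (intro conjI allI ballI impI)
    fix \<mu> \<beta>j
    assume "(\<forall>j. \<mu> j \<in> vector_measures \<and> \<beta>j j \<in> L1_loc) \<and>
        (SUP j. F_super_approx C w \<Omega> b1 b2 (\<alpha> j) (\<rho> j) (N j) (\<mu> j) (\<beta>j j)) < \<infinity>"
    then show "\<exists>r :: nat \<Rightarrow> nat. \<exists>\<beta>\<in>L2_sym \<Omega>. strict_mono r \<and>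
           weakly_L2_sym \<Omega> (\<lambda>k. rescaled_strain w (\<alpha> (r k)) (\<rho> (r k)) (N (r k)) (\<beta>j (r k))) \<beta>"
      using assms by (intro compactness[where \<mu> = \<mu> and ?b1.0 = b1 and ?b2.0 = b2]) auto
  next
    fix \<mu> \<beta>j \<beta>
    assume "(\<forall>j. \<mu> j \<in> vector_measures \<and> \<beta>j j \<in> L1_loc) \<and>
        weakly_L2_sym \<Omega> (\<lambda>j. rescaled_strain w (\<alpha> j) (\<rho> j) (N j) (\<beta>j j)) \<beta>"
    then show "F_super C \<Omega> \<beta> \<le> liminf (\<lambda>j. F_super_approx C w \<Omega> b1 b2 (\<alpha> j) (\<rho> j) (N j) (\<mu> j) (\<beta>j j))"
      using assms by (intro liminf_inequality) auto
  next
    fix \<beta> assume "\<beta> \<in> L2_sym \<Omega>"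
    from limsup_inequality[OF assms(7,8,9,10) this]
    show "\<exists>\<mu> \<beta>j. (\<forall>j. \<mu> j \<in> vector_measures \<and> \<beta>j j \<in> L1_loc \<and>
             \<mu> j \<in> admissible_measures \<Omega> b1 b2 (\<rho> j) \<and>
             \<beta>j j \<in> admissible_strains \<Omega> (\<rho> j) (\<mu> j)) \<and>
        weakly_L2_sym \<Omega> (\<lambda>j. rescaled_strain w (\<alpha> j) (\<rho> j) (N j) (\<beta>j j)) \<beta> \<and>
        limsup (\<lambda>j. F_super_approx C w \<Omega> b1 b2 (\<alpha> j) (\<rho> j) (N j) (\<mu> j) (\<beta>j j)) \<le> F_super C \<Omega> \<beta>" .
  qed
qed

end
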